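(* Let $A$ be a separable unital $C^*$-algebra and let $(\mathcal{A},\mathsf{H}_A,D_A)$ be an odd spectral triple on $A$ with faithful representation $\pi:A\to\mathbb{B}(\mathsf{H}_A)$. Let $\Gamma$ be a discrete group equipped with a proper translation bounded function $l:\Gamma\to\mathbb{Z}$, and let $\alpha:\Gamma\to\mathrm{Aut}(A)$ be an action such that $\alpha_g(\mathcal{A})\subset\mathcal{A}$ for all $g\in\Gamma$ and $$\sup_{g\in\Gamma}\|[D_A,\pi(\alpha_g(a))]\|<\infty\quad\text{for every }a\in\mathcal{A}.$$ Let $\mathsf{H}=\mathsf{H}_A\otimes\ell^2(\Gamma)$, regard the reduced crossed product $A\rtimes_{r,\alpha}\Gamma$ as a subalgebra of $\mathbb{B}(\mathsf{H})$ via the covariant representation $$\tilde\pi(a)(\xi\otimes\delta_g)=\pi(\alpha_{g^{-1}}(a))\xi\otimes\delta_g,\qquad \lambda_h(\xi\otimes\delta_g)=\xi\otimes\delta_{hg}\qquad(a\in A,\ \xi\in\mathsf{H}_A,\ g,h\in\Gamma),$$ let it act diagonally ($x\mapsto x\oplus x$) on $\mathsf{H}\oplus\mathsf{H}$, and let $D$ be the operator on $\mathsf{H}\oplus\mathsf{H}$ given by $$D=\begin{bmatrix}0 & D_A\otimes 1-i\otimes M_l\\ D_A\otimes 1+i\otimes M_l & 0\end{bmatrix}.$$ Then $(C_c(\Gamma,\mathcal{A}),\mathsf{H}\oplus\mathsf{H},D)$ is an even spectral triple on $A\rtimes_{r,\alpha}\Gamma$. If $D_A$ is $p$-summable and $M_l$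 is $q$-summable, then $D$ is $(p+q)$-summable. If $D_A$ is non-degenerate, then so too is $D$.
   Context: An odd spectral triple $(\mathcal{A},\mathsf{H},D)$ on a separable unital $C^*$-algebra $A$ consists of a representation $\pi$ of $A$ on a separable Hilbert space $\mathsf{H}$, a dense $*$-subalgebra $\mathcal{A}\subset A$ and a densely defined self-adjoint operator $D$ on $\mathsf{H}$ such that $(1+D^2)^{-1/2}$ is compact and, for all $a\in\mathcal{A}$, $\pi(a)$ maps the domain of $D$ into itself and $[D,\pi(a)]$ extends to a bounded operator on $\mathsf{H}$. An even spectral triple is given by the same data together with a decomposition $\mathsf{H}=\mathsf{H}_0\oplus\mathsf{H}_1$ with respect to which $\pi=\pi_0\oplus\pi_1$ is diagonal and $D=\begin{bmatrix}0&D_0\\ D_0^*&0\end{bmatrix}$ is off-diagonal. For $p>0$, the triple (or $D$) is $p$-summable if $(1+D^2)^{-p/2}$ is trace class. The triple (or $D$) is non-degenerate if $\pi$ is faithful and, for $a\in\mathcal{A}$, $[D,\pi(a)]=0$ if and only if $a\in\mathbb{C}1$. A function $l:\Gamma\to\mathbb{Z}$ is a proper translation bounded function if: $l(g)=0$ if and only if $g$ is the identity; the sets $\{g\in\Gamma:l(g)=n\}$ are finite for each $n\in\mathbb{Z}$; and for each $g\in\Gamma$ the function $x\mapsto l(x)-l(g^{-1}x)$ is bounded on $\Gamma$. $M_l$ is the self-adjoint operator of multiplication by $l$ on $\ell^2(\Gamma)$ (the closure of its restriction to finitely supported vectors). $C_c(\Gamma,\mathcal{A})$ is the dense $*$-subalgebra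 of $A\rtimes_{r,\alpha}\Gamma$ consisting of finite sums $\sum_{g\in\Gamma}x_g\lambda_g$ with each $x_g\in\mathcal{A}$. *)

theory Defs
  imports "HOL-Analysis.Analysis" "HOL-Computational_Algebra.Polynomial"
begin

section \<open>Complex Hilbert spaces\<close>

class scaleC =
  fixes scaleC :: "complex \<Rightarrow> 'a \<Rightarrow> 'a"  (infixr \<open>*\<^sub>C\<close> 75)

class complex_normed_vector = real_normed_vector + scaleC +
  assumes scaleR_scaleC: "r *\<^sub>R x = complex_of_real r *\<^sub>C x"
    and scaleC_add_right: "c *\<^sub>C (x + y) = c *\<^sub>C x + c *\<^sub>C y"
    and scaleC_add_left: "(c + d) *\<^sub>C x = c *\<^sub>C x + d *\<^sub>C x"
    and scaleC_scaleC: "c *\<^sub>C d *\<^sub>C x = (c * d) *\<^sub>C x"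
    and norm_scaleC: "norm (c *\<^sub>C x) = cmod c * norm x"

lemma scaleC_one [simp]: "1 *\<^sub>C x = (x :: 'a::complex_normed_vector)"
  using scaleR_scaleC[of 1 x] by simp

global_interpretation complex_vector: vector_space
  "scaleC :: complex \<Rightarrow> 'a \<Rightarrow> 'a::complex_normed_vector"
  defines csubspace = complex_vector.subspace and cspan = complex_vector.span
  by unfold_locales (simp_all add: scaleC_add_right scaleC_add_left scaleC_scaleC)

(* The inner product is conjugate-linear in the first and linear in the second argument. *)
class complex_inner = complex_normed_vector +
  fixes cinner :: "'a \<Rightarrow> 'a \<Rightarrow> complex"
  assumes cinner_commute: "cinner x y = cnj (cinner y x)"
    and cinner_add_right: "cinner x (y + z) = cinner x y + cinner x z"
    and cinner_scaleC_right: "cinner x (c *\<^sub>C y) = c * cinner x y"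
    and cinner_self: "cinner x x = complex_of_real ((norm x)\<^sup>2)"

class chilbert_space = complex_inner + complete_space

subclass (in chilbert_space) banach ..

lemma cinner_add_left: "cinner (x + y) z = cinner x z + cinner y z"
  for x :: "'a::complex_inner"
  by (metis cinner_add_right cinner_commute complex_cnj_add)

lemma cinner_scaleC_left: "cinner (c *\<^sub>C x) y = cnj c * cinner x y"
  for x :: "'a::complex_inner"
  by (metis cinner_scaleC_right cinner_commute complex_cnj_mult)

lemma cinner_zero [simp]: "cinner x 0 = 0" "cinner 0 x = 0" for x :: "'a::complex_inner"
  using cinner_add_right[of x 0 0] cinner_add_left[of 0 0 x] by auto

lemma cinner_minus_right: "cinner x (- y) = - cinner x y" for x :: "'a::complex_inner"
  using cinner_add_right[of x y "- y"] by (simp add: add_eq_0_iff)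

lemma cinner_diff_right: "cinner x (y - z) = cinner x y - cinner x z" for x :: "'a::complex_inner"
  using cinner_add_right[of x y "- z"] by (simp add: cinner_minus_right)

lemma cinner_minus_left: "cinner (- x) y = - cinner x y" for x :: "'a::complex_inner"
  using cinner_add_left[of x "- x" y] by (simp add: add_eq_0_iff)

lemma cinner_diff_left: "cinner (x - y) z = cinner x z - cinner y z" for x :: "'a::complex_inner"
  using cinner_add_left[of x "- y" z] by (simp add: cinner_minus_left)

lemma cinner_sum_right: "cinner x (sum f F) = (\<Sum>i\<in>F. cinner x (f i))" for x :: "'a::complex_inner"
  by (induction F rule: infinite_finite_induct) (simp_all add: cinner_add_right)

lemma norm_plus_sq: "(norm (x + y))\<^sup>2 = (norm x)\<^sup>2 + (norm y)\<^sup>2 + 2 * Re (cinner x y)"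
  for x y :: "'a::complex_inner"
proof -
  have "complex_of_real ((norm (x + y))\<^sup>2) = cinner (x + y) (x + y)"
    by (simp add: cinner_self)
  also have "\<dots> = cinner x x + cinner y y + (cinner x y + cnj (cinner x y))"
    by (simp add: cinner_add_left cinner_add_right cinner_commute[of y x])
  also have "\<dots> = complex_of_real ((norm x)\<^sup>2 + (norm y)\<^sup>2 + 2 * Re (cinner x y))"
    by (simp add: cinner_self complex_add_cnj)
  finally show ?thesis
    using of_real_eq_iff by blast
qed

lemma parallelogram: "(norm (x + y))\<^sup>2 + (norm (x - y))\<^sup>2 = 2 * (norm x)\<^sup>2 + 2 * (norm y)\<^sup>2"
  for x y :: "'a::complex_inner"
  using norm_plus_sq[of x y] norm_plus_sq[of x "- y"] by (simp add: cinner_minus_right)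

lemma Re_cinner_le: "Re (cinner x y) \<le> norm x * norm y" for x y :: "'a::complex_inner"
proof -
  have "(norm x)\<^sup>2 + (norm y)\<^sup>2 + 2 * Re (cinner x y) \<le> (norm x + norm y)\<^sup>2"
    by (metis norm_plus_sq norm_triangle_ineq norm_ge_zero power_mono)
  then show ?thesis by (simp add: power2_sum)
qed

lemma cmod_cinner_le: "cmod (cinner x y) \<le> norm x * norm y" for x y :: "'a::complex_inner"
proof (cases "cinner x y = 0")
  case False
  define u where "u = cnj (cinner x y) / complex_of_real (cmod (cinner x y))"
  have "cmod u = 1" using False by (simp add: u_def norm_divide)
  moreover have "u * cinner x y = complex_of_real (cmod (cinner x y))"
  proof -
    have "u * cinner x y = complex_of_real ((cmod (cinner x y))\<^sup>2) / complex_of_real (cmod (cinner x y))"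
      unfolding u_def complex_norm_square by (simp add: mult.commute)
    then show ?thesis by (simp add: power2_eq_square)
  qed
  then have "Re (cinner x (u *\<^sub>C y)) = cmod (cinner x y)"
    by (simp add: cinner_scaleC_right)
  ultimately show ?thesis
    using Re_cinner_le[of x "u *\<^sub>C y"] by (simp add: norm_scaleC)
qed simp

lemma cinner_eqI: "(\<And>z. cinner z x = cinner z y) \<Longrightarrow> x = y" for x :: "'a::complex_inner"
proof -
  assume "\<And>z. cinner z x = cinner z y"
  then have "cinner (x - y) (x - y) = 0"
    by (simp add: cinner_diff_right)
  then show "x = y" by (simp add: cinner_self)
qed

instantiation complex :: chilbert_space
begin
definition scaleC_complex :: "complex \<Rightarrow> complex \<Rightarrow> complex" where "scaleC_complex c x = c * x"
definition cinner_complex :: "complex \<Rightarrow> complex \<Rightarrow> complex" where "cinner_complex x y = cnj x * y"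
instance
proof
  show "cinner x x = complex_of_real ((norm x)\<^sup>2)" for x :: complex
    by (simp only: cinner_complex_def complex_norm_square mult.commute)
qed (simp_all add: scaleC_complex_def cinner_complex_def scaleR_conv_of_real algebra_simps norm_mult)
end

instantiation prod :: (complex_normed_vector, complex_normed_vector) complex_normed_vector
begin
definition scaleC_prod :: "complex \<Rightarrow> 'a \<times> 'b \<Rightarrow> 'a \<times> 'b"
  where "scaleC_prod c x = (c *\<^sub>C fst x, c *\<^sub>C snd x)"
instance
proof
  show "norm (c *\<^sub>C x) = cmod c * norm x" for c and x :: "'a \<times> 'b"
  proof -
    have "norm (c *\<^sub>C x) = sqrt ((cmod c)\<^sup>2 * ((norm (fst x))\<^sup>2 + (norm (snd x))\<^sup>2))"
      by (simp only: scaleC_prod_def norm_prod_def norm_scaleC power_mult_distrib distrib_left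
          fst_conv snd_conv)
    then show ?thesis by (simp add: norm_prod_def real_sqrt_mult)
  qed
qed (simp_all add: scaleC_prod_def scaleR_prod_def scaleR_scaleC scaleC_add_right
    scaleC_add_left scaleC_scaleC)
end

instantiation prod :: (complex_inner, complex_inner) complex_inner
begin
definition cinner_prod :: "'a \<times> 'b \<Rightarrow> 'a \<times> 'b \<Rightarrow> complex"
  where "cinner_prod x y = cinner (fst x) (fst y) + cinner (snd x) (snd y)"
instance
proof
  show "cinner x y = cnj (cinner y x)" for x y :: "'a \<times> 'b"
    by (simp only: cinner_prod_def complex_cnj_add cinner_commute[symmetric])
  show "cinner x (y + z) = cinner x y + cinner x z" for x y z :: "'a \<times> 'b"
    by (simp add: cinner_prod_def cinner_add_right)
  show "cinner x (c *\<^sub>C y) = c * cinner x y" for x y :: "'a \<times> 'b" and c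
    by (simp add: cinner_prod_def scaleC_prod_def cinner_scaleC_right distrib_left)
  show "cinner x x = complex_of_real ((norm x)\<^sup>2)" for x :: "'a \<times> 'b"
    by (simp add: cinner_prod_def cinner_self norm_prod_def)
qed
end

instance prod :: (chilbert_space, chilbert_space) chilbert_space ..

section \<open>The Hilbert space of square-summable families\<close>

typedef (overloaded) ('g, 'h) ell2 =
    "{f :: 'g \<Rightarrow> 'h::complex_normed_vector. (\<lambda>g. (norm (f g))\<^sup>2) summable_on UNIV}"
  morphisms ell2_apply Abs_ell2
  by (intro exI[of _ "\<lambda>_. 0"]) simp

setup_lifting type_definition_ell2

lemma ell2_eqI: "(\<And>g. ell2_apply x g = ell2_apply y g) \<Longrightarrow> x = y"
  by (simp add: ell2_apply_inject[symmetric] fun_eq_iff)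

lemma ell2_summable: "(\<lambda>g. (norm (ell2_apply x g))\<^sup>2) summable_on UNIV"
  using ell2_apply[of x] by simp

lemma norm_add_sq_le: "(norm (x + y))\<^sup>2 \<le> 2 * (norm x)\<^sup>2 + 2 * (norm y)\<^sup>2"
  for x :: "'a::real_normed_vector"
proof -
  have "(norm (x + y))\<^sup>2 \<le> (norm x + norm y)\<^sup>2"
    by (simp add: norm_triangle_ineq power_mono)
  also have "\<dots> \<le> 2 * (norm x)\<^sup>2 + 2 * (norm y)\<^sup>2"
    using sum_squares_bound[of "norm x" "norm y"] by (simp add: power2_sum)
  finally show ?thesis .
qed

lemma sq_summable_add:
  fixes f h :: "'g \<Rightarrow> 'h::real_normed_vector"
  assumes "(\<lambda>g. (norm (f g))\<^sup>2) summable_on UNIV" "(\<lambda>g. (norm (h g))\<^sup>2) summable_on UNIV"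
  shows "(\<lambda>g. (norm (f g + h g))\<^sup>2) summable_on UNIV"
proof (rule summable_on_comparison_test)
  show "(\<lambda>g. 2 * (norm (f g))\<^sup>2 + 2 * (norm (h g))\<^sup>2) summable_on UNIV"
    by (intro summable_on_add summable_on_cmult_right assms)
qed (simp_all add: norm_add_sq_le)

instantiation ell2 :: (type, complex_normed_vector) "{real_normed_vector, scaleC}"
begin
lift_definition zero_ell2 :: "('a, 'b) ell2" is "\<lambda>_. 0" by simp
lift_definition plus_ell2 :: "('a, 'b) ell2 \<Rightarrow> ('a, 'b) ell2 \<Rightarrow> ('a, 'b) ell2"
  is "\<lambda>f h g. f g + h g" by (rule sq_summable_add)
lift_definition uminus_ell2 :: "('a, 'b) ell2 \<Rightarrow> ('a, 'b) ell2"
  is "\<lambda>f g. - f g" by simp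
lift_definition minus_ell2 :: "('a, 'b) ell2 \<Rightarrow> ('a, 'b) ell2 \<Rightarrow> ('a, 'b) ell2"
  is "\<lambda>f h g. f g - h g"
  subgoal for f h using sq_summable_add[of f "\<lambda>g. - h g"] by simp
  done
lift_definition scaleR_ell2 :: "real \<Rightarrow> ('a, 'b) ell2 \<Rightarrow> ('a, 'b) ell2"
  is "\<lambda>r f g. r *\<^sub>R f g" by (simp add: power_mult_distrib summable_on_cmult_right)
lift_definition scaleC_ell2 :: "complex \<Rightarrow> ('a, 'b) ell2 \<Rightarrow> ('a, 'b) ell2"
  is "\<lambda>c f g. c *\<^sub>C f g" by (simp add: norm_scaleC power_mult_distrib summable_on_cmult_right)
lift_definition norm_ell2 :: "('a, 'b) ell2 \<Rightarrow> real"
  is "\<lambda>f. sqrt (\<Sum>\<^sub>\<infinity>g. (norm (f g))\<^sup>2)" .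
definition sgn_ell2 :: "('a, 'b) ell2 \<Rightarrow> ('a, 'b) ell2" where "sgn_ell2 x = scaleR (inverse (norm x)) x"
definition dist_ell2 :: "('a, 'b) ell2 \<Rightarrow> ('a, 'b) ell2 \<Rightarrow> real" where "dist_ell2 x y = norm (x - y)"
definition [code del]: "(uniformity :: (('a, 'b) ell2 \<times> ('a, 'b) ell2) filter) =
  (INF e\<in>{0 <..}. principal {(x, y). dist x y < e})"
definition open_ell2 :: "('a, 'b) ell2 set \<Rightarrow> bool"
  where [code del]: "open_ell2 S = (\<forall>x\<in>S. \<forall>\<^sub>F (x', y) in uniformity. x' = x \<longrightarrow> y \<in> S)"

instance
proof
  fix x y z :: "('a, 'b) ell2" and r s :: real
  show "x + y + z = x + (y + z)" by transfer (simp add: add.assoc)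
  show "x + y = y + x" by transfer (simp add: add.commute)
  show "0 + x = x" by transfer simp
  show "- x + x = 0" by transfer simp
  show "x - y = x + - y" by transfer simp
  show "r *\<^sub>R (x + y) = r *\<^sub>R x + r *\<^sub>R y" by transfer (simp add: scaleR_add_right)
  show "(r + s) *\<^sub>R x = r *\<^sub>R x + s *\<^sub>R x" by transfer (simp add: scaleR_add_left)
  show "r *\<^sub>R s *\<^sub>R x = (r * s) *\<^sub>R x" by transfer simp
  show "1 *\<^sub>R x = x" by transfer simp
  show "sgn x = scaleR (inverse (norm x)) x" by (rule sgn_ell2_def)
  show "dist x y = norm (x - y)" by (rule dist_ell2_def)
  show "(uniformity :: (('a, 'b) ell2 \<times> ('a, 'b) ell2) filter) =
      (INF e\<in>{0 <..}. principal {(x, y). dist x y < e})" by (rule uniformity_ell2_def)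
  show "open S = (\<forall>x\<in>S. \<forall>\<^sub>F (x', y) in uniformity. x' = x \<longrightarrow> y \<in> S)" for S :: "('a, 'b) ell2 set"
    by (rule open_ell2_def)
  show "(norm x = 0) = (x = 0)"
  proof
    assume "norm x = 0"
    then have "(\<Sum>\<^sub>\<infinity>g. (norm (ell2_apply x g))\<^sup>2) = 0" by (simp add: norm_ell2.rep_eq)
    then have "(norm (ell2_apply x g))\<^sup>2 = 0" for g
      using nonneg_infsum_le_0D[OF _ ell2_summable[of x], of g] by simp
    then show "x = 0" by (intro ell2_eqI) (simp add: zero_ell2.rep_eq)
  qed (simp add: norm_ell2.rep_eq zero_ell2.rep_eq)
  show "norm (r *\<^sub>R x) = \<bar>r\<bar> * norm x"
    by transfer (simp add: power_mult_distrib infsum_cmult_right' real_sqrt_mult)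
  show "norm (x + y) \<le> norm x + norm y"
  proof -
    have "(\<Sum>\<^sub>\<infinity>g. (norm (ell2_apply (x + y) g))\<^sup>2) \<le> (norm x + norm y)\<^sup>2"
    proof (rule infsum_le_finite_sums[OF ell2_summable])
      fix F :: "'a set" assume F: "finite F" "F \<subseteq> UNIV"
      have le: "L2_set (\<lambda>g. norm (ell2_apply z g)) F \<le> norm z" for z :: "('a, 'b) ell2"
        unfolding L2_set_def norm_ell2.rep_eq
        by (intro real_sqrt_le_mono finite_sum_le_infsum ell2_summable F) auto
      have "L2_set (\<lambda>g. norm (ell2_apply (x + y) g)) F
          \<le> L2_set (\<lambda>g. norm (ell2_apply x g) + norm (ell2_apply y g)) F"
        by (intro L2_set_mono) (simp_all add: plus_ell2.rep_eq norm_triangle_ineq)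
      also have "\<dots> \<le> norm x + norm y"
        using L2_set_triangle_ineq[of "\<lambda>g. norm (ell2_apply x g)" "\<lambda>g. norm (ell2_apply y g)" F]
          le[of x] le[of y] by linarith
      finally have "(L2_set (\<lambda>g. norm (ell2_apply (x + y) g)) F)\<^sup>2 \<le> (norm x + norm y)\<^sup>2"
        by (intro power_mono L2_set_nonneg)
      then show "(\<Sum>g\<in>F. (norm (ell2_apply (x + y) g))\<^sup>2) \<le> (norm x + norm y)\<^sup>2"
        by (simp add: L2_set_def sum_nonneg)
    qed
    moreover have "0 \<le> norm x + norm y"
      by (simp add: norm_ell2.rep_eq infsum_nonneg)
    ultimately show ?thesis
      by (simp add: norm_ell2.rep_eq[of "x + y"] real_le_lsqrt infsum_nonneg)
  qed
qed
end

lemma ell2_norm_sq: "(norm x)\<^sup>2 = (\<Sum>\<^sub>\<infinity>g. (norm (ell2_apply x g))\<^sup>2)"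
  by (simp add: norm_ell2.rep_eq infsum_nonneg)

lemma ell2_norm_ge: "norm (ell2_apply x g) \<le> norm x"
proof -
  have "(norm (ell2_apply x g))\<^sup>2 \<le> (norm x)\<^sup>2"
    using finite_sum_le_infsum[OF ell2_summable[of x], of "{g}"] by (simp add: ell2_norm_sq)
  then show ?thesis by (rule power2_le_imp_le) simp
qed

instance ell2 :: (type, complex_normed_vector) complex_normed_vector
proof
  fix x y :: "('a, 'b) ell2" and c d :: complex and r :: real
  show "r *\<^sub>R x = complex_of_real r *\<^sub>C x" by transfer (simp add: scaleR_scaleC)
  show "c *\<^sub>C (x + y) = c *\<^sub>C x + c *\<^sub>C y" by transfer (simp add: scaleC_add_right)
  show "(c + d) *\<^sub>C x = c *\<^sub>C x + d *\<^sub>C x" by transfer (simp add: scaleC_add_left)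
  show "c *\<^sub>C d *\<^sub>C x = (c * d) *\<^sub>C x" by transfer (simp add: scaleC_scaleC)
  show "norm (c *\<^sub>C x) = cmod c * norm x"
    by transfer (simp add: norm_scaleC power_mult_distrib infsum_cmult_right' real_sqrt_mult)
qed

lemma ell2_cinner_summable:
  "(\<lambda>g. cinner (ell2_apply x g) (ell2_apply y g)) summable_on UNIV"
  for x :: "('g, 'h::complex_inner) ell2"
proof (rule abs_summable_summable, rule summable_on_comparison_test)
  show "(\<lambda>g. (norm (ell2_apply x g))\<^sup>2 + (norm (ell2_apply y g))\<^sup>2) summable_on UNIV"
    by (intro summable_on_add ell2_summable)
  show "norm (cinner (ell2_apply x g) (ell2_apply y g))
      \<le> (norm (ell2_apply x g))\<^sup>2 + (norm (ell2_apply y g))\<^sup>2" for g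
  proof -
    define a b where "a = norm (ell2_apply x g)" and "b = norm (ell2_apply y g)"
    have "2 * a * b \<le> a\<^sup>2 + b\<^sup>2" by (rule sum_squares_bound)
    moreover have "0 \<le> a * b" by (simp add: a_def b_def)
    moreover have "norm (cinner (ell2_apply x g) (ell2_apply y g)) \<le> a * b"
      unfolding a_def b_def by (rule cmod_cinner_le)
    ultimately show ?thesis unfolding a_def b_def by linarith
  qed
qed simp

instantiation ell2 :: (type, complex_inner) complex_inner
begin
definition cinner_ell2 :: "('a, 'b) ell2 \<Rightarrow> ('a, 'b) ell2 \<Rightarrow> complex"
  where "cinner_ell2 x y = (\<Sum>\<^sub>\<infinity>g. cinner (ell2_apply x g) (ell2_apply y g))"
instance
proof
  fix x y z :: "('a, 'b) ell2" and c :: complex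
  show "cinner x y = cnj (cinner y x)"
    by (simp only: cinner_ell2_def infsum_cnj[symmetric] cinner_commute[symmetric])
  show "cinner x (y + z) = cinner x y + cinner x z"
    by (simp add: cinner_ell2_def plus_ell2.rep_eq cinner_add_right infsum_add
        ell2_cinner_summable)
  show "cinner x (c *\<^sub>C y) = c * cinner x y"
    by (simp add: cinner_ell2_def scaleC_ell2.rep_eq cinner_scaleC_right infsum_cmult_right')
  show "cinner x x = complex_of_real ((norm x)\<^sup>2)"
    unfolding cinner_ell2_def ell2_norm_sq cinner_self
    by (intro infsumI has_sum_of_real has_sum_infsum ell2_summable)
qed
end

instance ell2 :: (type, chilbert_space) chilbert_space
proof
  fix X :: "nat \<Rightarrow> ('a, 'b) ell2" assume X: "Cauchy X"
  have "Cauchy (\<lambda>n. ell2_apply (X n) g)" for g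
  proof (rule metric_CauchyI)
    fix e :: real assume "e > 0"
    then obtain M where M: "\<And>m n. m \<ge> M \<Longrightarrow> n \<ge> M \<Longrightarrow> dist (X m) (X n) < e"
      using metric_CauchyD[OF X] by blast
    have "dist (ell2_apply (X m) g) (ell2_apply (X n) g) \<le> dist (X m) (X n)" for m n
      using ell2_norm_ge[of "X m - X n" g] by (simp add: dist_norm minus_ell2.rep_eq)
    then show "\<exists>M. \<forall>m\<ge>M. \<forall>n\<ge>M. dist (ell2_apply (X m) g) (ell2_apply (X n) g) < e"
      using M by (meson order_le_less_trans)
  qed
  then have "\<forall>g. \<exists>l. (\<lambda>n. ell2_apply (X n) g) \<longlonglongrightarrow> l"
    by (simp add: Cauchy_convergent convergent_def[symmetric])
  then obtain f where f: "\<And>g. (\<lambda>n. ell2_apply (X n) g) \<longlonglongrightarrow> f g" by metis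
  have fin: "(\<Sum>g\<in>F. (norm (ell2_apply (X m) g - f g))\<^sup>2) \<le> e\<^sup>2"
    if F: "finite F" and e: "\<And>n. n \<ge> M \<Longrightarrow> dist (X m) (X n) \<le> e" for F m M and e :: real
  proof (rule tendsto_upperbound)
    show "(\<lambda>n. \<Sum>g\<in>F. (norm (ell2_apply (X m) g - ell2_apply (X n) g))\<^sup>2)
        \<longlonglongrightarrow> (\<Sum>g\<in>F. (norm (ell2_apply (X m) g - f g))\<^sup>2)"
      by (intro tendsto_intros f)
    have "(\<Sum>g\<in>F. (norm (ell2_apply (X m) g - ell2_apply (X n) g))\<^sup>2) \<le> e\<^sup>2" if "n \<ge> M" for n
    proof -
      have "(\<Sum>g\<in>F. (norm (ell2_apply (X m - X n) g))\<^sup>2) \<le> (norm (X m - X n))\<^sup>2"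
        unfolding ell2_norm_sq by (intro finite_sum_le_infsum ell2_summable F) auto
      also have "\<dots> \<le> e\<^sup>2"
        using e[OF that] by (intro power_mono) (simp_all add: dist_norm)
      finally show ?thesis by (simp add: minus_ell2.rep_eq)
    qed
    then show "\<forall>\<^sub>F n in sequentially.
        (\<Sum>g\<in>F. (norm (ell2_apply (X m) g - ell2_apply (X n) g))\<^sup>2) \<le> e\<^sup>2"
      by (rule eventually_sequentiallyI)
  qed simp
  have diff: "(\<lambda>g. (norm (ell2_apply (X m) g - f g))\<^sup>2) summable_on UNIV"
    if e: "\<And>n. n \<ge> M \<Longrightarrow> dist (X m) (X n) \<le> e" for m M and e :: real
  proof (rule nonneg_bdd_above_summable_on)
    show "bdd_above (sum (\<lambda>g. (norm (ell2_apply (X m) g - f g))\<^sup>2) ` {F. F \<subseteq> UNIV \<and> finite F})"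
    proof (rule bdd_aboveI2)
      fix F :: "'a set" assume "F \<in> {F. F \<subseteq> UNIV \<and> finite F}"
      then show "(\<Sum>g\<in>F. (norm (ell2_apply (X m) g - f g))\<^sup>2) \<le> e\<^sup>2"
        using fin[OF _ e] by simp
    qed
  qed simp
  obtain M where M: "\<And>m n. m \<ge> M \<Longrightarrow> n \<ge> M \<Longrightarrow> dist (X m) (X n) < 1"
    using metric_CauchyD[OF X, of 1] by auto
  have "(\<lambda>g. (norm (ell2_apply (X M) g + - (ell2_apply (X M) g - f g)))\<^sup>2) summable_on UNIV"
  proof (rule sq_summable_add[OF ell2_summable], subst norm_minus_cancel)
    have "dist (X M) (X n) \<le> 1" if "n \<ge> M" for n
      using M[of M n] that by simp
    then show "(\<lambda>g. (norm (ell2_apply (X M) g - f g))\<^sup>2) summable_on UNIV" by (rule diff)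
  qed
  then have "f \<in> {f. (\<lambda>g. (norm (f g))\<^sup>2) summable_on UNIV}" by simp
  then have Rep: "ell2_apply (Abs_ell2 f) = f" by (rule Abs_ell2_inverse)
  have "X \<longlonglongrightarrow> Abs_ell2 f"
  proof (rule metric_LIMSEQ_I)
    fix e :: real assume "e > 0"
    then obtain N where N: "\<And>m n. m \<ge> N \<Longrightarrow> n \<ge> N \<Longrightarrow> dist (X m) (X n) < e / 2"
      using metric_CauchyD[OF X, of "e / 2"] by auto
    have "dist (X m) (Abs_ell2 f) < e" if "m \<ge> N" for m
    proof -
      have e: "\<And>n. n \<ge> N \<Longrightarrow> dist (X m) (X n) \<le> e / 2"
        using N[OF that] by (simp add: less_imp_le)
      have "(norm (X m - Abs_ell2 f))\<^sup>2 \<le> (e / 2)\<^sup>2"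
        unfolding ell2_norm_sq
      proof (rule infsum_le_finite_sums[OF ell2_summable])
        fix F :: "'a set" assume "finite F"
        then show "(\<Sum>g\<in>F. (norm (ell2_apply (X m - Abs_ell2 f) g))\<^sup>2) \<le> (e / 2)\<^sup>2"
          using fin[OF _ e] by (simp only: minus_ell2.rep_eq Rep)
      qed
      then have "norm (X m - Abs_ell2 f) \<le> e / 2"
        by (rule power2_le_imp_le) (use \<open>e > 0\<close> in simp)
      then show ?thesis using \<open>e > 0\<close> by (simp add: dist_norm)
    qed
    then show "\<exists>N. \<forall>n\<ge>N. dist (X n) (Abs_ell2 f) < e" by blast
  qed
  then show "convergent X" by (auto simp: convergent_def)
qed


lift_definition ell2_delta :: "'g \<Rightarrow> ('g, complex) ell2"
  is "\<lambda>g x. if x = g then 1 else 0"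
  subgoal for g
    by (rule finite_nonzero_values_imp_summable_on, rule finite_subset[of _ "{g}"]) auto
  done

(* The Hilbert tensor product of H and l^2(G) is realised as the space l^2(G; H); the elementary
   tensor of xi and u is the family g |-> u(g) xi.  The next two lemmas are the characterisation of
   the Hilbert tensor product: the inner product of elementary tensors, and their totality. *)
lift_definition tens :: "'h::complex_normed_vector \<Rightarrow> ('g, complex) ell2 \<Rightarrow> ('g, 'h) ell2"
  is "\<lambda>\<xi> u g. u g *\<^sub>C \<xi>"
  by (simp add: norm_scaleC power_mult_distrib summable_on_cmult_left)

lemma cinner_tens: "cinner (tens \<xi> u) (tens \<eta> v) = cinner \<xi> \<eta> * cinner u v"
  for \<xi> :: "'h::complex_inner"
proof -
  have "cinner (ell2_apply (tens \<xi> u) g) (ell2_apply (tens \<eta> v) g)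
      = cinner \<xi> \<eta> * cinner (ell2_apply u g) (ell2_apply v g)" for g
    by (simp add: tens.rep_eq cinner_scaleC_right cinner_scaleC_left cinner_complex_def)
  then show ?thesis
    by (simp add: cinner_ell2_def infsum_cmult_right')
qed

lemma ell2_apply_sum: "ell2_apply (sum f F) g = (\<Sum>i\<in>F. ell2_apply (f i) g)"
  by (induction F rule: infinite_finite_induct) (simp_all add: zero_ell2.rep_eq plus_ell2.rep_eq)

lemma tens_total:
  "closure (cspan (range (\<lambda>(\<xi>, u). tens \<xi> u))) = (UNIV :: ('g, 'h::complex_normed_vector) ell2 set)"
proof -
  have "x \<in> closure (cspan (range (\<lambda>(\<xi>, u). tens \<xi> u)))" for x :: "('g, 'h) ell2"
    unfolding closure_approachable
  proof (intro allI impI)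
    fix e :: real assume e: "e > 0"
    obtain F where F: "finite F"
      and le: "dist (\<Sum>g\<in>F. (norm (ell2_apply x g))\<^sup>2) (\<Sum>\<^sub>\<infinity>g. (norm (ell2_apply x g))\<^sup>2) \<le> e\<^sup>2 / 2"
      using infsum_finite_approximation[OF ell2_summable[of x], of "e\<^sup>2 / 2"] e by auto
    define y where "y = (\<Sum>g\<in>F. tens (ell2_apply x g) (ell2_delta g))"
    have y: "ell2_apply y h = (if h \<in> F then ell2_apply x h else 0)" for h
    proof -
      have "ell2_apply y h = (\<Sum>g\<in>F. if h = g then ell2_apply x g else 0)"
        unfolding y_def ell2_apply_sum
        by (intro sum.cong refl) (simp add: tens.rep_eq ell2_delta.rep_eq)
      then show ?thesis using F by simp
    qed
    have "(norm (x - y))\<^sup>2 = (\<Sum>\<^sub>\<infinity>g. (norm (ell2_apply (x - y) g))\<^sup>2)"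
      by (rule ell2_norm_sq)
    also have "\<dots> = (\<Sum>\<^sub>\<infinity>g\<in>UNIV - F. (norm (ell2_apply x g))\<^sup>2)"
      by (rule infsum_cong_neutral) (auto simp: minus_ell2.rep_eq y)
    also have "\<dots> = (\<Sum>\<^sub>\<infinity>g. (norm (ell2_apply x g))\<^sup>2) - (\<Sum>g\<in>F. (norm (ell2_apply x g))\<^sup>2)"
      using F by (simp add: infsum_Diff ell2_summable)
    also have "\<dots> < e\<^sup>2"
      using le zero_less_power[OF e, of 2] unfolding dist_real_def by linarith
    finally have "norm (x - y) < e"
      using e by (simp add: power2_less_imp_less)
    moreover have "y \<in> cspan (range (\<lambda>(\<xi>, u). tens \<xi> u))"
      unfolding y_def by (intro complex_vector.span_sum complex_vector.span_base) auto
    ultimately show "\<exists>y\<in>cspan (range (\<lambda>(\<xi>, u). tens \<xi> u)). dist y x < e"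
      by (auto simp: dist_norm norm_minus_commute)
  qed
  then show ?thesis by auto
qed

section \<open>C*-algebras and bounded operators\<close>

class star =
  fixes star :: "'a \<Rightarrow> 'a"

(* No unit is required here: unital C*-algebras are carriers inside such a type, with a unit of
   their own. *)
class cstar_algebra = complex_normed_vector + real_normed_algebra + complete_space + star +
  assumes mult_scaleC_left: "(c *\<^sub>C x) * y = c *\<^sub>C (x * y)"
    and mult_scaleC_right: "x * (c *\<^sub>C y) = c *\<^sub>C (x * y)"
    and star_star: "star (star x) = x"
    and star_add: "star (x + y) = star x + star y"
    and star_scaleC: "star (c *\<^sub>C x) = cnj c *\<^sub>C star x"
    and star_mult: "star (x * y) = star y * star x"
    and cstar_identity: "norm (star x * x) = (norm x)\<^sup>2"

definition bounded_clinear :: "('h::complex_normed_vector \<Rightarrow> 'k::complex_normed_vector) \<Rightarrow> bool"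
  where "bounded_clinear f \<longleftrightarrow> bounded_linear f \<and> (\<forall>c x. f (c *\<^sub>C x) = c *\<^sub>C f x)"

lemma riesz_representation:
  fixes \<phi> :: "'h::chilbert_space \<Rightarrow> complex"
  assumes "bounded_clinear \<phi>"
  obtains z where "\<And>x. cinner z x = \<phi> x"
proof -
  interpret bounded_linear \<phi> using assms by (simp add: bounded_clinear_def)
  have scaleC: "\<phi> (c *\<^sub>C x) = c * \<phi> x" for c x
    using assms by (simp add: bounded_clinear_def scaleC_complex_def)
  define J where "J x = (norm x)\<^sup>2 - 2 * Re (\<phi> x)" for x
  obtain K where K: "\<And>x. norm (\<phi> x) \<le> norm x * K" using bounded by blast
  have J_ge: "- (K\<^sup>2) \<le> J x" for x
  proof -
    have "Re (\<phi> x) \<le> norm x * K" using K[of x] complex_Re_le_cmod[of "\<phi> x"] by linarith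
    moreover have "0 \<le> (norm x - K)\<^sup>2" by simp
    ultimately show ?thesis unfolding J_def power2_diff by linarith
  qed
  have bdd: "bdd_below (range J)" using J_ge by (intro bdd_belowI2)
  define m where "m = Inf (range J)"
  have m_le: "m \<le> J x" for x unfolding m_def by (intro cInf_lower bdd) simp
  have "\<exists>x. J x < m + 1 / real (Suc n)" for n
  proof -
    have "Inf (range J) < m + 1 / real (Suc n)" by (simp add: m_def)
    then show ?thesis using cInf_lessD[of "range J"] by blast
  qed
  then obtain X where X: "\<And>n. J (X n) < m + 1 / real (Suc n)" by metis
  have J_diff: "(norm (x - y))\<^sup>2 \<le> 2 * (J x - m) + 2 * (J y - m)" for x y
  proof -
    define h where "h = (1/2) *\<^sub>R (x + y)"
    have "4 * J h = (norm (x + y))\<^sup>2 - 4 * Re (\<phi> x) - 4 * Re (\<phi> y)"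
      unfolding J_def h_def scaleR add norm_scaleR power_mult_distrib
      by (simp add: power2_eq_square field_simps)
    moreover have "N \<le> 2 * (X - 2 * a - m) + 2 * (Y - 2 * b - m)"
      if "4 * j = P - 4 * a - 4 * b" "P + N = 2 * X + 2 * Y" "m \<le> j"
      for N X Y P a b j :: real
      using that by simp
    ultimately show ?thesis
      unfolding J_def[of x] J_def[of y] using parallelogram[of x y] m_le[of h] by blast
  qed
  have "Cauchy X"
  proof (rule metric_CauchyI)
    fix e :: real assume e: "e > 0"
    obtain N where N: "1 / real (Suc N) < e\<^sup>2 / 4"
      using reals_Archimedean[of "e\<^sup>2 / 4"] e by (auto simp: inverse_eq_divide)
    have *: "J (X n) - m < e\<^sup>2 / 4" if "n \<ge> N" for n
    proof -
      have "1 / real (Suc n) \<le> 1 / real (Suc N)" using that by (simp add: frac_le)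
      then show ?thesis using X[of n] N by linarith
    qed
    have "dist (X i) (X j) < e" if "i \<ge> N" "j \<ge> N" for i j
    proof -
      have "(norm (X i - X j))\<^sup>2 < e\<^sup>2"
        by (rule order_le_less_trans[OF J_diff]) (use *[OF that(1)] *[OF that(2)] in simp)
      then show ?thesis using e by (simp add: dist_norm power2_less_imp_less)
    qed
    then show "\<exists>M. \<forall>m\<ge>M. \<forall>n\<ge>M. dist (X m) (X n) < e" by blast
  qed
  then obtain z where z: "X \<longlonglongrightarrow> z"
    using Cauchy_convergent convergent_def by blast
  have "(\<lambda>n. J (X n)) \<longlonglongrightarrow> J z"
    unfolding J_def by (intro tendsto_intros z tendsto)
  moreover have "(\<lambda>n. m + 1 / real (Suc n)) \<longlonglongrightarrow> m + 0"
    by (intro tendsto_add tendsto_const) (use LIMSEQ_inverse_real_of_nat in \<open>simp add: inverse_eq_divide\<close>)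
  ultimately have "J z \<le> m + 0"
    by (rule LIMSEQ_le) (use X in \<open>auto intro: less_imp_le\<close>)
  then have min: "J z \<le> J y" for y using m_le[of y] by linarith
  have Re_eq: "Re (cinner z h) = Re (\<phi> h)" for h
  proof -
    define c where "c = Re (cinner z h) - Re (\<phi> h)"
    define N where "N = (norm h)\<^sup>2"
    have N: "N \<ge> 0" by (simp add: N_def)
    have ge: "0 \<le> t\<^sup>2 * N + 2 * (t * c)" for t :: real
    proof -
      have "cinner z (t *\<^sub>R h) = t * cinner z h" by (simp add: scaleR_scaleC cinner_scaleC_right)
      then have "J (z + t *\<^sub>R h) = J z + t\<^sup>2 * N + 2 * (t * c)"
        unfolding J_def norm_plus_sq add scaleR norm_scaleR power_mult_distrib c_def N_def
        by (simp add: algebra_simps)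
      then show ?thesis using min[of "z + t *\<^sub>R h"] by linarith
    qed
    define t where "t = - c / (N + 1)"
    have c: "c = - (t * (N + 1))" using N by (simp add: t_def)
    have "t\<^sup>2 * (N + 2) = - (t\<^sup>2 * N + 2 * (t * c))"
      unfolding c by (simp add: algebra_simps power2_eq_square)
    then have "t\<^sup>2 * (N + 2) \<le> 0" using ge[of t] by linarith
    moreover have "N + 2 > 0" using N by simp
    ultimately have "t = 0" by (simp add: mult_le_0_iff)
    then have "c = 0" by (simp add: c)
    then show ?thesis by (simp add: c_def)
  qed
  have "cinner z x = \<phi> x" for x
    using Re_eq[of x] Re_eq[of "\<i> *\<^sub>C x"]
    by (simp add: complex_eq_iff scaleC cinner_scaleC_right)
  then show ?thesis by (rule that)
qed

typedef (overloaded) 'h bop = "{f :: 'h::chilbert_space \<Rightarrow> 'h. bounded_clinear f}"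
  morphisms bop_apply Abs_bop
  by (intro exI[of _ "\<lambda>_. 0"]) (simp add: bounded_clinear_def)

setup_lifting type_definition_bop

lemma bop_eqI: "(\<And>x. bop_apply S x = bop_apply T x) \<Longrightarrow> S = T"
  by (simp add: bop_apply_inject[symmetric] fun_eq_iff)

lemma bounded_linear_bop: "bounded_linear (bop_apply T)"
  and bop_scaleC: "bop_apply T (c *\<^sub>C x) = c *\<^sub>C bop_apply T x"
  using bop_apply[of T] by (simp_all add: bounded_clinear_def)

lemmas bop_add = linear_add[OF bounded_linear.linear[OF bounded_linear_bop]]
  and bop_scaleR = linear_scale[OF bounded_linear.linear[OF bounded_linear_bop]]
  and bop_zero [simp] = linear_0[OF bounded_linear.linear[OF bounded_linear_bop]]

definition is_adjoint :: "('h::chilbert_space \<Rightarrow> 'h) \<Rightarrow> ('h \<Rightarrow> 'h) \<Rightarrow> bool"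
  where "is_adjoint f f' \<longleftrightarrow> (\<forall>x y. cinner (f' y) x = cinner y (f x))"

lemma ex_adjoint:
  assumes "bounded_clinear f"
  obtains f' where "is_adjoint f f'" "bounded_clinear f'"
proof -
  interpret bounded_linear f using assms by (simp add: bounded_clinear_def)
  have scaleC: "f (c *\<^sub>C x) = c *\<^sub>C f x" for c x
    using assms by (simp add: bounded_clinear_def)
  obtain K where K: "\<And>x. norm (f x) \<le> norm x * K" and "K > 0"
    using pos_bounded by blast
  have "\<exists>z. \<forall>x. cinner z x = cinner y (f x)" for y
  proof -
    have "bounded_clinear (\<lambda>x. cinner y (f x))"
      unfolding bounded_clinear_def
    proof (intro conjI allI bounded_linear_intro[of _ "norm y * K"])
      show "norm (cinner y (f x)) \<le> norm x * (norm y * K)" for x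
        using cmod_cinner_le[of y "f x"] mult_left_mono[OF K[of x] norm_ge_zero[of y]]
        by (simp add: ac_simps)
    qed (simp_all add: add scaleR scaleR_scaleC scaleC cinner_add_right cinner_scaleC_right
        scaleC_complex_def)
    then show ?thesis by (metis riesz_representation)
  qed
  then obtain f' where f': "\<And>x y. cinner (f' y) x = cinner y (f x)" by metis
  have f'2: "cinner x (f' y) = cinner (f x) y" for x y
    by (metis f' cinner_commute)
  have "bounded_clinear f'"
    unfolding bounded_clinear_def
  proof (intro conjI allI bounded_linear_intro[of _ K])
    show "f' (x + y) = f' x + f' y" for x y
      by (rule cinner_eqI) (simp add: f'2 cinner_add_right)
    show sC: "f' (c *\<^sub>C y) = c *\<^sub>C f' y" for c y
      by (rule cinner_eqI) (simp add: f'2 cinner_scaleC_right)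
    show "f' (r *\<^sub>R x) = r *\<^sub>R f' x" for r x
      by (simp only: scaleR_scaleC sC)
    show "norm (f' y) \<le> norm y * K" for y
    proof (cases "f' y = 0")
      case False
      have "(norm (f' y))\<^sup>2 = cmod (cinner (f' y) (f' y))" by (simp add: cinner_self norm_power)
      also have "\<dots> = cmod (cinner y (f (f' y)))" by (simp only: f')
      also have "\<dots> \<le> norm y * (norm (f' y) * K)"
        by (rule order_trans[OF cmod_cinner_le]) (intro mult_left_mono K norm_ge_zero)
      finally have "norm (f' y) * norm (f' y) \<le> norm (f' y) * (norm y * K)"
        by (simp only: power2_eq_square ac_simps)
      then show ?thesis using False by simp
    qed (use \<open>K > 0\<close> in simp)
  qed
  moreover have "is_adjoint f f'" unfolding is_adjoint_def by (simp add: f')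
  ultimately show ?thesis using that by blast
qed

lemma is_adjoint_unique: "is_adjoint f f1 \<Longrightarrow> is_adjoint f f2 \<Longrightarrow> f1 = f2"
  unfolding is_adjoint_def by (metis cinner_commute cinner_eqI ext)

lemma the_adjoint:
  assumes "bounded_clinear f"
  shows "is_adjoint f (THE f'. is_adjoint f f')" "bounded_clinear (THE f'. is_adjoint f f')"
proof -
  obtain f' where f': "is_adjoint f f'" "bounded_clinear f'"
    using ex_adjoint[OF assms] by blast
  then have "(THE f'. is_adjoint f f') = f'"
    using is_adjoint_unique by blast
  with f' show "is_adjoint f (THE f'. is_adjoint f f')" "bounded_clinear (THE f'. is_adjoint f f')"
    by simp_all
qed

instantiation bop :: (chilbert_space) "{real_normed_vector, scaleC, times, star}"
begin
lift_definition zero_bop :: "'a bop" is "\<lambda>_. 0" by (simp add: bounded_clinear_def)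
lift_definition plus_bop :: "'a bop \<Rightarrow> 'a bop \<Rightarrow> 'a bop" is "\<lambda>f g x. f x + g x"
  by (simp add: bounded_clinear_def bounded_linear_add scaleC_add_right)
lift_definition uminus_bop :: "'a bop \<Rightarrow> 'a bop" is "\<lambda>f x. - f x"
  by (simp add: bounded_clinear_def bounded_linear_minus complex_vector.scale_minus_right)
lift_definition minus_bop :: "'a bop \<Rightarrow> 'a bop \<Rightarrow> 'a bop" is "\<lambda>f g x. f x - g x"
  by (simp add: bounded_clinear_def bounded_linear_sub complex_vector.scale_right_diff_distrib)
lift_definition scaleC_bop :: "complex \<Rightarrow> 'a bop \<Rightarrow> 'a bop" is "\<lambda>c f x. c *\<^sub>C f x"
  subgoal for c f
  proof -
    assume f: "bounded_clinear f"
    then interpret bounded_linear f by (simp add: bounded_clinear_def)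
    obtain K where K: "\<And>x. norm (f x) \<le> norm x * K" using bounded by blast
    have "bounded_linear (\<lambda>x. c *\<^sub>C f x)"
    proof (rule bounded_linear_intro[of _ "cmod c * K"])
      show "norm (c *\<^sub>C f x) \<le> norm x * (cmod c * K)" for x
        using mult_left_mono[OF K[of x] norm_ge_zero[of c]] by (simp add: norm_scaleC ac_simps)
      show "c *\<^sub>C f (r *\<^sub>R x) = r *\<^sub>R (c *\<^sub>C f x)" for r x
        unfolding scaleR by (simp add: scaleR_scaleC scaleC_scaleC mult.commute)
    qed (simp add: add scaleC_add_right)
    with f show ?thesis by (simp add: bounded_clinear_def scaleC_scaleC ac_simps)
  qed
  done
lift_definition scaleR_bop :: "real \<Rightarrow> 'a bop \<Rightarrow> 'a bop" is "\<lambda>r f x. r *\<^sub>R f x"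
  unfolding bounded_clinear_def
  by (auto intro: bounded_linear_const_scaleR) (simp add: scaleR_scaleC scaleC_scaleC mult.commute)
lift_definition times_bop :: "'a bop \<Rightarrow> 'a bop \<Rightarrow> 'a bop" is "\<lambda>f g x. f (g x)"
  by (simp add: bounded_clinear_def bounded_linear_compose)
lift_definition star_bop :: "'a bop \<Rightarrow> 'a bop" is "\<lambda>f. THE f'. is_adjoint f f'"
  by (rule the_adjoint)
lift_definition norm_bop :: "'a bop \<Rightarrow> real" is onorm .
definition sgn_bop :: "'a bop \<Rightarrow> 'a bop" where "sgn_bop x = scaleR (inverse (norm x)) x"
definition dist_bop :: "'a bop \<Rightarrow> 'a bop \<Rightarrow> real" where "dist_bop x y = norm (x - y)"
definition [code del]: "(uniformity :: ('a bop \<times> 'a bop) filter) =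
  (INF e\<in>{0 <..}. principal {(x, y). dist x y < e})"
definition open_bop :: "'a bop set \<Rightarrow> bool"
  where [code del]: "open_bop S = (\<forall>x\<in>S. \<forall>\<^sub>F (x', y) in uniformity. x' = x \<longrightarrow> y \<in> S)"
instance
proof
  fix x y z :: "'a bop" and r s :: real
  show "x + y + z = x + (y + z)" by transfer (simp add: add.assoc)
  show "x + y = y + x" by transfer (simp add: add.commute)
  show "0 + x = x" by transfer simp
  show "- x + x = 0" by transfer simp
  show "x - y = x + - y" by transfer simp
  show "r *\<^sub>R (x + y) = r *\<^sub>R x + r *\<^sub>R y" by transfer (simp add: scaleR_add_right)
  show "(r + s) *\<^sub>R x = r *\<^sub>R x + s *\<^sub>R x" by transfer (simp add: scaleR_add_left)
  show "r *\<^sub>R s *\<^sub>R x = (r * s) *\<^sub>R x" by transfer simp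
  show "1 *\<^sub>R x = x" by transfer simp
  show "sgn x = scaleR (inverse (norm x)) x" by (rule sgn_bop_def)
  show "dist x y = norm (x - y)" by (rule dist_bop_def)
  show "(uniformity :: ('a bop \<times> 'a bop) filter) =
      (INF e\<in>{0 <..}. principal {(x, y). dist x y < e})" by (rule uniformity_bop_def)
  show "open S = (\<forall>x\<in>S. \<forall>\<^sub>F (x', y) in uniformity. x' = x \<longrightarrow> y \<in> S)" for S :: "'a bop set"
    by (rule open_bop_def)
  show "(norm x = 0) = (x = 0)"
    by transfer (auto simp: bounded_clinear_def onorm_eq_0 fun_eq_iff)
  show "norm (r *\<^sub>R x) = \<bar>r\<bar> * norm x"
    by transfer (simp add: bounded_clinear_def onorm_scaleR)
  show "norm (x + y) \<le> norm x + norm y"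
    by transfer (simp add: bounded_clinear_def onorm_triangle)
qed
end

lemma norm_bop_apply: "norm (bop_apply T x) \<le> norm T * norm x"
  by transfer (simp add: bounded_clinear_def onorm)

lemma norm_bop_le: "(\<And>x. norm (bop_apply T x) \<le> K * norm x) \<Longrightarrow> 0 \<le> K \<Longrightarrow> norm T \<le> K"
  by transfer (rule onorm_bound)

lemma cinner_star_left: "cinner (bop_apply (star T) y) x = cinner y (bop_apply T x)"
  using the_adjoint(1)[OF bop_apply[unfolded mem_Collect_eq], of T]
  unfolding is_adjoint_def star_bop.rep_eq by blast

lemma cinner_star_right: "cinner x (bop_apply (star T) y) = cinner (bop_apply T x) y"
  using cinner_star_left[of T y x] by (metis cinner_commute)

instance bop :: (chilbert_space) cstar_algebra
proof
  fix x y z :: "'a bop" and c d :: complex and r :: real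
  show "r *\<^sub>R x = complex_of_real r *\<^sub>C x" by transfer (simp add: scaleR_scaleC)
  show "c *\<^sub>C (x + y) = c *\<^sub>C x + c *\<^sub>C y" by transfer (simp add: scaleC_add_right)
  show "(c + d) *\<^sub>C x = c *\<^sub>C x + d *\<^sub>C x" by transfer (simp add: scaleC_add_left)
  show "c *\<^sub>C d *\<^sub>C x = (c * d) *\<^sub>C x" by transfer (simp add: scaleC_scaleC)
  have norm_le: "norm (c *\<^sub>C x) \<le> cmod c * norm x" for c and x :: "'a bop"
    by (rule norm_bop_le)
      (simp_all add: scaleC_bop.rep_eq norm_scaleC mult.assoc mult_left_mono norm_bop_apply)
  show "norm (c *\<^sub>C x) = cmod c * norm x"
  proof (cases "c = 0")
    case True
    then show ?thesis using norm_le[of c x] by simp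
  next
    case False
    have "x = inverse c *\<^sub>C c *\<^sub>C x"
      using False by (intro bop_eqI) (simp add: scaleC_bop.rep_eq scaleC_scaleC)
    then have "norm x \<le> cmod (inverse c) * norm (c *\<^sub>C x)" by (metis norm_le)
    then have "cmod c * norm x \<le> norm (c *\<^sub>C x)"
      using mult_left_mono[OF _ norm_ge_zero[of c]] False
      by (fastforce simp: norm_inverse simp flip: mult.assoc)
    then show ?thesis using norm_le[of c x] by linarith
  qed
  show "x * y * z = x * (y * z)" by transfer simp
  show "(x + y) * z = x * z + y * z" by transfer simp
  show "x * (y + z) = x * y + x * z"
    by (rule bop_eqI) (simp add: times_bop.rep_eq plus_bop.rep_eq bop_add)
  show "(r *\<^sub>R x) * y = r *\<^sub>R (x * y)" by transfer simp
  show "x * (r *\<^sub>R y) = r *\<^sub>R (x * y)"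
    by (rule bop_eqI) (simp add: times_bop.rep_eq scaleR_bop.rep_eq bop_scaleR)
  show mult_le: "norm (x * y) \<le> norm x * norm y" for x y :: "'a bop"
  proof (rule norm_bop_le)
    show "norm (bop_apply (x * y) v) \<le> norm x * norm y * norm v" for v
      using norm_bop_apply[of x "bop_apply y v"]
        mult_left_mono[OF norm_bop_apply[of y v] norm_ge_zero[of x]]
      by (simp add: times_bop.rep_eq mult.assoc)
  qed simp
  show "(c *\<^sub>C x) * y = c *\<^sub>C (x * y)" by transfer simp
  show "x * (c *\<^sub>C y) = c *\<^sub>C (x * y)"
    by (rule bop_eqI) (simp add: times_bop.rep_eq scaleC_bop.rep_eq bop_scaleC)
  show star_star: "star (star x) = x" for x :: "'a bop"
    by (rule bop_eqI, rule cinner_eqI) (simp add: cinner_star_right cinner_star_left)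
  show "star (x + y) = star x + star y"
    by (rule bop_eqI, rule cinner_eqI)
      (simp add: cinner_star_right plus_bop.rep_eq cinner_add_left cinner_add_right)
  show "star (c *\<^sub>C x) = cnj c *\<^sub>C star x"
    by (rule bop_eqI, rule cinner_eqI)
      (simp add: cinner_star_right scaleC_bop.rep_eq cinner_scaleC_left cinner_scaleC_right)
  show "star (x * y) = star y * star x"
    by (rule bop_eqI, rule cinner_eqI) (simp add: cinner_star_right times_bop.rep_eq)
  show "norm (star x * x) = (norm x)\<^sup>2"
  proof -
    have sq: "(norm (bop_apply x v))\<^sup>2 \<le> norm (star x * x) * (norm v)\<^sup>2" for x :: "'a bop" and v
    proof -
      have "(norm (bop_apply x v))\<^sup>2 = cmod (cinner (bop_apply (star x * x) v) v)"
        by (simp add: times_bop.rep_eq cinner_star_left cinner_self norm_power)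
      also have "\<dots> \<le> norm (bop_apply (star x * x) v) * norm v" by (rule cmod_cinner_le)
      also have "\<dots> \<le> norm (star x * x) * norm v * norm v"
        by (intro mult_right_mono norm_bop_apply norm_ge_zero)
      finally show ?thesis by (simp only: power2_eq_square ac_simps)
    qed
    have ge: "(norm x)\<^sup>2 \<le> norm (star x * x)" for x :: "'a bop"
    proof -
      have "norm x \<le> sqrt (norm (star x * x))"
      proof (rule norm_bop_le)
        show "norm (bop_apply x v) \<le> sqrt (norm (star x * x)) * norm v" for v
          using real_sqrt_le_mono[OF sq[of x v]] by (simp add: real_sqrt_mult)
      qed simp
      then show ?thesis using power_mono[of "norm x" "sqrt (norm (star x * x))" 2] by simp
    qed
    have le: "norm x \<le> norm (star x)" for x :: "'a bop"
    proof (cases "norm x = 0")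
      case False
      have "norm x * norm x \<le> norm (star x) * norm x"
        using order_trans[OF ge[of x] mult_le] by (simp only: power2_eq_square)
      then show ?thesis using False by simp
    qed simp
    have "norm (star x) = norm x" using le[of x] le[of "star x"] by (simp add: star_star)
    then have "norm (star x * x) \<le> (norm x)\<^sup>2"
      using mult_le[of "star x" x] by (simp only: power2_eq_square)
    then show ?thesis using ge[of x] by linarith
  qed
  show "convergent X" if X: "Cauchy X" for X :: "nat \<Rightarrow> 'a bop"
  proof -
    define Y where "Y n = Blinfun (bop_apply (X n))" for n
    have Y: "blinfun_apply (Y n) = bop_apply (X n)" for n
      unfolding Y_def by (rule bounded_linear_Blinfun_apply[OF bounded_linear_bop])
    have dist_Y: "dist (Y i) (Y j) = dist (X i) (X j)" for i j
    proof -
      have "blinfun_apply (Y i - Y j) = bop_apply (X i - X j)"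
        by (simp add: fun_eq_iff blinfun.diff_left Y minus_bop.rep_eq)
      then show ?thesis by (simp add: dist_norm norm_blinfun.rep_eq norm_bop.rep_eq)
    qed
    have "Cauchy Y" using X by (simp add: Cauchy_def dist_Y)
    then obtain L where L: "Y \<longlonglongrightarrow> L" using Cauchy_convergent convergent_def by blast
    have lim: "(\<lambda>n. bop_apply (X n) v) \<longlonglongrightarrow> blinfun_apply L v" for v
      using blinfun.tendsto[OF L tendsto_const[of v]] by (simp add: Y)
    have "blinfun_apply L (c *\<^sub>C v) = c *\<^sub>C blinfun_apply L v" for c v
    proof (rule LIMSEQ_unique[OF lim])
      have "(\<lambda>n. c *\<^sub>C (bop_apply (X n) v - blinfun_apply L v)) \<longlonglongrightarrow> 0"
        by (rule tendsto_norm_zero_cancel)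
          (use tendsto_mult_right_zero[OF tendsto_norm_zero[OF LIM_zero[OF lim[of v]]], of "cmod c"]
            in \<open>simp add: norm_scaleC\<close>)
      then have "(\<lambda>n. c *\<^sub>C bop_apply (X n) v - c *\<^sub>C blinfun_apply L v) \<longlonglongrightarrow> 0"
        by (simp add: complex_vector.scale_right_diff_distrib)
      then show "(\<lambda>n. bop_apply (X n) (c *\<^sub>C v)) \<longlonglongrightarrow> c *\<^sub>C blinfun_apply L v"
        by (simp add: bop_scaleC LIM_zero_iff)
    qed
    then have "bounded_clinear (blinfun_apply L)"
      by (simp add: bounded_clinear_def blinfun.bounded_linear_right)
    then have apply_L: "bop_apply (Abs_bop (blinfun_apply L)) = blinfun_apply L"
      by (simp add: Abs_bop_inverse)
    have dist_L: "dist (X n) (Abs_bop (blinfun_apply L)) = dist (Y n) L" for n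
    proof -
      have "blinfun_apply (Y n - L) = bop_apply (X n - Abs_bop (blinfun_apply L))"
        by (simp add: fun_eq_iff blinfun.diff_left Y minus_bop.rep_eq apply_L)
      then show ?thesis by (simp add: dist_norm norm_blinfun.rep_eq norm_bop.rep_eq)
    qed
    have "X \<longlonglongrightarrow> Abs_bop (blinfun_apply L)"
      using L by (simp add: tendsto_dist_iff[of X] tendsto_dist_iff[of Y] dist_L)
    then show ?thesis by (auto simp: convergent_def)
  qed
qed

instantiation bop :: (chilbert_space) monoid_mult
begin
lift_definition one_bop :: "'a bop" is "\<lambda>x. x" by (simp add: bounded_clinear_def)
instance by standard (transfer, simp)+
end


definition cstar_hom :: "'a::cstar_algebra set \<Rightarrow> ('a \<Rightarrow> 'b::cstar_algebra) \<Rightarrow> bool"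
  where "cstar_hom A \<phi> \<longleftrightarrow> (\<forall>x\<in>A. \<forall>y\<in>A. \<phi> (x + y) = \<phi> x + \<phi> y \<and> \<phi> (x * y) = \<phi> x * \<phi> y)
    \<and> (\<forall>c. \<forall>x\<in>A. \<phi> (c *\<^sub>C x) = c *\<^sub>C \<phi> x) \<and> (\<forall>x\<in>A. \<phi> (star x) = star (\<phi> x))"

definition cstar_aut :: "'a::cstar_algebra set \<Rightarrow> ('a \<Rightarrow> 'a) \<Rightarrow> bool"
  where "cstar_aut A \<phi> \<longleftrightarrow> cstar_hom A \<phi> \<and> bij_betw \<phi> A A"

definition star_subalgebra :: "'a::cstar_algebra set \<Rightarrow> bool"
  where "star_subalgebra A \<longleftrightarrow> csubspace A \<and> (\<forall>x\<in>A. \<forall>y\<in>A. x * y \<in> A) \<and> (\<forall>x\<in>A. star x \<in> A)"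

definition is_unit_of :: "'a::cstar_algebra set \<Rightarrow> 'a \<Rightarrow> bool"
  where "is_unit_of A e \<longleftrightarrow> e \<in> A \<and> (\<forall>x\<in>A. e * x = x \<and> x * e = x)"

definition unit_of :: "'a::cstar_algebra set \<Rightarrow> 'a"
  where "unit_of A = (THE e. is_unit_of A e)"

definition unital_cstar :: "'a::cstar_algebra set \<Rightarrow> bool"
  where "unital_cstar A \<longleftrightarrow> star_subalgebra A \<and> closed A \<and> (\<exists>e. is_unit_of A e)"

lift_definition bop_dsum :: "'h::chilbert_space bop \<Rightarrow> 'k::chilbert_space bop \<Rightarrow> ('h \<times> 'k) bop"
  is "\<lambda>f g x. (f (fst x), g (snd x))"
  by (auto simp: bounded_clinear_def scaleC_prod_def
      intro!: bounded_linear_Pair bounded_linear_compose[OF _ bounded_linear_fst]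
        bounded_linear_compose[OF _ bounded_linear_snd])

section \<open>Compact operators, real powers and trace class\<close>

definition compact_bop :: "'h::chilbert_space bop \<Rightarrow> bool"
  where "compact_bop T \<longleftrightarrow> compact (closure (bop_apply T ` cball 0 1))"

definition poly_bop :: "real poly \<Rightarrow> 'h::chilbert_space bop \<Rightarrow> 'h bop"
  where "poly_bop p T = (\<Sum>i\<le>degree p. coeff p i *\<^sub>R T ^ i)"

(* The power T^s (s > 0) of a positive operator T by continuous functional calculus: the norm limit
   of p_n(T) for polynomials p_n converging uniformly to x^s on [0, norm T], an interval that
   contains the spectrum of T. *)
definition bop_powr :: "'h::chilbert_space bop \<Rightarrow> real \<Rightarrow> 'h bop"
  where "bop_powr T s = (THE S. \<forall>p :: nat \<Rightarrow> real poly.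
    uniform_limit {0..norm T} (\<lambda>n. poly (p n)) (\<lambda>x. x powr s) sequentially \<longrightarrow>
    (\<lambda>n. poly_bop (p n) T) \<longlonglongrightarrow> S)"

definition orthonormal_basis :: "'h::chilbert_space set \<Rightarrow> bool"
  where "orthonormal_basis B \<longleftrightarrow> (\<forall>x\<in>B. \<forall>y\<in>B. cinner x y = (if x = y then 1 else 0))
    \<and> closure (cspan B) = UNIV"

(* The sum over a basis of the diagonal entries of |T| = (T* T)^(1/2); it does not depend on the
   basis. *)
definition trace_class :: "'h::chilbert_space bop \<Rightarrow> bool"
  where "trace_class T \<longleftrightarrow> (\<exists>B. orthonormal_basis B \<and>
    (\<lambda>e. cinner e (bop_apply (bop_powr (star T * T) (1 / 2)) e)) summable_on B)"

section \<open>Unbounded operators\<close>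

(* A partially defined operator from H to K is identified with its graph, a subset of the product;
   its domain is Domain G, its closure is closure G, and S O T applies S first. *)

definition densely_defined :: "('h::complex_normed_vector \<times> 'k::complex_normed_vector) set \<Rightarrow> bool"
  where "densely_defined G \<longleftrightarrow> csubspace G \<and> single_valued G \<and> closure (Domain G) = UNIV"

definition op_adj :: "('h::complex_inner \<times> 'k::complex_inner) set \<Rightarrow> ('k \<times> 'h) set"
  where "op_adj G = {(y, z). \<forall>(x, w)\<in>G. cinner y w = cinner z x}"

definition selfadjoint_op :: "('h::complex_inner \<times> 'h) set \<Rightarrow> bool"
  where "selfadjoint_op D \<longleftrightarrow> densely_defined D \<and> op_adj D = D"

definition op_plus :: "('h \<times> 'k::plus) set \<Rightarrow> ('h \<times> 'k) set \<Rightarrow> ('h \<times> 'k) set"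
  where "op_plus S T = {(x, y + z) | x y z. (x, y) \<in> S \<and> (x, z) \<in> T}"

definition op_minus :: "('h \<times> 'k::minus) set \<Rightarrow> ('h \<times> 'k) set \<Rightarrow> ('h \<times> 'k) set"
  where "op_minus S T = {(x, y - z) | x y z. (x, y) \<in> S \<and> (x, z) \<in> T}"

definition bop_graph :: "'h::chilbert_space bop \<Rightarrow> ('h \<times> 'h) set"
  where "bop_graph T = {(x, bop_apply T x) | x. True}"

(* The matrix with rows (0, S) and (T, 0). *)
definition op_offdiag :: "('k \<times> 'h) set \<Rightarrow> ('h \<times> 'k) set \<Rightarrow> (('h \<times> 'k) \<times> ('h \<times> 'k)) set"
  where "op_offdiag S T = {((x, y), (u, v)) | x y u v. (y, u) \<in> S \<and> (x, v) \<in> T}"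

definition op_tensor :: "('h::complex_normed_vector \<times> 'h) set
    \<Rightarrow> (('g, complex) ell2 \<times> ('g, complex) ell2) set \<Rightarrow> (('g, 'h) ell2 \<times> ('g, 'h) ell2) set"
  where "op_tensor S T =
    closure (cspan {(tens x u, tens y v) | x y u v. (x, y) \<in> S \<and> (u, v) \<in> T})"

(* The bounded operator (1 + D^2)^(-1); its powers s give (1 + D^2)^(-s). *)
definition inverse_one_plus_sq :: "('h::chilbert_space \<times> 'h) set \<Rightarrow> 'h bop"
  where "inverse_one_plus_sq D = (THE R. bop_graph R = (op_plus Id (D O D))\<inverse>)"

definition summable_op :: "real \<Rightarrow> ('h::chilbert_space \<times> 'h) set \<Rightarrow> bool"
  where "summable_op p D \<longleftrightarrow> trace_class (bop_powr (inverse_one_plus_sq D) (p / 2))"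

definition commutator_graph :: "('h::chilbert_space \<times> 'h) set \<Rightarrow> 'h bop \<Rightarrow> ('h \<times> 'h) set"
  where "commutator_graph D T = op_minus (bop_graph T O D) (D O bop_graph T)"

definition bounded_commutator :: "('h::chilbert_space \<times> 'h) set \<Rightarrow> 'h bop \<Rightarrow> bool"
  where "bounded_commutator D T \<longleftrightarrow> bop_apply T ` Domain D \<subseteq> Domain D \<and>
    (\<exists>S. commutator_graph D T \<subseteq> bop_graph S)"

(* The bounded extension of [D, T] to the whole space, unique when D is densely defined. *)
definition commutator :: "('h::chilbert_space \<times> 'h) set \<Rightarrow> 'h bop \<Rightarrow> 'h bop"
  where "commutator D T = (THE S. commutator_graph D T \<subseteq> bop_graph S)"

section \<open>Spectral triples\<close>

(* A representation is a *-homomorphism into the bounded operators, not required to preserve the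
   unit; likewise the dense subalgebra is not required to contain the unit. *)
definition odd_spectral_triple ::
    "'a::cstar_algebra set \<Rightarrow> 'a set \<Rightarrow> ('a \<Rightarrow> 'h::chilbert_space bop) \<Rightarrow> ('h \<times> 'h) set \<Rightarrow> bool"
  where "odd_spectral_triple A \<A> \<pi> D \<longleftrightarrow>
    unital_cstar A \<and> separable_space (top_of_set A) \<and>
    separable_space (euclidean :: 'h topology) \<and> cstar_hom A \<pi> \<and>
    star_subalgebra \<A> \<and> \<A> \<subseteq> A \<and> A \<subseteq> closure \<A> \<and>
    selfadjoint_op D \<and> compact_bop (bop_powr (inverse_one_plus_sq D) (1 / 2)) \<and>
    (\<forall>a\<in>\<A>. bounded_commutator D (\<pi> a))"

(* The decomposition of the Hilbert space is the one given by the product type. *)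
definition even_spectral_triple ::
    "'a::cstar_algebra set \<Rightarrow> 'a set \<Rightarrow> ('a \<Rightarrow> ('h::chilbert_space \<times> 'k::chilbert_space) bop)
      \<Rightarrow> (('h \<times> 'k) \<times> ('h \<times> 'k)) set \<Rightarrow> bool"
  where "even_spectral_triple A \<A> \<pi> D \<longleftrightarrow> odd_spectral_triple A \<A> \<pi> D \<and>
    (\<exists>\<pi>0 \<pi>1. cstar_hom A \<pi>0 \<and> cstar_hom A \<pi>1 \<and> (\<forall>a\<in>A. \<pi> a = bop_dsum (\<pi>0 a) (\<pi>1 a))) \<and>
    (\<exists>D0. densely_defined D0 \<and> D = op_offdiag D0 (op_adj D0))"

definition nondegenerate ::
    "'a::cstar_algebra set \<Rightarrow> 'a set \<Rightarrow> ('a \<Rightarrow> 'h::chilbert_space bop) \<Rightarrow> ('h \<times> 'h) set \<Rightarrow> bool"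
  where "nondegenerate A \<A> \<pi> D \<longleftrightarrow> inj_on \<pi> A \<and>
    (\<forall>a\<in>\<A>. commutator D (\<pi> a) = 0 \<longleftrightarrow> (\<exists>c. a = c *\<^sub>C unit_of A))"

section \<open>Crossed products\<close>

(* Discrete groups are types of class group_add, which need not be commutative and are written
   additively: - g + x stands for the product of the inverse of g with x. *)

definition proper_translation_bounded :: "('g::group_add \<Rightarrow> int) \<Rightarrow> bool"
  where "proper_translation_bounded l \<longleftrightarrow> (\<forall>g. l g = 0 \<longleftrightarrow> g = 0) \<and> (\<forall>n. finite {g. l g = n}) \<and>
    (\<forall>g. \<exists>C. \<forall>x. \<bar>l x - l (- g + x)\<bar> \<le> C)"

definition mult_op :: "('g \<Rightarrow> int) \<Rightarrow> (('g, complex) ell2 \<times> ('g, complex) ell2) set"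
  where "mult_op l = closure {(u, v). finite {g. ell2_apply u g \<noteq> 0} \<and>
    (\<forall>g. ell2_apply v g = of_int (l g) * ell2_apply u g)}"

definition action_on :: "'a::cstar_algebra set \<Rightarrow> ('g::group_add \<Rightarrow> 'a \<Rightarrow> 'a) \<Rightarrow> bool"
  where "action_on A \<alpha> \<longleftrightarrow> (\<forall>g. cstar_aut A (\<alpha> g)) \<and> (\<forall>a\<in>A. \<alpha> 0 a = a) \<and>
    (\<forall>g h. \<forall>a\<in>A. \<alpha> (g + h) a = \<alpha> g (\<alpha> h a))"

(* The covariant representation; the formulas on elementary tensors determine these bounded
   operators by linearity and continuity. *)
definition covariant_rep ::
    "('a \<Rightarrow> 'h::chilbert_space bop) \<Rightarrow> ('g::group_add \<Rightarrow> 'a \<Rightarrow> 'a) \<Rightarrow> 'a \<Rightarrow> ('g, 'h) ell2 bop"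
  where "covariant_rep \<pi> \<alpha> a = (THE T. \<forall>\<xi> g. bop_apply T (tens \<xi> (ell2_delta g)) =
    tens (bop_apply (\<pi> (\<alpha> (- g) a)) \<xi>) (ell2_delta g))"

definition translation :: "'g::group_add \<Rightarrow> ('g, 'h::chilbert_space) ell2 bop"
  where "translation h = (THE T. \<forall>\<xi> g. bop_apply T (tens \<xi> (ell2_delta g)) =
    tens \<xi> (ell2_delta (h + g)))"

definition crossed_Cc ::
    "'a set \<Rightarrow> ('a \<Rightarrow> 'h::chilbert_space bop) \<Rightarrow> ('g::group_add \<Rightarrow> 'a \<Rightarrow> 'a) \<Rightarrow> ('g, 'h) ell2 bop set"
  where "crossed_Cc \<A> \<pi> \<alpha> = {\<Sum>g\<in>F. covariant_rep \<pi> \<alpha> (x g) * translation g | F x.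
    finite F \<and> (\<forall>g\<in>F. x g \<in> \<A>)}"

(* For a faithful representation, the reduced crossed product, as the norm closed algebra of
   operators generated by the covariant representation. *)
definition reduced_crossed_product ::
    "'a set \<Rightarrow> ('a \<Rightarrow> 'h::chilbert_space bop) \<Rightarrow> ('g::group_add \<Rightarrow> 'a \<Rightarrow> 'a) \<Rightarrow> ('g, 'h) ell2 bop set"
  where "reduced_crossed_product A \<pi> \<alpha> = closure (crossed_Cc A \<pi> \<alpha>)"

definition crossed_dirac :: "('h::chilbert_space \<times> 'h) set \<Rightarrow> ('g \<Rightarrow> int)
    \<Rightarrow> ((('g, 'h) ell2 \<times> ('g, 'h) ell2) \<times> (('g, 'h) ell2 \<times> ('g, 'h) ell2)) set"
  where "crossed_dirac D\<^sub>A l =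
    (let D1 = op_tensor D\<^sub>A Id; iM = op_tensor {(\<xi>, \<i> *\<^sub>C \<xi>) | \<xi>. True} (mult_op l)
     in op_offdiag (op_minus D1 iM) (op_plus D1 iM))"

end

theory Submission
  imports Defs
begin

text \<open>Everything is computed in a basis of eigenvectors. Identify \<open>H\<^sub>A \<otimes> l\<^sup>2(\<Gamma>)\<close> with the square-summable
  families in \<open>H\<^sub>A\<close> indexed by \<open>\<Gamma>\<close>. Then \<open>D\<^sub>A \<otimes> 1 \<plusminus> i \<otimes> M\<^sub>l\<close> acts fibrewise, as \<open>D\<^sub>A \<plusminus> i l(g)\<close> on the fibre
  over \<open>g\<close>. For self-adjoint \<open>D\<^sub>A\<close> one has \<open>norm (D\<^sub>A \<xi> \<plusminus> i l(g) \<xi>)\<^sup>2 = norm (D\<^sub>A \<xi>)\<^sup>2 + l(g)\<^sup>2 norm \<xi>\<^sup>2\<close>,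
  so the sum of the two closed operators is again the full fibrewise operator (\<open>op_plus_fibre_op\<close>). Adjoints of
  fibrewise operators are taken fibre by fibre, whence \<open>D\<^sub>A \<otimes> 1 \<plusminus> i \<otimes> M\<^sub>l\<close> are adjoint to each other and the
  off-diagonal operator \<open>D\<close> is self-adjoint (\<open>selfadjoint_crossed_dirac\<close>).

  The resolvent \<open>(1 + D\<^sub>A\<^sup>2)\<^sup>-\<^sup>1\<close> is compact, positive and injective, so it has an orthonormal basis of
  eigenvectors \<open>b\<close> with eigenvalues \<open>0 < r\<^sub>b \<le> 1\<close> (\<open>compact_positive_eigenbasis\<close>). The mixed terms of \<open>D\<^sup>2\<close>
  cancel, so \<open>b \<otimes> \<delta>\<^sub>g\<close> in either summand is an eigenvector of \<open>(1 + D\<^sup>2)\<^sup>-\<^sup>1\<close> with eigenvalue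
  \<open>1 / (1 / r\<^sub>b + l(g)\<^sup>2)\<close> (\<open>crossed_dirac_resolvent\<close>). Compactness means that only finitely many eigenvalues
  exceed a given positive bound (\<open>compact_resolvent_iff\<close>), which follows from the same property of \<open>D\<^sub>A\<close>
  and the properness of \<open>l\<close>. Summability means that a power of the eigenvalues is summable (\<open>summable_op_iff\<close>); since
  the new eigenvalue is at most \<open>r\<^sub>b\<close> and at most \<open>1 / (1 + l(g)\<^sup>2)\<close>, its power \<open>(p + q) / 2\<close> is at most
  \<open>r\<^sub>b\<^sup>p\<^sup>/\<^sup>2 (1 + l(g)\<^sup>2)\<^sup>-\<^sup>q\<^sup>/\<^sup>2\<close>, which is summable over pairs.

  Both facts presuppose that the functional calculus defining real powers makes sense for the resolvent before it
  is known to be compact. This rests on the estimate \<open>norm (p(T)) \<le> sup \<bar>p\<bar>\<close> over \<open>[0, norm T]\<close> for positive \<open>T\<close>,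
  obtained from Bernstein expansions (\<open>pos_poly_bop\<close>, \<open>norm_poly_bop_le\<close>).

  The covariant representation is bounded because *-homomorphisms are contractive (\<open>cstar_hom_norm_le\<close>).
  Commutators with \<open>D\<close> are bounded for the generators: with \<open>\<lambda>\<^sub>h\<close> the commutator is multiplication by
  \<open>\<plusminus> i (l(g) - l(h\<^sup>-\<^sup>1 g))\<close>, and with an element of the dense subalgebra it is the family of commutators
  \<open>[D\<^sub>A, \<pi>(\<alpha>\<^sub>g\<^sup>-\<^sup>1(a))]\<close>, bounded by hypothesis; the Leibniz rule extends this to the whole algebra. Finally, an
  element \<open>\<Sum> x\<^sub>g \<lambda>\<^sub>g\<close> commuting with \<open>D\<close> commutes with both \<open>D\<^sub>A \<otimes> 1\<close> and \<open>1 \<otimes> M\<^sub>l\<close>; applied to \<open>\<xi> \<otimes> \<delta>\<^sub>0\<close>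
  the latter kills every \<open>x\<^sub>g\<close> with \<open>l(g) \<noteq> 0\<close>, and the former makes the remaining coefficient scalar.\<close>

section \<open>Hilbert space geometry\<close>

lemma bounded_bilinear_cinner:
  "bounded_bilinear (cinner :: 'h::complex_inner \<Rightarrow> 'h \<Rightarrow> complex)"
proof
  show "\<exists>K. \<forall>a b :: 'h. norm (cinner a b) \<le> norm a * norm b * K"
    by (intro exI[of _ 1]) (simp add: cmod_cinner_le)
qed (simp_all add: cinner_add_left cinner_add_right scaleR_scaleC cinner_scaleC_left
    cinner_scaleC_right scaleC_complex_def)

lemma bounded_bilinear_scaleC:
  "bounded_bilinear (scaleC :: complex \<Rightarrow> 'h::complex_normed_vector \<Rightarrow> 'h)"
proof
  show "\<exists>K. \<forall>a (b :: 'h). norm (a *\<^sub>C b) \<le> norm a * norm b * K"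
    by (intro exI[of _ 1]) (simp add: norm_scaleC)
qed (simp_all add: scaleC_add_left scaleC_add_right scaleR_scaleC scaleC_scaleC ac_simps
    scaleC_complex_def)

lemmas tendsto_scaleC = bounded_bilinear.tendsto[OF bounded_bilinear_scaleC]
lemmas bounded_linear_cinner_right = bounded_bilinear.bounded_linear_right[OF bounded_bilinear_cinner]
lemmas continuous_on_cinner = bounded_bilinear.continuous_on[OF bounded_bilinear_cinner]
lemmas continuous_on_scaleC = bounded_bilinear.continuous_on[OF bounded_bilinear_scaleC]

lemma cinner_sum_left: "cinner (sum f F) x = (\<Sum>i\<in>F. cinner (f i) x)" for x :: "'a::complex_inner"
  by (induction F rule: infinite_finite_induct) (simp_all add: cinner_add_left)

lemma csubspace_diff: "csubspace M \<Longrightarrow> x \<in> M \<Longrightarrow> y \<in> M \<Longrightarrow> x - y \<in> M"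
  by (rule complex_vector.subspace_diff)

lemma csubspace_scaleR: "csubspace M \<Longrightarrow> x \<in> M \<Longrightarrow> r *\<^sub>R x \<in> M"
  by (simp add: scaleR_scaleC complex_vector.subspace_scale)

lemma csubspace_closure: "csubspace (closure M)" if M: "csubspace M"
proof (rule complex_vector.subspaceI)
  show "0 \<in> closure M"
    using complex_vector.subspace_0[OF M] closure_subset by blast
next
  fix x y assume "x \<in> closure M" "y \<in> closure M"
  then obtain f g where "\<And>n. f n \<in> M" "f \<longlonglongrightarrow> x" "\<And>n. g n \<in> M" "g \<longlonglongrightarrow> y"
    unfolding closure_sequential by blast
  then show "x + y \<in> closure M"
    unfolding closure_sequential
    by (intro exI[of _ "\<lambda>n. f n + g n"]) (auto intro: complex_vector.subspace_add[OF M] tendsto_add)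
next
  fix c x assume "x \<in> closure M"
  then obtain f where "\<And>n. f n \<in> M" "f \<longlonglongrightarrow> x"
    unfolding closure_sequential by blast
  then show "c *\<^sub>C x \<in> closure M"
    unfolding closure_sequential
    by (intro exI[of _ "\<lambda>n. c *\<^sub>C f n"])
      (auto intro: complex_vector.subspace_scale[OF M] tendsto_scaleC)
qed

text \<open>A minimizing sequence for the distance to a closed subspace is Cauchy by the parallelogram
  law; minimality of the limit makes the remainder orthogonal to the subspace.\<close>

lemma orthogonal_projection:
  fixes M :: "'h::chilbert_space set"
  assumes M: "csubspace M" and "closed M"
  obtains p where "p \<in> M" "\<And>h. h \<in> M \<Longrightarrow> cinner h (x - p) = 0"
proof -
  define J where "J y = (norm (x - y))\<^sup>2" for y
  define m where "m = Inf (J ` M)"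
  have bdd: "bdd_below (J ` M)" by (intro bdd_belowI2[of _ 0]) (simp add: J_def)
  have ne: "J ` M \<noteq> {}" using complex_vector.subspace_0[OF M] by blast
  have m_le: "m \<le> J y" if "y \<in> M" for y unfolding m_def by (intro cInf_lower bdd imageI that)
  have "\<exists>y\<in>M. J y < m + 1 / real (Suc n)" for n
  proof -
    have "Inf (J ` M) < m + 1 / real (Suc n)" by (simp add: m_def)
    then show ?thesis using cInf_lessD[OF ne] by blast
  qed
  then obtain X where X: "\<And>n. X n \<in> M" "\<And>n. J (X n) < m + 1 / real (Suc n)" by metis
  have J_diff: "(norm (y - z))\<^sup>2 \<le> 2 * (J y - m) + 2 * (J z - m)" if "y \<in> M" "z \<in> M" for y z
  proof -
    define h where "h = (1/2) *\<^sub>R (y + z)"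
    have h: "h \<in> M" unfolding h_def by (intro csubspace_scaleR[OF M] complex_vector.subspace_add[OF M] that)
    have "(x - y) + (x - z) = 2 *\<^sub>R (x - h)" by (simp add: h_def algebra_simps scaleR_2)
    then have "(norm ((x - y) + (x - z)))\<^sup>2 = 4 * J h" by (simp add: J_def power_mult_distrib)
    moreover have "(x - y) - (x - z) = - (y - z)" by simp
    then have "(norm ((x - y) - (x - z)))\<^sup>2 = (norm (y - z))\<^sup>2" by (simp only: norm_minus_cancel)
    ultimately show ?thesis
      using parallelogram[of "x - y" "x - z"] m_le[OF h] by (simp add: J_def)
  qed
  have "Cauchy X"
  proof (rule metric_CauchyI)
    fix e :: real assume e: "e > 0"
    obtain N where N: "1 / real (Suc N) < e\<^sup>2 / 4"
      using reals_Archimedean[of "e\<^sup>2 / 4"] e by (auto simp: inverse_eq_divide)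
    have *: "J (X n) - m < e\<^sup>2 / 4" if "n \<ge> N" for n
    proof -
      have "1 / real (Suc n) \<le> 1 / real (Suc N)" using that by (simp add: frac_le)
      then show ?thesis using X(2)[of n] N by linarith
    qed
    have "dist (X i) (X j) < e" if "i \<ge> N" "j \<ge> N" for i j
    proof -
      have "(norm (X i - X j))\<^sup>2 < e\<^sup>2"
        by (rule order_le_less_trans[OF J_diff[OF X(1) X(1)]]) (use *[OF that(1)] *[OF that(2)] in simp)
      then show ?thesis using e by (simp add: dist_norm power2_less_imp_less)
    qed
    then show "\<exists>M. \<forall>m\<ge>M. \<forall>n\<ge>M. dist (X m) (X n) < e" by blast
  qed
  then obtain p where p: "X \<longlonglongrightarrow> p"
    using Cauchy_convergent convergent_def by blast
  then have pM: "p \<in> M" using \<open>closed M\<close> X(1) closed_sequentially by blast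
  have "(\<lambda>n. J (X n)) \<longlonglongrightarrow> J p"
    unfolding J_def by (intro tendsto_intros p)
  moreover have "(\<lambda>n. m + 1 / real (Suc n)) \<longlonglongrightarrow> m + 0"
    by (intro tendsto_add tendsto_const) (use LIMSEQ_inverse_real_of_nat in \<open>simp add: inverse_eq_divide\<close>)
  ultimately have "J p \<le> m + 0"
    by (rule LIMSEQ_le) (use X in \<open>auto intro: less_imp_le\<close>)
  then have min: "J p \<le> J y" if "y \<in> M" for y using m_le[OF that] by linarith
  have Re0: "Re (cinner h (x - p)) = 0" if h: "h \<in> M" for h
  proof -
    define c where "c = Re (cinner h (x - p))"
    define N where "N = (norm h)\<^sup>2"
    have N: "N \<ge> 0" by (simp add: N_def)
    have ge: "0 \<le> t\<^sup>2 * N - 2 * (t * c)" for t :: real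
    proof -
      have "x - (p + t *\<^sub>R h) = (- t) *\<^sub>R h + (x - p)" by simp
      then have "J (p + t *\<^sub>R h) = t\<^sup>2 * N + J p + 2 * Re (cinner ((- t) *\<^sub>R h) (x - p))"
        unfolding J_def N_def by (simp only: norm_plus_sq norm_scaleR power_mult_distrib) simp
      also have "Re (cinner ((- t) *\<^sub>R h) (x - p)) = - t * c"
        by (simp add: c_def scaleR_scaleC cinner_scaleC_left cinner_minus_left)
      finally show ?thesis
        using min[OF complex_vector.subspace_add[OF M pM csubspace_scaleR[OF M h]], of t] by simp
    qed
    define t where "t = c / (N + 1)"
    have c: "c = t * (N + 1)" using N by (simp add: t_def)
    have "t\<^sup>2 * (N + 2) = - (t\<^sup>2 * N - 2 * (t * c))"
      unfolding c by (simp add: algebra_simps power2_eq_square)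
    then have "t\<^sup>2 * (N + 2) \<le> 0" using ge[of t] by linarith
    moreover have "N + 2 > 0" using N by simp
    ultimately have "t = 0" by (simp add: mult_le_0_iff)
    then show ?thesis using c by (simp add: c_def)
  qed
  have "cinner h (x - p) = 0" if "h \<in> M" for h
    using Re0[OF that] Re0[OF complex_vector.subspace_scale[OF M that, of \<i>]]
    by (simp add: complex_eq_iff cinner_scaleC_left)
  then show ?thesis using pM that by blast
qed

definition orthonormal :: "'h::complex_inner set \<Rightarrow> bool"
  where "orthonormal B \<longleftrightarrow> (\<forall>x\<in>B. \<forall>y\<in>B. cinner x y = (if x = y then 1 else 0))"

text \<open>Projecting onto the closed span leaves a remainder orthogonal to every basis vector.\<close>

lemma orthonormal_basisI:
  fixes B :: "'h::chilbert_space set"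
  assumes "orthonormal B" and tot: "\<And>x. (\<And>b. b \<in> B \<Longrightarrow> cinner b x = 0) \<Longrightarrow> x = 0"
  shows "orthonormal_basis B"
proof -
  have "x \<in> closure (cspan B)" for x
  proof -
    obtain p where p: "p \<in> closure (cspan B)" "\<And>h. h \<in> closure (cspan B) \<Longrightarrow> cinner h (x - p) = 0"
      using orthogonal_projection[OF csubspace_closure[OF complex_vector.subspace_span] closed_closure]
      by blast
    have "x - p = 0"
    proof (rule tot, rule p(2))
      fix b assume "b \<in> B"
      then show "b \<in> closure (cspan B)" using closure_subset complex_vector.span_base by blast
    qed
    then show ?thesis using p(1) by simp
  qed
  then show ?thesis using assms(1) by (auto simp: orthonormal_basis_def orthonormal_def)
qed

lemma orthonormal_basisD: "orthonormal_basis B \<Longrightarrow> orthonormal B"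
  by (simp add: orthonormal_basis_def orthonormal_def)

lemma orthonormal_cinner:
  "orthonormal B \<Longrightarrow> x \<in> B \<Longrightarrow> y \<in> B \<Longrightarrow> cinner x y = (if x = y then 1 else 0)"
  by (simp add: orthonormal_def)

lemma orthonormal_norm: "orthonormal B \<Longrightarrow> b \<in> B \<Longrightarrow> norm b = 1"
  using cinner_self[of b] orthonormal_cinner[of B b b]
  by (metis norm_ge_zero of_real_eq_1_iff one_power2 power2_eq_iff_nonneg zero_le_one)

lemma cinner_orthonormal_sum:
  assumes "orthonormal B" "finite F" "F \<subseteq> B" "b \<in> F"
  shows "cinner b (\<Sum>a\<in>F. c a *\<^sub>C a) = c b"
proof -
  have "cinner b (\<Sum>a\<in>F. c a *\<^sub>C a) = (\<Sum>a\<in>F. if b = a then c a else 0)"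
    unfolding cinner_sum_right cinner_scaleC_right
  proof (intro sum.cong refl)
    fix a assume "a \<in> F"
    then have "a \<in> B" "b \<in> B" using assms(3,4) by auto
    then show "c a * cinner b a = (if b = a then c a else 0)"
      using orthonormal_cinner[OF assms(1)] by simp
  qed
  then show ?thesis using assms by simp
qed

lemma norm_orthonormal_sum:
  assumes "orthonormal B" "finite F" "F \<subseteq> B"
  shows "(norm (\<Sum>a\<in>F. c a *\<^sub>C a))\<^sup>2 = (\<Sum>a\<in>F. (cmod (c a))\<^sup>2)"
proof -
  have "complex_of_real ((norm (\<Sum>a\<in>F. c a *\<^sub>C a))\<^sup>2)
      = cinner (\<Sum>a\<in>F. c a *\<^sub>C a) (\<Sum>a\<in>F. c a *\<^sub>C a)" by (simp only: cinner_self)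
  also have "\<dots> = (\<Sum>b\<in>F. cnj (c b) * c b)"
    unfolding cinner_sum_left[of _ F] cinner_scaleC_left
    using cinner_orthonormal_sum[OF assms] by simp
  also have "\<dots> = complex_of_real (\<Sum>a\<in>F. (cmod (c a))\<^sup>2)"
    unfolding of_real_sum by (intro sum.cong refl) (simp only: complex_norm_square mult.commute)
  finally show ?thesis using of_real_eq_iff by blast
qed

text \<open>The Fourier partial sum is the best approximation from the span of the chosen vectors.\<close>

lemma orthonormal_best_approx:
  assumes "orthonormal B" "finite F" "F \<subseteq> B"
  shows "(norm (x - (\<Sum>a\<in>F. c a *\<^sub>C a)))\<^sup>2
    = (norm (x - (\<Sum>a\<in>F. cinner a x *\<^sub>C a)))\<^sup>2 + (\<Sum>a\<in>F. (cmod (cinner a x - c a))\<^sup>2)"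
proof -
  define s where "s = (\<Sum>a\<in>F. cinner a x *\<^sub>C a)"
  define d where "d = (\<Sum>a\<in>F. (cinner a x - c a) *\<^sub>C a)"
  have d: "x - (\<Sum>a\<in>F. c a *\<^sub>C a) = (x - s) + d"
    by (simp add: s_def d_def complex_vector.scale_left_diff_distrib sum_subtractf)
  have "cinner (x - s) d = (\<Sum>a\<in>F. (cinner a x - c a) * cinner (x - s) a)"
    unfolding d_def cinner_sum_right cinner_scaleC_right by simp
  also have "\<dots> = 0"
  proof (intro sum.neutral ballI)
    fix a assume "a \<in> F"
    then have "cinner a (x - s) = 0"
      using cinner_orthonormal_sum[OF assms, of a "\<lambda>a. cinner a x"] by (simp add: cinner_diff_right s_def)
    then show "(cinner a x - c a) * cinner (x - s) a = 0"
      using cinner_commute[of "x - s" a] by simp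
  qed
  finally have "cinner (x - s) d = 0" .
  then have "(norm ((x - s) + d))\<^sup>2 = (norm (x - s))\<^sup>2 + (norm d)\<^sup>2"
    unfolding norm_plus_sq by simp
  moreover have "(norm d)\<^sup>2 = (\<Sum>a\<in>F. (cmod (cinner a x - c a))\<^sup>2)"
    unfolding d_def by (rule norm_orthonormal_sum[OF assms])
  ultimately show ?thesis by (simp only: d s_def)
qed

text \<open>Some finite combination of basis vectors is close to \<open>x\<close>; by best approximation the Fourier sum
  over any larger finite set is at least as close.\<close>

lemma orthonormal_basis_expansion:
  fixes B :: "'h::chilbert_space set"
  assumes B: "orthonormal_basis B"
  shows "((\<lambda>b. cinner b x *\<^sub>C b) has_sum x) B"
  unfolding has_sum_def tendsto_iff
proof (intro allI impI)
  fix e :: real assume e: "e > 0"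
  have oB: "orthonormal B" using B by (rule orthonormal_basisD)
  have "x \<in> closure (cspan B)" using B by (simp add: orthonormal_basis_def)
  then obtain y where y: "y \<in> cspan B" "dist y x < e" using e closure_approachable by blast
  obtain F c where F: "finite F" "F \<subseteq> B" and y_eq: "y = (\<Sum>a\<in>F. c a *\<^sub>C a)"
    using y(1) unfolding complex_vector.span_explicit by blast
  have "dist (\<Sum>b\<in>G. cinner b x *\<^sub>C b) x < e" if G: "finite G" "F \<subseteq> G" "G \<subseteq> B" for G
  proof -
    define c' where "c' a = (if a \<in> F then c a else 0)" for a
    have "y = (\<Sum>a\<in>G. c' a *\<^sub>C a)"
      unfolding y_eq using G F by (intro sum.mono_neutral_cong_left) (auto simp: c'_def)
    then have "(norm (x - (\<Sum>b\<in>G. cinner b x *\<^sub>C b)))\<^sup>2 \<le> (norm (x - y))\<^sup>2"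
      using orthonormal_best_approx[OF oB G(1,3), of x c'] by (simp add: sum_nonneg)
    then have "norm (x - (\<Sum>b\<in>G. cinner b x *\<^sub>C b)) \<le> norm (x - y)"
      by (rule power2_le_imp_le) simp
    then show ?thesis using y(2) by (simp add: dist_norm norm_minus_commute)
  qed
  then show "\<forall>\<^sub>F G in finite_subsets_at_top B. dist (\<Sum>b\<in>G. cinner b x *\<^sub>C b) x < e"
    unfolding eventually_finite_subsets_at_top using F by blast
qed

lemma orthonormal_basis_cinner:
  fixes B :: "'h::chilbert_space set"
  assumes B: "orthonormal_basis B"
  shows "((\<lambda>b. cinner x b * cinner b y) has_sum cinner x y) B"
proof -
  have "((\<lambda>b. cinner x (cinner b y *\<^sub>C b)) has_sum cinner x y) B"
    using has_sum_bounded_linear[OF bounded_linear_cinner_right orthonormal_basis_expansion[OF B]]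
    by (simp add: o_def)
  then show ?thesis by (simp add: cinner_scaleC_right mult.commute)
qed

lemma parseval:
  fixes B :: "'h::chilbert_space set"
  assumes B: "orthonormal_basis B"
  shows "((\<lambda>b. (cmod (cinner b x))\<^sup>2) has_sum (norm x)\<^sup>2) B"
proof -
  have "cinner x b * cinner b x = complex_of_real ((cmod (cinner b x))\<^sup>2)" for b
    unfolding complex_norm_square by (subst cinner_commute[of x b]) (rule mult.commute)
  then have "((\<lambda>b. complex_of_real ((cmod (cinner b x))\<^sup>2)) has_sum complex_of_real ((norm x)\<^sup>2)) B"
    using orthonormal_basis_cinner[OF B, of x x] by (simp only: cinner_self)
  then show ?thesis using has_sum_of_real_iff by blast
qed

section \<open>Polynomials in a positive operator\<close>

definition pos_bop :: "'h::chilbert_space bop \<Rightarrow> bool"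
  where "pos_bop T \<longleftrightarrow> star T = T \<and> (\<forall>x. 0 \<le> Re (cinner x (bop_apply T x)))"

lemma star_minus: "star (- x) = - star x" for x :: "'a::cstar_algebra"
  using star_scaleC[of "- 1" x] by (simp add: complex_vector.scale_minus_left)

lemma star_diff: "star (x - y) = star x - star y" for x :: "'a::cstar_algebra"
  using star_add[of x "- y"] by (simp add: star_minus)

lemma star_zero [simp]: "star (0 :: 'a::cstar_algebra) = 0"
  using star_diff[of 0 "0::'a"] by simp

lemma star_scaleR: "star (r *\<^sub>R x) = r *\<^sub>R star x" for x :: "'a::cstar_algebra"
  by (simp add: scaleR_scaleC star_scaleC)

lemma norm_star: "norm (star x) = norm x" for x :: "'a::cstar_algebra"
proof -
  have le: "norm x \<le> norm (star x)" for x :: 'a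
  proof (cases "norm x = 0")
    case False
    have "norm x * norm x \<le> norm (star x) * norm x"
      using norm_mult_ineq[of "star x" x] by (simp add: cstar_identity power2_eq_square)
    then show ?thesis using False by simp
  qed simp
  show ?thesis using le[of x] le[of "star x"] by (simp add: star_star)
qed

lemma bounded_linear_star: "bounded_linear (star :: 'a::cstar_algebra \<Rightarrow> 'a)"
  by (rule bounded_linear_intro[of _ 1]) (simp_all add: star_add star_scaleR norm_star)

lemma star_one [simp]: "star (1 :: 'h::chilbert_space bop) = 1"
  by (rule bop_eqI, rule cinner_eqI) (simp add: cinner_star_right one_bop.rep_eq)

lemma bounded_bilinear_bop_apply:
  "bounded_bilinear (bop_apply :: 'h::chilbert_space bop \<Rightarrow> 'h \<Rightarrow> 'h)"
proof
  show "\<exists>K. \<forall>a (b::'h). norm (bop_apply a b) \<le> norm a * norm b * K"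
    by (intro exI[of _ 1]) (simp add: norm_bop_apply)
qed (simp_all add: plus_bop.rep_eq bop_add scaleR_bop.rep_eq bop_scaleR)

lemmas tendsto_bop_apply = bounded_bilinear.tendsto[OF bounded_bilinear_bop_apply]

lemma bop_diff: "bop_apply T (x - y) = bop_apply T x - bop_apply T y"
  by (rule linear_diff[OF bounded_linear.linear[OF bounded_linear_bop]])
lemma sum_bop_apply: "bop_apply (sum f F) x = (\<Sum>i\<in>F. bop_apply (f i) x)"
  by (induction F rule: infinite_finite_induct) (simp_all add: zero_bop.rep_eq plus_bop.rep_eq)

lemma cinner_selfadjoint: "star T = T \<Longrightarrow> cinner (bop_apply T x) y = cinner x (bop_apply T y)"
  by (metis cinner_star_left)

lemma cinner_scaleR_right: "cinner x (r *\<^sub>R y) = complex_of_real r * cinner x y"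
  by (simp add: scaleR_scaleC cinner_scaleC_right)

lemma selfadjointI: "(\<And>x y. cinner (bop_apply T x) y = cinner x (bop_apply T y)) \<Longrightarrow> star T = T"
  by (rule bop_eqI, rule cinner_eqI) (simp add: cinner_star_right)

lemma poly_bop_eq: "degree p \<le> n \<Longrightarrow> poly_bop p T = (\<Sum>i\<le>n. coeff p i *\<^sub>R T ^ i)"
  unfolding poly_bop_def by (intro sum.mono_neutral_left) (auto simp: coeff_eq_0)

lemma poly_bop_0 [simp]: "poly_bop 0 T = 0"
  by (simp add: poly_bop_def)

lemma poly_bop_pCons: "poly_bop (pCons a p) T = a *\<^sub>R 1 + T * poly_bop p T"
proof -
  have "poly_bop (pCons a p) T = (\<Sum>i\<le>Suc (degree p). coeff (pCons a p) i *\<^sub>R T ^ i)"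
    by (rule poly_bop_eq) (simp add: degree_pCons_le)
  also have "\<dots> = a *\<^sub>R 1 + (\<Sum>i\<le>degree p. coeff p i *\<^sub>R (T * T ^ i))"
    by (subst sum.atMost_Suc_shift) simp
  finally show ?thesis by (simp add: poly_bop_def sum_distrib_left)
qed

lemma poly_bop_add: "poly_bop (p + q) T = poly_bop p T + poly_bop q T"
proof -
  define n where "n = max (degree p) (degree q)"
  have "degree (p + q) \<le> n" "degree p \<le> n" "degree q \<le> n"
    by (simp_all add: n_def degree_add_le_max)
  then show ?thesis
    by (simp add: poly_bop_eq[of _ n] scaleR_add_left sum.distrib)
qed

lemma poly_bop_smult: "poly_bop (smult c p) T = c *\<^sub>R poly_bop p T"
  by (induction p) (simp_all add: poly_bop_pCons scaleR_add_right)

lemma poly_bop_diff: "poly_bop (p - q) T = poly_bop p T - poly_bop q T"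
proof -
  have "p - q = p + smult (- 1) q" by simp
  then show ?thesis by (simp only: poly_bop_add poly_bop_smult) simp
qed

lemma poly_bop_sum: "poly_bop (sum f F) T = (\<Sum>i\<in>F. poly_bop (f i) T)"
  by (induction F rule: infinite_finite_induct) (simp_all add: poly_bop_add)

lemma poly_bop_mult: "poly_bop (p * q) T = poly_bop p T * poly_bop q T"
  by (induction p) (simp_all add: poly_bop_pCons poly_bop_add poly_bop_smult distrib_right mult.assoc)

lemma poly_bop_const: "poly_bop [:c:] T = c *\<^sub>R 1"
  by (simp add: poly_bop_pCons)

lemma poly_bop_X: "poly_bop [:0, 1:] T = T"
  by (simp add: poly_bop_pCons)

lemma poly_bop_commute: "poly_bop p T * poly_bop q T = poly_bop q T * poly_bop p T"
  by (metis mult.commute poly_bop_mult)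

lemma star_poly_bop: "star T = T \<Longrightarrow> star (poly_bop p T) = poly_bop p T"
  using poly_bop_commute[of _ T "[:0, 1:]"]
  by (induction p) (simp_all add: poly_bop_pCons[of _ _ T] star_add star_mult star_scaleR poly_bop_X)

lemma poly_bop_eigenvector:
  assumes "bop_apply T x = r *\<^sub>R x"
  shows "bop_apply (poly_bop p T) x = poly p r *\<^sub>R x"
  by (induction p) (simp_all add: poly_bop_pCons zero_bop.rep_eq plus_bop.rep_eq scaleR_bop.rep_eq
      one_bop.rep_eq times_bop.rep_eq bop_scaleR assms scaleR_add_left mult.commute)

text \<open>Both sides are products of \<open>j\<close> factors, \<open>(k - i) / (n - i)\<close> against \<open>k / n\<close>. Exchanging factor
  number \<open>i\<close> costs at most \<open>i / n\<close>, and these errors add up to at most \<open>j\<^sup>2 / n\<close>.\<close>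

lemma falling_ratio_approx:
  assumes "k \<le> n" "j \<le> n" "n > 0"
  shows "\<bar>real (k choose j) / real (n choose j) - (real k / real n) ^ j\<bar> \<le> real (j\<^sup>2) / real n"
  using assms(2)
proof (induction j)
  case (Suc j)
  define r where "r = real (k choose j) / real (n choose j)"
  define s where "s = real (k - j) / real (n - j)"
  have n: "real (n choose j) > 0" "real (n choose Suc j) > 0" "real (n - j) > 0" using Suc.prems by simp_all
  have ab: "real (Suc j) * real (m choose Suc j) = real (m - j) * real (m choose j)" for m
    using binomial_absorb_comp[of m j] binomial_absorption[of j m]
    by (metis of_nat_mult)
  have rs: "real (k choose Suc j) / real (n choose Suc j) = r * s"
  proof -
    have "real (k choose Suc j) / real (n choose Suc j)
        = (real (Suc j) * real (k choose Suc j)) / (real (Suc j) * real (n choose Suc j))" by simp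
    also have "\<dots> = r * s" unfolding ab r_def s_def by (simp add: mult.commute)
    finally show ?thesis .
  qed
  have s: "0 \<le> s" "s \<le> 1" using assms(1) n by (simp_all add: s_def)
  have t: "0 \<le> real k / real n" "real k / real n \<le> 1" using assms by simp_all
  have sk: "\<bar>s - real k / real n\<bar> \<le> real j / real n"
  proof (cases "j \<le> k")
    case True
    have "real k / real n - s = real j * (real n - real k) / (real n * real (n - j))"
      using True Suc.prems n assms unfolding s_def
      by (simp add: of_nat_diff field_simps)
    moreover have "real j * (real n - real k) / (real n * real (n - j)) \<le> real j * real (n - j) / (real n * real (n - j))"
      using True assms n Suc.prems by (intro divide_right_mono mult_left_mono) (simp_all add: of_nat_diff)
    moreover have "0 \<le> real j * (real n - real k) / (real n * real (n - j))"
      using assms by simp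
    ultimately show ?thesis using n by simp
  next
    case False
    then have "s = 0" "real k / real n \<le> real j / real n" by (simp_all add: s_def divide_right_mono)
    then show ?thesis using t by simp
  qed
  have "\<bar>r * s - (real k / real n) ^ Suc j\<bar>
      = \<bar>(r - (real k / real n) ^ j) * s + (real k / real n) ^ j * (s - real k / real n)\<bar>"
    by (simp add: algebra_simps)
  also have "\<dots> \<le> \<bar>r - (real k / real n) ^ j\<bar> * s + (real k / real n) ^ j * \<bar>s - real k / real n\<bar>"
    using s t by (intro order_trans[OF abs_triangle_ineq]) (simp add: abs_mult power_abs)
  also have "\<dots> \<le> real (j\<^sup>2) / real n * 1 + 1 * (real j / real n)"
    using Suc.IH Suc.prems s t sk unfolding r_def
    by (intro add_mono mult_mono power_le_one) auto
  also have "\<dots> \<le> real ((Suc j)\<^sup>2) / real n"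
    using assms(3) by (simp add: power2_eq_square field_simps)
  finally show ?case by (simp only: rs)
qed simp

text \<open>The coefficients of \<open>M\<^sup>n p\<close> with respect to \<open>(n choose k) x\<^sup>k (M - x)\<^sup>n\<^sup>-\<^sup>k\<close>.\<close>

definition bernstein_coeff :: "real \<Rightarrow> real poly \<Rightarrow> nat \<Rightarrow> nat \<Rightarrow> real"
  where "bernstein_coeff M p n k = (\<Sum>j\<le>degree p. coeff p j * M ^ j * (real (k choose j) / real (n choose j)))"

text \<open>This is the binomial theorem for the exponent \<open>n - j\<close>, shifted by \<open>j\<close>.\<close>

lemma bernstein_monomial:
  fixes x y :: real
  assumes "j \<le> n"
  shows "(\<Sum>k\<le>n. real (k choose j) / real (n choose j) * real (n choose k) * x ^ k * y ^ (n - k))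
    = x ^ j * (x + y) ^ (n - j)"
proof -
  have nz: "real (n choose j) \<noteq> 0" using assms by simp
  have "(\<Sum>k\<le>n. real (k choose j) / real (n choose j) * real (n choose k) * x ^ k * y ^ (n - k))
      = (\<Sum>k\<in>{j..n}. real (k choose j) / real (n choose j) * real (n choose k) * x ^ k * y ^ (n - k))"
    by (intro sum.mono_neutral_right) (auto simp: binomial_eq_0)
  also have "\<dots> = (\<Sum>i\<le>n - j. real (j + i choose j) / real (n choose j) * real (n choose (j + i)) * x ^ (j + i) * y ^ (n - (j + i)))"
    using assms by (intro sum.reindex_bij_witness[of _ "\<lambda>i. j + i" "\<lambda>k. k - j"]) auto
  also have "\<dots> = (\<Sum>i\<le>n - j. x ^ j * (real (n - j choose i) * x ^ i * y ^ (n - j - i)))"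
  proof (intro sum.cong refl)
    fix i assume "i \<in> {..n - j}"
    then have "(n choose (j + i)) * (j + i choose j) = (n choose j) * (n - j choose i)"
      using choose_mult[of j "j + i" n] assms by simp
    then have "real (j + i choose j) * real (n choose (j + i)) = real (n choose j) * real (n - j choose i)"
      by (metis mult.commute of_nat_mult)
    then have "real (j + i choose j) / real (n choose j) * real (n choose (j + i)) = real (n - j choose i)"
      using nz by (simp add: field_simps)
    then show "real (j + i choose j) / real (n choose j) * real (n choose (j + i)) * x ^ (j + i) * y ^ (n - (j + i))
        = x ^ j * (real (n - j choose i) * x ^ i * y ^ (n - j - i))"
      by (simp add: power_add)
  qed
  also have "\<dots> = x ^ j * (x + y) ^ (n - j)"
    by (simp add: binomial_ring sum_distrib_left)
  finally show ?thesis .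
qed

text \<open>A monomial \<open>x\<^sup>j\<close> becomes homogeneous of degree \<open>n\<close> on multiplication by a power of \<open>M = x + (M - x)\<close>,
  after which the binomial theorem applies. Unlike Bernstein approximation, the expansion is exact, so it can be
  evaluated at an operator.\<close>

lemma bernstein_expansion:
  assumes "degree p \<le> n"
  shows "smult (M ^ n) p = (\<Sum>k\<le>n. smult (bernstein_coeff M p n k * real (n choose k)) ([:0, 1:] ^ k * [:M, - 1:] ^ (n - k)))"
proof -
  have "M ^ n * poly p x = (\<Sum>k\<le>n. bernstein_coeff M p n k * real (n choose k) * (x ^ k * (M - x) ^ (n - k)))" for x
  proof -
    have "(\<Sum>k\<le>n. bernstein_coeff M p n k * real (n choose k) * (x ^ k * (M - x) ^ (n - k)))
      = (\<Sum>j\<le>degree p. coeff p j * M ^ j * (\<Sum>k\<le>n. real (k choose j) / real (n choose j) * real (n choose k) * x ^ k * (M - x) ^ (n - k)))"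
      unfolding bernstein_coeff_def sum_distrib_right sum_distrib_left
      by (subst sum.swap) (simp add: ac_simps)
    also have "\<dots> = (\<Sum>j\<le>degree p. coeff p j * M ^ j * (x ^ j * M ^ (n - j)))"
      using assms by (intro sum.cong refl) (simp only: bernstein_monomial atMost_iff order_trans, simp)
    also have "\<dots> = (\<Sum>j\<le>degree p. M ^ n * (coeff p j * x ^ j))"
    proof (intro sum.cong refl)
      fix j assume "j \<in> {..degree p}"
      then have "M ^ n = M ^ j * M ^ (n - j)" using assms by (simp flip: power_add)
      then show "coeff p j * M ^ j * (x ^ j * M ^ (n - j)) = M ^ n * (coeff p j * x ^ j)" by simp
    qed
    finally show ?thesis by (simp add: poly_altdef sum_distrib_left)
  qed
  then have "poly (smult (M ^ n) p) = poly (\<Sum>k\<le>n. smult (bernstein_coeff M p n k * real (n choose k)) ([:0, 1:] ^ k * [:M, - 1:] ^ (n - k)))"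
    by (intro ext) (simp add: poly_sum)
  then show ?thesis by (simp only: poly_eq_poly_eq_iff)
qed

text \<open>The coefficient with index \<open>k\<close> differs from the value of \<open>p\<close> at \<open>M k / n\<close> by \<open>O(1 / n)\<close> uniformly in \<open>k\<close>,
  so a positive lower bound for \<open>p\<close> makes all coefficients nonnegative for large \<open>n\<close>.\<close>

lemma bernstein_coeff_nonneg:
  assumes "M \<ge> 0" "e > 0" and p: "\<And>x. 0 \<le> x \<Longrightarrow> x \<le> M \<Longrightarrow> e \<le> poly p x"
  obtains n where "degree p \<le> n" "n > 0" "\<And>k. k \<le> n \<Longrightarrow> 0 \<le> bernstein_coeff M p n k"
proof -
  define K where "K = (\<Sum>j\<le>degree p. \<bar>coeff p j\<bar> * M ^ j * real (j\<^sup>2))"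
  obtain n0 where n0: "K / e < real n0" using reals_Archimedean2 by blast
  define n where "n = max (Suc (degree p)) n0"
  have n: "degree p \<le> n" "n > 0" "K < e * real n"
    using n0 assms(2) unfolding n_def by (auto simp: pos_divide_less_eq mult.commute intro: less_le_trans)
  have "0 \<le> bernstein_coeff M p n k" if k: "k \<le> n" for k
  proof -
    define t where "t = real k / real n"
    have t: "0 \<le> t" "t \<le> 1" using k n by (simp_all add: t_def)
    have "\<bar>bernstein_coeff M p n k - poly p (M * t)\<bar>
        = \<bar>\<Sum>j\<le>degree p. coeff p j * M ^ j * (real (k choose j) / real (n choose j) - t ^ j)\<bar>"
      unfolding bernstein_coeff_def poly_altdef
      by (simp add: sum_subtractf[symmetric] power_mult_distrib algebra_simps)
    also have "\<dots> \<le> (\<Sum>j\<le>degree p. \<bar>coeff p j\<bar> * M ^ j * (real (j\<^sup>2) / real n))"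
    proof (rule order_trans[OF sum_abs], rule sum_mono)
      fix j assume "j \<in> {..degree p}"
      then have "\<bar>real (k choose j) / real (n choose j) - t ^ j\<bar> \<le> real (j\<^sup>2) / real n"
        unfolding t_def using k n by (intro falling_ratio_approx) auto
      then show "\<bar>coeff p j * M ^ j * (real (k choose j) / real (n choose j) - t ^ j)\<bar>
          \<le> \<bar>coeff p j\<bar> * M ^ j * (real (j\<^sup>2) / real n)"
        using assms(1) by (simp only: abs_mult power_abs abs_of_nonneg) (intro mult_left_mono, simp_all)
    qed
    also have "\<dots> = K / real n" by (simp add: K_def sum_divide_distrib)
    also have "\<dots> < e" using n by (simp add: pos_divide_less_eq)
    finally have "poly p (M * t) - e < bernstein_coeff M p n k" by linarith
    moreover have "e \<le> poly p (M * t)"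
      using t assms(1) by (intro p) (simp_all add: mult_left_le)
    ultimately show ?thesis by linarith
  qed
  then show ?thesis using n that by blast
qed

text \<open>The product equals \<open>S T S\<close>.\<close>

lemma pos_bop_sandwich:
  assumes "star S = S" "pos_bop T" "S * T = T * S"
  shows "pos_bop (S * S * T)"
proof -
  have eq: "S * S * T = S * T * S" by (simp only: mult.assoc assms(3)[symmetric])
  have "star (S * T * S) = S * T * S"
    using assms(1,2) by (simp add: star_mult pos_bop_def mult.assoc)
  moreover have "0 \<le> Re (cinner x (bop_apply (S * T * S) x))" for x
    using assms(2) cinner_selfadjoint[OF assms(1), of x]
    by (simp add: times_bop.rep_eq pos_bop_def flip: cinner_selfadjoint[OF assms(1), of x])
  ultimately show ?thesis unfolding eq pos_bop_def by blast
qed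

lemma pos_bop_add: "pos_bop S \<Longrightarrow> pos_bop T \<Longrightarrow> pos_bop (S + T)"
  by (simp add: pos_bop_def star_add plus_bop.rep_eq cinner_add_right)

lemma pos_bop_scaleR: "0 \<le> r \<Longrightarrow> pos_bop T \<Longrightarrow> pos_bop (r *\<^sub>R T)"
  by (simp add: pos_bop_def star_scaleR scaleR_bop.rep_eq cinner_scaleR_right)

lemma pos_bop_0 [simp]: "pos_bop 0"
  by (simp add: pos_bop_def zero_bop.rep_eq)

lemma pos_bop_1 [simp]: "pos_bop 1"
  by (simp add: pos_bop_def one_bop.rep_eq cinner_self)

lemma pos_bop_sum: "(\<And>i. i \<in> F \<Longrightarrow> pos_bop (f i)) \<Longrightarrow> pos_bop (sum f F)"
  by (induction F rule: infinite_finite_induct) (simp_all add: pos_bop_add)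

lemma pos_bop_norm_minus:
  assumes "pos_bop T"
  shows "pos_bop (norm T *\<^sub>R 1 - T)"
proof -
  have "0 \<le> Re (cinner x (bop_apply (norm T *\<^sub>R 1 - T) x))" for x
  proof -
    have "Re (cinner x (bop_apply T x)) \<le> norm x * (norm T * norm x)"
      by (rule order_trans[OF Re_cinner_le]) (intro mult_left_mono norm_bop_apply norm_ge_zero)
    moreover have "Re (cinner x (norm T *\<^sub>R x)) = norm T * (norm x)\<^sup>2"
      by (simp add: cinner_scaleR_right cinner_self)
    ultimately show ?thesis
      by (simp add: minus_bop.rep_eq scaleR_bop.rep_eq one_bop.rep_eq cinner_diff_right
          power2_eq_square ac_simps)
  qed
  then show ?thesis using assms by (simp add: pos_bop_def star_diff star_scaleR)
qed

text \<open>Even powers can be split off as squares, so only the products of the two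
  factors themselves need an argument.\<close>

lemma pos_bop_bernstein_monomial:
  assumes T: "pos_bop T"
  shows "pos_bop (poly_bop ([:0, 1:] ^ k * [:norm T, - 1:] ^ m) T)"
proof -
  define X where "X = [:0, 1 :: real:]"
  define Y where "Y = [:norm T, - 1:]"
  have sa: "star (poly_bop p T) = poly_bop p T" for p
    using T by (intro star_poly_bop) (simp add: pos_bop_def)
  have sq: "pos_bop (poly_bop (p * p * q) T)" if "pos_bop (poly_bop q T)" for p q
    unfolding poly_bop_mult by (rule pos_bop_sandwich[OF sa that poly_bop_commute])
  have X: "pos_bop (poly_bop X T)" using T by (simp add: X_def poly_bop_X)
  have Y: "pos_bop (poly_bop Y T)"
    using pos_bop_norm_minus[OF T] by (simp add: Y_def poly_bop_pCons)
  have XY: "pos_bop (poly_bop (X * Y) T)"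
  proof (cases "norm T = 0")
    case True
    then have "poly_bop X T = 0" by (simp add: X_def poly_bop_X)
    then show ?thesis by (simp add: poly_bop_mult)
  next
    case False
    \<comment> \<open>The product of the two factors is a combination of squares times single factors, via \<open>X + Y = norm T\<close>.\<close>
    have "X + Y = [:norm T:]" by (simp add: X_def Y_def)
    then have "smult (norm T) (X * Y) = X * Y * (X + Y)" by simp
    then have eq: "X * Y = smult (inverse (norm T)) (X * X * Y + Y * Y * X)"
      using False by (smt (verit) distrib_left left_inverse mult.assoc mult.commute smult_1_left smult_smult)
    show ?thesis
      unfolding eq poly_bop_smult poly_bop_add
      by (intro pos_bop_scaleR pos_bop_add sq X Y) simp
  qed
  have "X ^ k * Y ^ m = (X ^ (k div 2) * Y ^ (m div 2)) * (X ^ (k div 2) * Y ^ (m div 2)) * (X ^ (k mod 2) * Y ^ (m mod 2))"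
  proof -
    have "P ^ i = P ^ (i div 2) * P ^ (i div 2) * P ^ (i mod 2)" for P :: "real poly" and i
      unfolding power_add[symmetric] by (rule arg_cong[of _ _ "power P"]) presburger
    from this[of X k] this[of Y m] show ?thesis by (simp only: ac_simps)
  qed
  moreover have "pos_bop (poly_bop (X ^ (k mod 2) * Y ^ (m mod 2)) T)"
    by (cases "k mod 2 = 0"; cases "m mod 2 = 0")
      (simp_all add: X Y XY not_mod_2_eq_0_eq_1 one_pCons poly_bop_const del: mod_0_imp_dvd)
  ultimately show ?thesis unfolding X_def[symmetric] Y_def[symmetric] by (simp only: sq)
qed

text \<open>All Bernstein coefficients are nonnegative, and each Bernstein monomial is positive at \<open>T\<close>.\<close>

lemma pos_poly_bop_strict:
  assumes T: "pos_bop T" and "e > 0" and p: "\<And>x. 0 \<le> x \<Longrightarrow> x \<le> norm T \<Longrightarrow> e \<le> poly p x"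
  shows "pos_bop (poly_bop p T)"
proof (cases "norm T = 0")
  case True
  then have "T = 0" by simp
  then have "poly_bop p T = poly p 0 *\<^sub>R 1"
    by (intro bop_eqI, subst poly_bop_eigenvector[of _ _ 0])
      (simp_all add: zero_bop.rep_eq scaleR_bop.rep_eq one_bop.rep_eq)
  then show ?thesis using p[of 0] True \<open>e > 0\<close> by (simp add: pos_bop_scaleR)
next
  case False
  obtain n where n: "degree p \<le> n" "\<And>k. k \<le> n \<Longrightarrow> 0 \<le> bernstein_coeff (norm T) p n k"
    using bernstein_coeff_nonneg[OF norm_ge_zero \<open>e > 0\<close> p] by blast
  have "pos_bop (norm T ^ n *\<^sub>R poly_bop p T)"
    unfolding poly_bop_smult[symmetric] bernstein_expansion[OF n(1)] poly_bop_sum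
    using n(2) by (intro pos_bop_sum) (simp add: poly_bop_smult pos_bop_scaleR pos_bop_bernstein_monomial[OF T])
  then have "pos_bop (inverse (norm T ^ n) *\<^sub>R norm T ^ n *\<^sub>R poly_bop p T)"
    by (rule pos_bop_scaleR[rotated]) simp
  moreover have "inverse (norm T ^ n) *\<^sub>R norm T ^ n *\<^sub>R poly_bop p T = poly_bop p T"
    using False by simp
  ultimately show ?thesis by metis
qed

lemma pos_poly_bop:
  assumes T: "pos_bop T" and p: "\<And>x. 0 \<le> x \<Longrightarrow> x \<le> norm T \<Longrightarrow> 0 \<le> poly p x"
  shows "pos_bop (poly_bop p T)"
proof -
  have "0 \<le> Re (cinner x (bop_apply (poly_bop p T) x))" for x
  proof (rule field_le_epsilon)
    fix e :: real assume e: "e > 0"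
    define d where "d = e / ((norm x)\<^sup>2 + 1)"
    have d: "d > 0" "d * (norm x)\<^sup>2 \<le> e"
    proof -
      define N where "N = (norm x)\<^sup>2"
      have "N \<ge> 0" by (simp add: N_def)
      then show "d > 0" "d * (norm x)\<^sup>2 \<le> e"
        using e unfolding d_def N_def[symmetric] by (simp_all add: divide_simps)
    qed
    have "pos_bop (poly_bop (p + [:d:]) T)"
      by (rule pos_poly_bop_strict[OF T d(1)]) (use p d in simp)
    then have "0 \<le> Re (cinner x (bop_apply (poly_bop p T) x)) + d * (norm x)\<^sup>2"
      by (simp add: pos_bop_def poly_bop_add poly_bop_const plus_bop.rep_eq scaleR_bop.rep_eq
          one_bop.rep_eq cinner_add_right cinner_scaleR_right cinner_self)
    then show "0 \<le> Re (cinner x (bop_apply (poly_bop p T) x)) + e" using d by linarith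
  qed
  then show ?thesis using star_poly_bop[of T p] T by (simp add: pos_bop_def)
qed

text \<open>The polynomial \<open>c\<^sup>2 - p\<^sup>2\<close> is nonnegative on the interval, and \<open>cinner x (p(T)\<^sup>2 x) = (norm (p(T) x))\<^sup>2\<close>.\<close>

lemma norm_poly_bop_le:
  assumes T: "pos_bop T" and p: "\<And>x. 0 \<le> x \<Longrightarrow> x \<le> norm T \<Longrightarrow> \<bar>poly p x\<bar> \<le> c" and c: "0 \<le> c"
  shows "norm (poly_bop p T) \<le> c"
proof (rule norm_bop_le[OF _ c])
  fix x
  have "pos_bop (poly_bop ([:c\<^sup>2:] - p * p) T)"
  proof (rule pos_poly_bop[OF T])
    fix y :: real assume "0 \<le> y" "y \<le> norm T"
    then have "(poly p y)\<^sup>2 \<le> c\<^sup>2" using p by (metis abs_ge_zero power2_abs power_mono)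
    then show "0 \<le> poly ([:c\<^sup>2:] - p * p) y" by (simp add: power2_eq_square)
  qed
  then have "0 \<le> Re (cinner x (bop_apply (c\<^sup>2 *\<^sub>R 1 - poly_bop p T * poly_bop p T) x))"
    by (simp add: pos_bop_def poly_bop_diff poly_bop_mult poly_bop_const)
  also have "\<dots> = c\<^sup>2 * (norm x)\<^sup>2 - Re (cinner x (bop_apply (poly_bop p T) (bop_apply (poly_bop p T) x)))"
    by (simp add: minus_bop.rep_eq scaleR_bop.rep_eq
          one_bop.rep_eq times_bop.rep_eq cinner_diff_right cinner_scaleR_right cinner_self)
  also have "cinner x (bop_apply (poly_bop p T) (bop_apply (poly_bop p T) x))
      = complex_of_real ((norm (bop_apply (poly_bop p T) x))\<^sup>2)"
    using T by (subst cinner_selfadjoint[symmetric]) (simp_all add: pos_bop_def star_poly_bop cinner_self)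
  finally have "(norm (bop_apply (poly_bop p T) x))\<^sup>2 \<le> (c * norm x)\<^sup>2"
    by (simp add: power_mult_distrib)
  then show "norm (bop_apply (poly_bop p T) x) \<le> c * norm x"
    by (rule power2_le_imp_le) (simp add: c)
qed

section \<open>Real powers of a positive operator\<close>

lemma powr_poly_approx:
  assumes "s > 0" "M \<ge> 0"
  obtains p :: "nat \<Rightarrow> real poly"
  where "uniform_limit {0..M} (\<lambda>n. poly (p n)) (\<lambda>x. x powr s) sequentially"
proof -
  have "continuous_on {0..M} (\<lambda>x. x powr s)"
    using assms by (intro continuous_on_powr' continuous_intros) auto
  then obtain g where g: "uniform_limit {0..M} g (\<lambda>x. x powr s) sequentially"
      "\<And>n. polynomial_function (g n)"
    using Stone_Weierstrass_uniform_limit[of "{0..M}" "\<lambda>x. x powr s"] by blast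
  have "\<exists>p. poly p = g n" for n
  proof -
    obtain a m where g_eq: "g n = (\<lambda>x. \<Sum>i\<le>m. a i * x ^ i)"
      using g(2) real_polynomial_function_iff_sum[of "g n"] by (auto simp: real_polynomial_function_eq)
    have "poly (\<Sum>i\<le>m. monom (a i) i) = g n"
      by (simp add: g_eq fun_eq_iff poly_sum poly_monom)
    then show ?thesis by blast
  qed
  then obtain p where "\<And>n. poly (p n) = g n" by metis
  then show ?thesis using g(1) that[of p] by simp
qed

lemma norm_poly_bop_diff_le:
  assumes T: "pos_bop T"
    and p: "\<And>x. x \<in> {0..norm T} \<Longrightarrow> dist (poly p x) (f x) < e"
    and q: "\<And>x. x \<in> {0..norm T} \<Longrightarrow> dist (poly q x) (f x) < e"
  shows "norm (poly_bop p T - poly_bop q T) \<le> 2 * e"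
  unfolding poly_bop_diff[symmetric]
proof (rule norm_poly_bop_le[OF T])
  have "0 \<le> dist (poly p 0) (f 0)" "dist (poly p 0) (f 0) < e" using p[of 0] by simp_all
  then show "0 \<le> 2 * e" by linarith
  fix x :: real assume "0 \<le> x" "x \<le> norm T"
  then have "x \<in> {0..norm T}" by simp
  from p[OF this] q[OF this] show "\<bar>poly (p - q) x\<bar> \<le> 2 * e"
    unfolding dist_real_def poly_diff by linarith
qed

lemma poly_bop_limit_unique:
  assumes T: "pos_bop T"
    and p: "uniform_limit {0..norm T} (\<lambda>n. poly (p n)) f sequentially"
    and q: "uniform_limit {0..norm T} (\<lambda>n. poly (q n)) f sequentially"
  shows "(\<lambda>n. poly_bop (p n) T - poly_bop (q n) T) \<longlonglongrightarrow> 0"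
proof (rule tendstoI)
  fix r :: real assume "r > 0"
  then have "r / 4 > 0" by simp
  from uniform_limitD[OF p this] uniform_limitD[OF q this]
  show "\<forall>\<^sub>F n in sequentially. dist (poly_bop (p n) T - poly_bop (q n) T) 0 < r"
  proof eventually_elim
    case (elim n)
    then have "norm (poly_bop (p n) T - poly_bop (q n) T) \<le> 2 * (r / 4)"
      by (intro norm_poly_bop_diff_le[OF T]) auto
    then show ?case using \<open>r > 0\<close> by simp
  qed
qed

lemma poly_bop_Cauchy:
  assumes T: "pos_bop T"
    and p: "uniform_limit {0..norm T} (\<lambda>n. poly (p n)) f sequentially"
  shows "Cauchy (\<lambda>n. poly_bop (p n) T)"
proof (rule metric_CauchyI)
  fix r :: real assume r: "r > 0"
  then have "r / 4 > 0" by simp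
  from uniform_limitD[OF p this] obtain N
    where N: "\<And>n x. n \<ge> N \<Longrightarrow> x \<in> {0..norm T} \<Longrightarrow> dist (poly (p n) x) (f x) < r / 4"
    unfolding eventually_sequentially by blast
  have "dist (poly_bop (p m) T) (poly_bop (p n) T) < r" if "m \<ge> N" "n \<ge> N" for m n
    using norm_poly_bop_diff_le[OF T N[OF that(1)] N[OF that(2)]] r by (simp add: dist_norm)
  then show "\<exists>M. \<forall>m\<ge>M. \<forall>n\<ge>M. dist (poly_bop (p m) T) (poly_bop (p n) T) < r" by blast
qed

text \<open>By the norm estimate every approximating sequence of polynomials is Cauchy at \<open>T\<close> and any two have the
  same limit, so the description defining the power determines an operator.\<close>

lemma bop_powr_limit:
  assumes T: "pos_bop T" and s: "s > 0"
    and p: "uniform_limit {0..norm T} (\<lambda>n. poly (p n)) (\<lambda>x. x powr s) sequentially"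
  shows "(\<lambda>n. poly_bop (p n) T) \<longlonglongrightarrow> bop_powr T s"
proof -
  obtain S where S: "(\<lambda>n. poly_bop (p n) T) \<longlonglongrightarrow> S"
    using poly_bop_Cauchy[OF T p] Cauchy_convergent convergent_def by blast
  have all: "(\<lambda>n. poly_bop (q n) T) \<longlonglongrightarrow> S"
    if q: "uniform_limit {0..norm T} (\<lambda>n. poly (q n)) (\<lambda>x. x powr s) sequentially" for q
    using tendsto_diff[OF S poly_bop_limit_unique[OF T p q]] by simp
  have "bop_powr T s = S"
    unfolding bop_powr_def
  proof (rule the_equality)
    show "\<forall>p. uniform_limit {0..norm T} (\<lambda>n. poly (p n)) (\<lambda>x. x powr s) sequentially \<longrightarrow>
        (\<lambda>n. poly_bop (p n) T) \<longlonglongrightarrow> S" using all by blast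
  next
    fix S' assume "\<forall>p. uniform_limit {0..norm T} (\<lambda>n. poly (p n)) (\<lambda>x. x powr s) sequentially \<longrightarrow>
        (\<lambda>n. poly_bop (p n) T) \<longlonglongrightarrow> S'"
    then show "S' = S" using p S LIMSEQ_unique by blast
  qed
  then show ?thesis using S by simp
qed

lemma star_bop_powr:
  assumes T: "pos_bop T" and s: "s > 0"
  shows "star (bop_powr T s) = bop_powr T s"
proof -
  obtain p where p: "uniform_limit {0..norm T} (\<lambda>n. poly (p n)) (\<lambda>x. x powr s) sequentially"
    using powr_poly_approx[OF s norm_ge_zero] by blast
  note lim = bop_powr_limit[OF T s p]
  have "(\<lambda>n. star (poly_bop (p n) T)) \<longlonglongrightarrow> star (bop_powr T s)"
    by (rule bounded_linear.tendsto[OF bounded_linear_star lim])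
  then have "(\<lambda>n. poly_bop (p n) T) \<longlonglongrightarrow> star (bop_powr T s)"
    using T by (simp add: star_poly_bop pos_bop_def)
  then show ?thesis using lim LIMSEQ_unique by blast
qed

lemma pos_bop_eigenvalue:
  assumes T: "pos_bop T" and x: "bop_apply T x = r *\<^sub>R x" "x \<noteq> 0"
  shows "0 \<le> r" "r \<le> norm T"
proof -
  have "0 \<le> Re (cinner x (bop_apply T x))" using T by (simp add: pos_bop_def)
  also have "\<dots> = r * (norm x)\<^sup>2"
    by (simp add: x(1) cinner_scaleR_right cinner_self)
  finally show "0 \<le> r" using x(2) by (simp add: zero_le_mult_iff)
  have "\<bar>r\<bar> * norm x \<le> norm T * norm x" using norm_bop_apply[of T x] by (simp add: x(1))
  then show "r \<le> norm T" using x(2) by simp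
qed

lemma bop_powr_eigenvector:
  assumes T: "pos_bop T" and s: "s > 0" and x: "bop_apply T x = r *\<^sub>R x"
  shows "bop_apply (bop_powr T s) x = (r powr s) *\<^sub>R x"
proof (cases "x = 0")
  case False
  obtain p where p: "uniform_limit {0..norm T} (\<lambda>n. poly (p n)) (\<lambda>x. x powr s) sequentially"
    using powr_poly_approx[OF s norm_ge_zero] by blast
  have "(\<lambda>n. bop_apply (poly_bop (p n) T) x) \<longlonglongrightarrow> bop_apply (bop_powr T s) x"
    by (intro tendsto_bop_apply tendsto_const bop_powr_limit[OF T s p])
  moreover have "(\<lambda>n. poly (p n) r *\<^sub>R x) \<longlonglongrightarrow> (r powr s) *\<^sub>R x"
    using pos_bop_eigenvalue[OF T x False]
    by (intro tendsto_intros tendsto_uniform_limitI[OF p]) simp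
  ultimately show ?thesis using LIMSEQ_unique by (simp add: poly_bop_eigenvector[OF x]) blast
qed simp

text \<open>The squares of polynomials approximating the square root approximate the identity function.\<close>

lemma bop_powr_half_square:
  assumes T: "pos_bop T"
  shows "bop_powr T (1 / 2) * bop_powr T (1 / 2) = T"
proof -
  obtain p where p: "uniform_limit {0..norm T} (\<lambda>n. poly (p n)) (\<lambda>x. x powr (1 / 2)) sequentially"
    using powr_poly_approx[of "1 / 2" "norm T"] by auto
  note lim = bop_powr_limit[OF T _ p]
  have sq: "(\<lambda>n. poly_bop (p n * p n) T) \<longlonglongrightarrow> bop_powr T (1 / 2) * bop_powr T (1 / 2)"
    unfolding poly_bop_mult by (intro tendsto_mult lim) simp_all
  have "uniform_limit {0..norm T} (\<lambda>n. poly (p n * p n)) (\<lambda>x. x) sequentially"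
  proof -
    have bdd: "bounded ((\<lambda>x :: real. x powr (1 / 2)) ` {0..norm T})"
      by (intro compact_imp_bounded compact_continuous_image continuous_on_powr' continuous_intros) auto
    have "uniform_limit {0..norm T} (\<lambda>n x. poly (p n) x * poly (p n) x)
        (\<lambda>x. x powr (1 / 2) * x powr (1 / 2)) sequentially"
      by (rule uniform_lim_mult[OF p p bdd bdd])
    then show ?thesis
      by (rule uniform_limit_cong'[THEN iffD1, rotated 2]) (simp_all add: powr_add[symmetric])
  qed
  moreover have "uniform_limit {0..norm T} (\<lambda>n. poly [:0, 1:]) (\<lambda>x. x) sequentially"
    by (rule uniform_limit_cong'[THEN iffD1, OF _ _ uniform_limit_const]) simp_all
  ultimately have "(\<lambda>n. poly_bop (p n * p n) T - poly_bop [:0, 1:] T) \<longlonglongrightarrow> 0"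
    by (intro poly_bop_limit_unique[OF T])
  then have "(\<lambda>n. poly_bop (p n * p n) T) \<longlonglongrightarrow> T"
    by (simp add: poly_bop_X LIM_zero_iff)
  then show ?thesis using sq LIMSEQ_unique by blast
qed

section \<open>The resolvent of a self-adjoint operator\<close>

lemma closed_op_adj:
  fixes G :: "('h::complex_inner \<times> 'k::complex_inner) set"
  shows "closed (op_adj G)"
proof -
  have "op_adj G = (\<Inter>q\<in>G. {p. cinner (fst p) (snd q) = cinner (snd p) (fst q)})"
    by (force simp: op_adj_def)
  moreover have "closed {p :: 'k \<times> 'h. cinner (fst p) w = cinner (snd p) x}" for w x
    by (intro closed_Collect_eq continuous_on_cinner continuous_intros)
  ultimately show ?thesis by (simp add: closed_INT)
qed

lemma selfadjoint_closed: "selfadjoint_op D \<Longrightarrow> closed D"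
  using closed_op_adj[of D] by (simp add: selfadjoint_op_def)

lemma selfadjoint_symmetric:
  assumes "selfadjoint_op D" "(x, w) \<in> D" "(y, v) \<in> D"
  shows "cinner x v = cinner w y"
proof -
  have "(x, w) \<in> op_adj D" using assms by (simp add: selfadjoint_op_def)
  then show ?thesis using assms(3) by (auto simp: op_adj_def)
qed

lemma densely_definedD:
  assumes "densely_defined D"
  shows "csubspace D" "single_valued D" "closure (Domain D) = UNIV"
  using assms by (simp_all add: densely_defined_def)

lemma single_valued_zero: "csubspace D \<Longrightarrow> single_valued D \<Longrightarrow> (0, w) \<in> D \<Longrightarrow> w = 0"
  using complex_vector.subspace_0[of D] by (auto simp: single_valued_def zero_prod_def)

lemma csubspace_pair_add: "csubspace D \<Longrightarrow> (x, y) \<in> D \<Longrightarrow> (u, v) \<in> D \<Longrightarrow> (x + u, y + v) \<in> D"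
  using complex_vector.subspace_add[of D "(x, y)" "(u, v)"] by simp

lemma csubspace_pair_scale: "csubspace D \<Longrightarrow> (x, y) \<in> D \<Longrightarrow> (c *\<^sub>C x, c *\<^sub>C y) \<in> D"
  using complex_vector.subspace_scale[of D "(x, y)" c] by (simp add: scaleC_prod_def)

text \<open>The pair \<open>(h, 0)\<close> is split along the closed graph of \<open>D\<close>; the component orthogonal to
  the graph belongs, up to a rotation, to the graph of the adjoint, which is \<open>D\<close> itself. \<close>

lemma selfadjoint_one_plus_sq_surj:
  fixes D :: "('h::chilbert_space \<times> 'h) set"
  assumes D: "selfadjoint_op D"
  obtains x w where "(x, w) \<in> D" "(w, h - x) \<in> D"
proof -
  have sub: "csubspace D" and adj: "op_adj D = D"
    using D by (auto simp: selfadjoint_op_def densely_defined_def)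
  obtain p where p: "p \<in> D" "\<And>q. q \<in> D \<Longrightarrow> cinner q ((h, 0) - p) = 0"
    using orthogonal_projection[OF sub selfadjoint_closed[OF D]] by blast
  obtain x w where pxw: "p = (x, w)" by (cases p)
  have "cinner (- w) w' = cinner (x - h) x'" if "(x', w') \<in> D" for x' w'
  proof -
    have "cinner x' (h - x) + cinner w' (- w) = 0"
      using p(2)[OF that] by (simp add: pxw cinner_prod_def)
    then have "cinner w' (- w) = cinner x' (x - h)"
      by (simp add: cinner_diff_right add_eq_0_iff)
    then show ?thesis by (metis cinner_commute)
  qed
  then have "(- w, x - h) \<in> op_adj D" by (auto simp: op_adj_def)
  then have "(- w, x - h) \<in> D" by (simp add: adj)
  then have "(w, h - x) \<in> D" using csubspace_pair_scale[OF sub, of "- w" "x - h" "- 1"]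
    by (simp add: complex_vector.scale_minus_left)
  then show ?thesis using p(1) pxw that by blast
qed

text \<open>Pairing \<open>(1 + D\<^sup>2) x\<close> with \<open>y\<close> gives the graph inner product of \<open>x\<close> and \<open>y\<close>.\<close>

lemma one_plus_sq_cinner:
  assumes D: "selfadjoint_op D"
    and "(x, w) \<in> D" "(w, h - x) \<in> D" "(y, v) \<in> D"
  shows "cinner h y = cinner x y + cinner w v"
  using selfadjoint_symmetric[OF D assms(3,4)] by (simp add: cinner_diff_left algebra_simps)

lemma one_plus_sq_norm_le:
  assumes D: "selfadjoint_op D" and "(x, w) \<in> D" "(w, h - x) \<in> D"
  shows "norm x \<le> norm h"
proof -
  have "cinner h x = cinner x x + cinner w w"
    by (rule one_plus_sq_cinner[OF assms assms(2)])
  then have "Re (cinner h x) = (norm x)\<^sup>2 + (norm w)\<^sup>2" by (simp add: cinner_self)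
  then have "norm x * norm x \<le> norm h * norm x"
    using Re_cinner_le[of h x] by (simp add: power2_eq_square) (smt (verit) mult_nonneg_nonneg norm_ge_zero)
  then show ?thesis by (cases "norm x = 0") simp_all
qed

text \<open>The relation \<open>P h x\<close> below expresses \<open>x + D\<^sup>2 x = h\<close>. It is linear and norm decreasing from \<open>h\<close> to \<open>x\<close>,
  hence the graph of a bounded operator once every \<open>h\<close> is known to have a solution.\<close>

lemma inverse_one_plus_sq_iff:
  fixes D :: "('h::chilbert_space \<times> 'h) set"
  assumes D: "selfadjoint_op D"
  shows "bop_apply (inverse_one_plus_sq D) h = x \<longleftrightarrow> (\<exists>w. (x, w) \<in> D \<and> (w, h - x) \<in> D)"
proof -
  have sub: "csubspace D" using D by (simp add: selfadjoint_op_def densely_defined_def)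
  define P where "P h x \<longleftrightarrow> (\<exists>w. (x, w) \<in> D \<and> (w, h - x) \<in> D)" for h x
  have P_add: "P (h + k) (x + y)" if "P h x" "P k y" for h k x y
  proof -
    obtain w v where "(x, w) \<in> D" "(w, h - x) \<in> D" "(y, v) \<in> D" "(v, k - y) \<in> D"
      using \<open>P h x\<close> \<open>P k y\<close> unfolding P_def by blast
    then have "(x + y, w + v) \<in> D" "(w + v, (h - x) + (k - y)) \<in> D"
      using csubspace_pair_add[OF sub] by blast+
    then show ?thesis unfolding P_def by (auto simp: algebra_simps)
  qed
  have P_scale: "P (c *\<^sub>C h) (c *\<^sub>C x)" if "P h x" for h x c
    using that csubspace_pair_scale[OF sub, of _ _ c] unfolding P_def
    by (metis complex_vector.scale_right_diff_distrib)
  have P_norm: "norm x \<le> norm h" if "P h x" for h x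
    using that one_plus_sq_norm_le[OF D] unfolding P_def by blast
  have P_unique: "x = y" if "P h x" "P h y" for h x y
  proof -
    have "P (h + (- 1) *\<^sub>C h) (x + (- 1) *\<^sub>C y)" by (intro P_add P_scale that)
    then show ?thesis using P_norm by fastforce
  qed
  have "\<exists>x. P h x" for h
    using selfadjoint_one_plus_sq_surj[OF D, of h] unfolding P_def by blast
  then obtain f where f: "P h (f h)" for h by metis
  have "bounded_clinear f"
    unfolding bounded_clinear_def
  proof (intro conjI allI bounded_linear_intro[of _ 1])
    show "f (x + y) = f x + f y" for x y by (intro P_unique[OF f] P_add f)
    show fC: "f (c *\<^sub>C x) = c *\<^sub>C f x" for c x by (intro P_unique[OF f] P_scale f)
    show "f (r *\<^sub>R x) = r *\<^sub>R f x" for r x by (simp add: scaleR_scaleC fC)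
    show "norm (f x) \<le> norm x * 1" for x using P_norm[OF f] by simp
  qed
  then obtain R where R: "bop_apply R = f" using Abs_bop_inverse[of f] by auto
  have R_iff: "bop_apply R h = x \<longleftrightarrow> P h x" for h x using R f P_unique by auto
  have graph: "bop_graph R = (op_plus Id (D O D))\<inverse>"
  proof -
    have "(h, x) \<in> (op_plus Id (D O D))\<inverse> \<longleftrightarrow> P h x" for h x
    proof
      assume "(h, x) \<in> (op_plus Id (D O D))\<inverse>"
      then obtain z where "h = x + z" "(x, z) \<in> D O D" by (auto simp: op_plus_def)
      then show "P h x" unfolding P_def by auto
    next
      assume "P h x"
      then have "(x, h - x) \<in> D O D" unfolding P_def by blast
      then have "(x, x + (h - x)) \<in> op_plus Id (D O D)" unfolding op_plus_def by blast
      then show "(h, x) \<in> (op_plus Id (D O D))\<inverse>" by simp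
    qed
    moreover have "(h, x) \<in> bop_graph R \<longleftrightarrow> P h x" for h x
      using R_iff[of h x] by (auto simp: bop_graph_def)
    ultimately show ?thesis by (metis subrelI subset_antisym)
  qed
  have "inverse_one_plus_sq D = R"
    unfolding inverse_one_plus_sq_def
  proof (rule the_equality)
    show "bop_graph R = (op_plus Id (D O D))\<inverse>" by (rule graph)
  next
    fix R' assume "bop_graph R' = (op_plus Id (D O D))\<inverse>"
    then have "bop_graph R' = bop_graph R" by (simp only: graph)
    then show "R' = R" by (intro bop_eqI) (auto simp: bop_graph_def)
  qed
  then show ?thesis using R_iff unfolding P_def by simp
qed

lemma pos_inverse_one_plus_sq:
  assumes D: "selfadjoint_op D"
  shows "pos_bop (inverse_one_plus_sq D)"
proof -
  define R where "R = inverse_one_plus_sq D"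
  have ex: "\<exists>w. (bop_apply R h, w) \<in> D \<and> (w, h - bop_apply R h) \<in> D" for h
    unfolding R_def inverse_one_plus_sq_iff[OF D, symmetric] by simp
  have "cinner (bop_apply R h) k = cinner h (bop_apply R k)" for h k
  proof -
    obtain w where w: "(bop_apply R h, w) \<in> D" "(w, h - bop_apply R h) \<in> D" using ex by blast
    obtain v where v: "(bop_apply R k, v) \<in> D" "(v, k - bop_apply R k) \<in> D" using ex by blast
    have "cinner k (bop_apply R h) = cinner (bop_apply R k) (bop_apply R h) + cinner v w"
      by (rule one_plus_sq_cinner[OF D v w(1)])
    moreover have "cinner h (bop_apply R k) = cinner (bop_apply R h) (bop_apply R k) + cinner w v"
      by (rule one_plus_sq_cinner[OF D w v(1)])
    ultimately show ?thesis by (metis cinner_add_left cinner_commute complex_cnj_add)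
  qed
  moreover have "0 \<le> Re (cinner h (bop_apply R h))" for h
  proof -
    obtain w where w: "(bop_apply R h, w) \<in> D" "(w, h - bop_apply R h) \<in> D" using ex by blast
    show ?thesis using one_plus_sq_cinner[OF D w w(1)] by (simp add: cinner_self)
  qed
  ultimately show ?thesis unfolding pos_bop_def R_def[symmetric] by (simp add: selfadjointI)
qed

lemma inverse_one_plus_sq_injective:
  assumes D: "selfadjoint_op D" and "bop_apply (inverse_one_plus_sq D) h = 0"
  shows "h = 0"
proof -
  have "csubspace D" "single_valued D" using D by (auto simp: selfadjoint_op_def densely_defined_def)
  note zero = single_valued_zero[OF this]
  obtain w where w: "(0, w) \<in> D" "(w, h - 0) \<in> D"
    using assms(2) inverse_one_plus_sq_iff[OF D] by blast
  then show ?thesis using zero[of w] zero[of h] by simp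
qed

section \<open>Compact positive operators\<close>

text \<open>A maximizing sequence of unit vectors for \<open>norm (R x)\<close> on an invariant subspace becomes an
  approximate eigenvector of \<open>R\<^sup>2\<close>; compactness makes it converge, and positivity turns an
  eigenvector of \<open>R\<^sup>2\<close> into one of \<open>R\<close>.\<close>

lemma compact_positive_eigenvector:
  fixes R :: "'h::chilbert_space bop"
  assumes R: "pos_bop R" and comp: "compact_bop R"
    and N: "csubspace N" "closed N" "N \<noteq> {0}" and inv: "\<And>x. x \<in> N \<Longrightarrow> bop_apply R x \<in> N"
  obtains x r where "x \<in> N" "norm x = 1" "bop_apply R x = r *\<^sub>R x"
proof -
  have sa: "star R = R" using R by (simp add: pos_bop_def)
  define U where "U = {x \<in> N. norm x = 1}"
  obtain z where z: "z \<in> N" "z \<noteq> 0" using N complex_vector.subspace_0[OF N(1)] by blast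
  have "(1 / norm z) *\<^sub>R z \<in> U"
    unfolding U_def using z csubspace_scaleR[OF N(1)] by simp
  then have U0: "U \<noteq> {}" by blast
  define m where "m = Sup ((\<lambda>x. norm (bop_apply R x)) ` U)"
  have bdd: "bdd_above ((\<lambda>x. norm (bop_apply R x)) ` U)"
  proof (rule bdd_aboveI2)
    show "norm (bop_apply R x) \<le> norm R" if "x \<in> U" for x
      using norm_bop_apply[of R x] that by (simp add: U_def)
  qed
  have le_U: "norm (bop_apply R x) \<le> m" if "x \<in> U" for x
    unfolding m_def using that bdd by (intro cSup_upper) auto
  have le_m: "norm (bop_apply R x) \<le> m * norm x" if x: "x \<in> N" for x
  proof (cases "x = 0")
    case False
    have "(1 / norm x) *\<^sub>R x \<in> U"
      unfolding U_def using False x csubspace_scaleR[OF N(1)] by simp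
    from le_U[OF this] show ?thesis using False by (simp add: bop_scaleR field_simps)
  qed simp
  have m0: "0 \<le> m" using U0 le_U by (meson ex_in_conv norm_ge_zero order_trans)
  show ?thesis
  proof (cases "m = 0")
    case True
    obtain x where "x \<in> U" using U0 by blast
    then show ?thesis using le_U[of x] True that[of x 0] by (simp add: U_def)
  next
    case False
    then have m: "m > 0" using m0 by simp
    have "\<exists>x\<in>U. m - 1 / real (Suc n) < norm (bop_apply R x)" for n
    proof -
      have "m - 1 / real (Suc n) < Sup ((\<lambda>x. norm (bop_apply R x)) ` U)" by (simp add: m_def)
      then show ?thesis using less_cSupD[of "(\<lambda>x. norm (bop_apply R x)) ` U"] U0 by blast
    qed
    then obtain X where X: "\<And>n. X n \<in> U" "\<And>n. m - 1 / real (Suc n) < norm (bop_apply R (X n))"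
      by metis
    have lim_norm: "(\<lambda>n. norm (bop_apply R (X n))) \<longlonglongrightarrow> m"
    proof (rule tendsto_sandwich[OF always_eventually always_eventually])
      show "\<forall>n. m - 1 / real (Suc n) \<le> norm (bop_apply R (X n))" using X(2) less_imp_le by blast
      show "\<forall>n. norm (bop_apply R (X n)) \<le> m" using X(1) le_U by blast
      have "(\<lambda>n. m - 1 / real (Suc n)) \<longlonglongrightarrow> m - 0"
        by (intro tendsto_diff tendsto_const) (use LIMSEQ_inverse_real_of_nat in \<open>simp add: inverse_eq_divide\<close>)
      then show "(\<lambda>n. m - 1 / real (Suc n)) \<longlonglongrightarrow> m" by simp
    qed simp
    \<comment> \<open>The failure of \<open>X n\<close> to be an eigenvector of \<open>R\<^sup>2\<close> for the eigenvalue \<open>m\<^sup>2\<close>.\<close>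
    define d where "d n = bop_apply R (bop_apply R (X n)) - m\<^sup>2 *\<^sub>R X n" for n
    have d_le: "(norm (d n))\<^sup>2 \<le> m\<^sup>2 * (m\<^sup>2 - (norm (bop_apply R (X n)))\<^sup>2)" for n
    proof -
      define y where "y = bop_apply R (X n)"
      have y: "y \<in> N" unfolding y_def using X(1) inv by (simp add: U_def)
      have "norm (X n) = 1" using X(1) by (simp add: U_def)
      moreover have "cinner (bop_apply R y) (X n) = complex_of_real ((norm y)\<^sup>2)"
        unfolding cinner_selfadjoint[OF sa] y_def[symmetric] by (rule cinner_self)
      ultimately have "(norm (bop_apply R y + - (m\<^sup>2 *\<^sub>R X n)))\<^sup>2
          = (norm (bop_apply R y))\<^sup>2 + (m\<^sup>2)\<^sup>2 - 2 * m\<^sup>2 * (norm y)\<^sup>2"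
        unfolding norm_plus_sq by (simp add: cinner_minus_right cinner_scaleR_right)
      moreover have "(norm (bop_apply R y))\<^sup>2 \<le> (m * norm y)\<^sup>2"
        by (intro power_mono le_m y) simp
      ultimately show ?thesis
        unfolding d_def y_def[symmetric] by (simp add: power_mult_distrib algebra_simps power2_eq_square)
    qed
    have "(\<lambda>n. m\<^sup>2 * (m\<^sup>2 - (norm (bop_apply R (X n)))\<^sup>2)) \<longlonglongrightarrow> m\<^sup>2 * (m\<^sup>2 - m\<^sup>2)"
      by (intro tendsto_intros lim_norm)
    then have "(\<lambda>n. m\<^sup>2 * (m\<^sup>2 - (norm (bop_apply R (X n)))\<^sup>2)) \<longlonglongrightarrow> 0" by simp
    then have "(\<lambda>n. (norm (d n))\<^sup>2) \<longlonglongrightarrow> 0"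
      by (rule tendsto_0_le[where K = 1]) (use d_le in \<open>auto intro!: always_eventually order_trans[OF _ abs_ge_self]\<close>)
    then have "(\<lambda>n. sqrt ((norm (d n))\<^sup>2)) \<longlonglongrightarrow> sqrt 0" by (rule tendsto_real_sqrt)
    then have d0: "d \<longlonglongrightarrow> 0" by (simp add: tendsto_norm_zero_iff)
    have "bop_apply R (X n) \<in> closure (bop_apply R ` cball 0 1)" for n
      using X(1) by (intro subsetD[OF closure_subset] imageI) (simp add: U_def)
    then obtain y s where "strict_mono s" "((\<lambda>n. bop_apply R (X n)) \<circ> s) \<longlonglongrightarrow> y"
      using seq_compactE[OF compact_imp_seq_compact[OF comp[unfolded compact_bop_def]],
          of "\<lambda>n. bop_apply R (X n)"] by blast
    then have y: "strict_mono s" "(\<lambda>n. bop_apply R (X (s n))) \<longlonglongrightarrow> y" by (simp_all add: o_def)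
    have ds: "(\<lambda>n. d (s n)) \<longlonglongrightarrow> 0" using LIMSEQ_subseq_LIMSEQ[OF d0 y(1)] by (simp add: o_def)
    have "(\<lambda>n. (1 / m\<^sup>2) *\<^sub>R (bop_apply R (bop_apply R (X (s n))) - d (s n))) \<longlonglongrightarrow> (1 / m\<^sup>2) *\<^sub>R (bop_apply R y - 0)"
      by (intro tendsto_intros tendsto_bop_apply y ds)
    moreover define x where "x = (1 / m\<^sup>2) *\<^sub>R (bop_apply R y)"
    ultimately have lim: "(\<lambda>n. X (s n)) \<longlonglongrightarrow> x" using m by (simp add: d_def)
    have xN: "x \<in> N" using closed_sequentially[OF N(2) _ lim] X(1) by (simp add: U_def)
    have "(\<lambda>n. norm (X (s n))) \<longlonglongrightarrow> norm x" by (rule tendsto_norm[OF lim])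
    then have x1: "norm x = 1" using X(1) by (simp add: U_def LIMSEQ_const_iff)
    have "(\<lambda>n. d (s n)) \<longlonglongrightarrow> bop_apply R (bop_apply R x) - m\<^sup>2 *\<^sub>R x"
      unfolding d_def by (intro tendsto_intros tendsto_bop_apply lim)
    then have RR: "bop_apply R (bop_apply R x) = m\<^sup>2 *\<^sub>R x" using ds LIMSEQ_unique by fastforce
    \<comment> \<open>Since \<open>(R + m) (R - m) x = 0\<close>, this vector would be an eigenvector for \<open>- m < 0\<close>.\<close>
    define z where "z = bop_apply R x - m *\<^sub>R x"
    have "bop_apply R z = - m *\<^sub>R z"
      by (simp add: z_def bop_diff bop_scaleR RR power2_eq_square algebra_simps)
    then have "Re (cinner z (bop_apply R z)) = - m * (norm z)\<^sup>2"
      by (simp only: cinner_scaleR_right cinner_self) simp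
    moreover have "0 \<le> Re (cinner z (bop_apply R z))" using R by (simp add: pos_bop_def)
    ultimately have "z = 0" using m by (simp add: mult_le_0_iff)
    then show ?thesis using that[OF xN x1, of m] by (simp add: z_def)
  qed
qed

text \<open>A maximal orthonormal set of eigenvectors exists by Zorn's lemma. Its orthogonal complement is invariant, so
  a nonzero complement would contain another eigenvector.\<close>

theorem compact_positive_eigenbasis:
  fixes R :: "'h::chilbert_space bop"
  assumes R: "pos_bop R" and comp: "compact_bop R"
  obtains B r where "orthonormal_basis B" "\<And>b. b \<in> B \<Longrightarrow> bop_apply R b = r b *\<^sub>R b"
proof -
  define Z where "Z = {E. orthonormal E \<and> (\<forall>b\<in>E. \<exists>r. bop_apply R b = r *\<^sub>R b)}"
  have "\<Union>C \<in> Z" if C: "subset.chain Z C" for C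
  proof -
    have "cinner x y = (if x = y then 1 else 0)" if xy: "x \<in> \<Union>C" "y \<in> \<Union>C" for x y
    proof -
      obtain E F where EF: "E \<in> C" "F \<in> C" "x \<in> E" "y \<in> F" using xy by blast
      then have "E \<subseteq> F \<or> F \<subseteq> E" using subset_chain_def[of Z C] C by blast
      then have "x \<in> E \<and> y \<in> E \<or> x \<in> F \<and> y \<in> F" using EF by blast
      moreover have "C \<subseteq> Z" using C by (simp add: subset_chain_def)
      then have "orthonormal E" "orthonormal F" using EF unfolding Z_def by blast+
      ultimately show ?thesis using orthonormal_cinner by metis
    qed
    then have "orthonormal (\<Union>C)" unfolding orthonormal_def by blast
    moreover have "C \<subseteq> Z" using C by (simp add: subset_chain_def)
    then have "\<forall>b\<in>\<Union>C. \<exists>r. bop_apply R b = r *\<^sub>R b" unfolding Z_def by blast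
    ultimately show ?thesis unfolding Z_def by simp
  qed
  then obtain E where E: "E \<in> Z" "\<And>F. F \<in> Z \<Longrightarrow> E \<subseteq> F \<Longrightarrow> F = E"
    using subset_Zorn'[of Z] by blast
  have oE: "orthonormal E" using E(1) by (simp add: Z_def)
  have "orthonormal_basis E"
  proof (rule orthonormal_basisI[OF oE])
    fix x assume x: "\<And>b. b \<in> E \<Longrightarrow> cinner b x = 0"
    define N where "N = {x. \<forall>b\<in>E. cinner b x = 0}"
    show "x = 0"
    proof (rule ccontr)
      assume "x \<noteq> 0"
      have "N = (\<Inter>b\<in>E. {x. cinner b x = 0})" by (auto simp: N_def)
      then have cl: "closed N"
        by (simp only:) (intro closed_INT ballI closed_Collect_eq continuous_on_cinner continuous_on_id continuous_on_const)
      have sub: "csubspace N"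
        by (rule complex_vector.subspaceI) (simp_all add: N_def cinner_add_right cinner_scaleC_right)
      have N0: "N \<noteq> {0}" using x \<open>x \<noteq> 0\<close> by (auto simp: N_def)
      have inv: "bop_apply R y \<in> N" if y: "y \<in> N" for y
        unfolding N_def
      proof (intro CollectI ballI)
        fix b assume b: "b \<in> E"
        then obtain r where "bop_apply R b = r *\<^sub>R b" using E(1) by (auto simp: Z_def)
        then have "cinner b (bop_apply R y) = cinner (r *\<^sub>R b) y"
          using R by (simp add: pos_bop_def flip: cinner_selfadjoint)
        then show "cinner b (bop_apply R y) = 0"
          using y b by (simp add: N_def scaleR_scaleC cinner_scaleC_left)
      qed
      obtain v r where v: "v \<in> N" "norm v = 1" "bop_apply R v = r *\<^sub>R v"
        using compact_positive_eigenvector[OF R comp sub cl N0 inv] by blast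
      have vE: "cinner b v = 0" "cinner v b = 0" if "b \<in> E" for b
        using v(1) that cinner_commute[of v b] by (simp_all add: N_def)
      have "orthonormal (insert v E)"
        unfolding orthonormal_def using orthonormal_cinner[OF oE] vE v(2)
        by (metis cinner_self insert_iff of_real_1 one_power2)
      then have "insert v E \<in> Z" using E(1) v(3) by (auto simp: Z_def)
      then have "v \<in> E" using E(2) by blast
      then show False using vE(1)[of v] v(2) by (simp add: cinner_self)
    qed
  qed
  moreover have "\<forall>b\<in>E. \<exists>r. bop_apply R b = r *\<^sub>R b" using E(1) by (simp add: Z_def)
  then obtain r where "\<forall>b\<in>E. bop_apply R b = r b *\<^sub>R b" by (rule bchoice[THEN exE])
  ultimately show ?thesis using that by blast
qed

lemma compact_bop_times_left:
  assumes "compact_bop T"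
  shows "compact_bop (S * T)"
proof -
  have "compact (bop_apply S ` closure (bop_apply T ` cball 0 1))" (is "compact ?K")
    using assms linear_continuous_on[OF bounded_linear_bop]
    by (intro compact_continuous_image) (simp_all add: compact_bop_def)
  moreover have "bop_apply (S * T) ` cball 0 1 \<subseteq> ?K"
    using closure_subset by (fastforce simp: times_bop.rep_eq)
  then have "closure (bop_apply (S * T) ` cball 0 1) \<subseteq> ?K"
    by (rule closure_minimal) (rule compact_imp_closed[OF calculation])
  ultimately show ?thesis
    unfolding compact_bop_def by (metis closed_closure compact_Int_closed Int_absorb1)
qed

text \<open>Images of distinct basis vectors with eigenvalue above \<open>e\<close> have distance at least \<open>e\<close>, so
  a relatively compact set contains only finitely many of them.\<close>

lemma compact_bop_finite_eigenvalues:
  assumes comp: "compact_bop T" and B: "orthonormal B"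
    and T: "\<And>b. b \<in> B \<Longrightarrow> bop_apply T b = t b *\<^sub>R b" and e: "e > 0"
  shows "finite {b \<in> B. t b > e}"
proof -
  define I where "I = {b \<in> B. t b > e}"
  define K where "K = closure (bop_apply T ` cball 0 1)"
  obtain k where k: "finite k" "K \<subseteq> (\<Union>x\<in>k. ball x (e / 2))"
    using comp half_gt_zero[OF e] unfolding compact_bop_def compact_eq_totally_bounded K_def
    by blast
  have "bop_apply T b \<in> K" if "b \<in> I" for b
    using that orthonormal_norm[OF B] unfolding K_def I_def
    by (intro subsetD[OF closure_subset] imageI) simp
  then have "\<forall>b\<in>I. \<exists>x. x \<in> k \<and> dist x (bop_apply T b) < e / 2" using k(2) by force
  then obtain c where c: "\<And>b. b \<in> I \<Longrightarrow> c b \<in> k" "\<And>b. b \<in> I \<Longrightarrow> dist (c b) (bop_apply T b) < e / 2"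
    by metis
  have "inj_on c I"
  proof (rule inj_onI, rule ccontr)
    fix a b assume ab: "a \<in> I" "b \<in> I" "c a = c b" "a \<noteq> b"
    have "dist (bop_apply T a) (bop_apply T b) < e"
      using c(2)[OF ab(1)] c(2)[OF ab(2)] ab(3) by (metis dist_commute dist_triangle_half_r)
    then have "(norm (t a *\<^sub>R a + - (t b *\<^sub>R b)))\<^sup>2 < e\<^sup>2"
      using ab T by (simp add: I_def dist_norm power_strict_mono)
    moreover have "(norm (t a *\<^sub>R a + - (t b *\<^sub>R b)))\<^sup>2 = (t a)\<^sup>2 + (t b)\<^sup>2"
      using ab B unfolding norm_plus_sq
      by (simp add: I_def orthonormal_norm orthonormal_def cinner_minus_right scaleR_scaleC
          cinner_scaleC_left cinner_scaleC_right norm_scaleC power_mult_distrib)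
    moreover have "e\<^sup>2 \<le> (t a)\<^sup>2" using ab e by (intro power_mono) (simp_all add: I_def)
    moreover have "0 \<le> (t b)\<^sup>2" by simp
    ultimately show False by linarith
  qed
  then show ?thesis using inj_on_finite[of c I k] c(1) k(1) unfolding I_def by blast
qed

lemma compact_bounded_combinations:
  fixes F :: "'h::complex_normed_vector set"
  assumes "finite F"
  shows "compact {\<Sum>b\<in>F. c b *\<^sub>C b | c. \<forall>b\<in>F. cmod (c b) \<le> C}"
  using assms
proof induction
  case (insert a F)
  define K where "K = {\<Sum>b\<in>F. c b *\<^sub>C b | c. \<forall>b\<in>F. cmod (c b) \<le> C}"
  have "{\<Sum>b\<in>insert a F. c b *\<^sub>C b | c. \<forall>b\<in>insert a F. cmod (c b) \<le> C}
      = (\<lambda>(z, y). z *\<^sub>C a + y) ` (cball 0 C \<times> K)"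
  proof (intro equalityI subsetI)
    fix x assume "x \<in> {\<Sum>b\<in>insert a F. c b *\<^sub>C b | c. \<forall>b\<in>insert a F. cmod (c b) \<le> C}"
    then show "x \<in> (\<lambda>(z, y). z *\<^sub>C a + y) ` (cball 0 C \<times> K)"
      using insert.hyps by (force simp: K_def)
  next
    fix x assume "x \<in> (\<lambda>(z, y). z *\<^sub>C a + y) ` (cball 0 C \<times> K)"
    then obtain z c where zc: "cmod z \<le> C" "\<forall>b\<in>F. cmod (c b) \<le> C" "x = z *\<^sub>C a + (\<Sum>b\<in>F. c b *\<^sub>C b)"
      by (auto simp: K_def)
    have "(\<Sum>b\<in>F. c b *\<^sub>C b) = (\<Sum>b\<in>F. (c(a := z)) b *\<^sub>C b)"
      using insert.hyps by (intro sum.cong) auto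
    then show "x \<in> {\<Sum>b\<in>insert a F. c b *\<^sub>C b | c. \<forall>b\<in>insert a F. cmod (c b) \<le> C}"
      using zc insert.hyps by (intro CollectI exI[of _ "c(a := z)"]) simp
  qed
  moreover have "compact ((\<lambda>(z, y). z *\<^sub>C a + y) ` (cball 0 C \<times> K))"
    using insert.IH unfolding K_def[symmetric] split_def
    by (intro compact_continuous_image compact_Times continuous_intros continuous_on_scaleC) auto
  ultimately show ?case by simp
qed simp

lemma selfadjoint_eigen_coeff:
  assumes "star T = T" "bop_apply T b = t *\<^sub>R b"
  shows "cinner b (bop_apply T x) = complex_of_real t * cinner b x"
  unfolding cinner_selfadjoint[OF assms(1), symmetric] assms(2)
  by (simp add: scaleR_scaleC cinner_scaleC_left)

text \<open>Cutting off the finitely many large eigenvalues leaves an operator of small norm, and the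
  finite part maps the ball into a compact set.\<close>

lemma compact_bop_diagonal:
  fixes T :: "'h::chilbert_space bop"
  assumes B: "orthonormal_basis B" and sa: "star T = T"
    and T: "\<And>b. b \<in> B \<Longrightarrow> bop_apply T b = t b *\<^sub>R b" and t0: "\<And>b. b \<in> B \<Longrightarrow> 0 \<le> t b"
    and fin: "\<And>e. e > 0 \<Longrightarrow> finite {b \<in> B. t b > e}"
  shows "compact_bop T"
  unfolding compact_bop_def compact_eq_totally_bounded
proof (intro conjI allI impI)
  show "complete (closure (bop_apply T ` cball 0 1))" by (simp add: complete_eq_closed)
  fix e :: real assume e: "e > 0"
  have oB: "orthonormal B" by (rule orthonormal_basisD[OF B])
  define F where "F = {b \<in> B. t b > e / 4}"
  have F: "finite F" "F \<subseteq> B" using fin[of "e / 4"] e by (auto simp: F_def)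
  define K where "K = {\<Sum>b\<in>F. c b *\<^sub>C b | c. \<forall>b\<in>F. cmod (c b) \<le> norm T}"
  obtain k where k: "finite k" "K \<subseteq> (\<Union>x\<in>k. ball x (e / 4))"
  proof -
    have "compact K" "e / 4 > 0"
      using compact_bounded_combinations[OF F(1), of "norm T"] e by (simp_all add: K_def)
    then show ?thesis using that unfolding compact_eq_totally_bounded by blast
  qed
  have "bop_apply T ` cball 0 1 \<subseteq> (\<Union>x\<in>k. cball x (e / 2))"
  proof
    fix y assume "y \<in> bop_apply T ` cball 0 1"
    then obtain x where x: "norm x \<le> 1" and y: "y = bop_apply T x" by auto
    define s where "s = (\<Sum>b\<in>F. cinner b y *\<^sub>C b)"
    have "norm y \<le> norm T" using norm_bop_apply[of T x] x unfolding y
      by (meson mult_left_le norm_ge_zero order_trans)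
    then have "cmod (cinner b y) \<le> norm T" if "b \<in> F" for b
      using cmod_cinner_le[of b y] orthonormal_norm[OF oB, of b] that F by fastforce
    then have "s \<in> K" unfolding s_def K_def by (intro CollectI exI[of _ "\<lambda>b. cinner b y"]) simp
    then obtain z where z: "z \<in> k" "dist z s < e / 4" using k by auto
    have coeff: "(cmod (cinner b (y - s)))\<^sup>2 \<le> (e / 4)\<^sup>2 * (cmod (cinner b x))\<^sup>2" if b: "b \<in> B" for b
    proof (cases "b \<in> F")
      case True
      then have "cinner b (y - s) = 0"
        using cinner_orthonormal_sum[OF oB F, of b "\<lambda>b. cinner b y"] by (simp add: s_def cinner_diff_right)
      then show ?thesis by simp
    next
      case False
      have "cinner b s = 0"
        unfolding s_def cinner_sum_right cinner_scaleC_right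
      proof (intro sum.neutral ballI)
        fix a assume "a \<in> F"
        then have "cinner b a = 0" using False b F orthonormal_cinner[OF oB, of b a] by auto
        then show "cinner a y * cinner b a = 0" by simp
      qed
      then have "cmod (cinner b (y - s)) = t b * cmod (cinner b x)"
        using t0[OF b] by (simp add: y cinner_diff_right selfadjoint_eigen_coeff[OF sa T[OF b]] norm_mult)
      also have "\<dots> \<le> e / 4 * cmod (cinner b x)"
        using False b by (intro mult_right_mono) (simp_all add: F_def)
      finally show ?thesis by (metis norm_ge_zero power_mono power_mult_distrib)
    qed
    have "(norm (y - s))\<^sup>2 \<le> (e / 4)\<^sup>2 * (norm x)\<^sup>2"
      by (rule has_sum_mono[OF parseval[OF B] has_sum_cmult_right[OF parseval[OF B]] coeff])
    also have "\<dots> \<le> (e / 4)\<^sup>2 * 1" using x by (intro mult_left_mono power_le_one) simp_all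
    finally have "norm (y - s) \<le> e / 4" using e by (simp add: power2_le_iff_abs_le abs_of_pos flip: power_divide)
    then have "dist z y \<le> e / 2" using z(2) dist_triangle[of z y s] by (simp add: dist_norm norm_minus_commute)
    then show "y \<in> (\<Union>x\<in>k. cball x (e / 2))" using z(1) by auto
  qed
  moreover have "closed (\<Union>x\<in>k. cball x (e / 2))" using k(1) by (intro closed_UN) auto
  ultimately have "closure (bop_apply T ` cball 0 1) \<subseteq> (\<Union>x\<in>k. cball x (e / 2))"
    by (rule closure_minimal)
  also have "\<dots> \<subseteq> (\<Union>x\<in>k. ball x e)" using e by force
  finally show "\<exists>k. finite k \<and> closure (bop_apply T ` cball 0 1) \<subseteq> (\<Union>x\<in>k. ball x e)"
    using k(1) by blast
qed

section \<open>Trace class and summability\<close>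

lemma has_sum_finite_sum:
  fixes f :: "'b \<Rightarrow> 'e \<Rightarrow> real"
  assumes "\<And>b. b \<in> F \<Longrightarrow> (f b has_sum s b) E"
  shows "((\<lambda>e. \<Sum>b\<in>F. f b e) has_sum (\<Sum>b\<in>F. s b)) E"
  using assms by (induction F rule: infinite_finite_induct) (simp_all add: has_sum_add)

text \<open>Expanding \<open>cinner e (Q e) = \<Sum> q\<^sub>b (cmod (cinner b e))\<^sup>2\<close> and summing over \<open>e\<close> first gives back \<open>q\<^sub>b\<close>, by
  the Parseval identity in the basis \<open>E\<close>. For finitely many \<open>b\<close> the exchange of sums is harmless, and a uniform
  bound on finite sums suffices.\<close>

lemma summable_diagonal_basis_independent:
  fixes Q :: "'h::chilbert_space bop"
  assumes B: "orthonormal_basis B" and sa: "star Q = Q"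
    and Q: "\<And>b. b \<in> B \<Longrightarrow> bop_apply Q b = q b *\<^sub>R b" and q0: "\<And>b. b \<in> B \<Longrightarrow> 0 \<le> q b"
    and E: "orthonormal_basis E" and sum: "(\<lambda>e. cinner e (bop_apply Q e)) summable_on E"
  shows "q summable_on B"
proof (rule nonneg_bdd_above_summable_on[OF q0])
  define a where "a e = Re (cinner e (bop_apply Q e))" for e
  obtain S where S: "(a has_sum S) E"
    using summable_on_Re[OF sum] unfolding a_def summable_on_def by blast
  have a_sum: "((\<lambda>b. q b * (cmod (cinner b e))\<^sup>2) has_sum a e) B" for e
  proof -
    have "((\<lambda>b. Re (cinner e b * cinner b (bop_apply Q e))) has_sum a e) B"
      unfolding a_def by (intro has_sum_Re orthonormal_basis_cinner B)
    moreover have "Re (cinner e b * cinner b (bop_apply Q e)) = q b * (cmod (cinner b e))\<^sup>2" if "b \<in> B" for b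
    proof -
      have "cinner e b * cinner b (bop_apply Q e) = complex_of_real (q b) * (cinner b e * cnj (cinner b e))"
        unfolding selfadjoint_eigen_coeff[OF sa Q[OF that]] by (subst cinner_commute[of e b]) (simp only: ac_simps)
      also have "\<dots> = complex_of_real (q b * (cmod (cinner b e))\<^sup>2)"
        by (simp only: complex_norm_square of_real_mult)
      finally show ?thesis by (simp only: Re_complex_of_real)
    qed
    ultimately show ?thesis by (rule has_sum_cong[THEN iffD1, rotated])
  qed
  have "sum q F \<le> S" if F: "finite F" "F \<subseteq> B" for F
  proof -
    have "((\<lambda>e. \<Sum>b\<in>F. q b * (cmod (cinner b e))\<^sup>2) has_sum (\<Sum>b\<in>F. q b * 1)) E"
    proof (rule has_sum_finite_sum)
      fix b assume "b \<in> F"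
      then have "norm b = 1" using F orthonormal_norm[OF orthonormal_basisD[OF B]] by blast
      then have "((\<lambda>e. (cmod (cinner e b))\<^sup>2) has_sum 1) E" using parseval[OF E, of b] by simp
      moreover have "cmod (cinner e b) = cmod (cinner b e)" for e
        by (subst cinner_commute) (rule complex_mod_cnj)
      ultimately show "((\<lambda>e. q b * (cmod (cinner b e))\<^sup>2) has_sum q b * 1) E"
        by (intro has_sum_cmult_right) simp
    qed
    then have "(\<Sum>b\<in>F. q b * 1) \<le> S"
    proof (rule has_sum_mono[OF _ S])
      fix e
      show "(\<Sum>b\<in>F. q b * (cmod (cinner b e))\<^sup>2) \<le> a e"
        by (rule finite_sum_le_has_sum[OF a_sum F]) (simp add: q0)
    qed
    then show ?thesis by simp
  qed
  then show "bdd_above (sum q ` {F. F \<subseteq> B \<and> finite F})" by (intro bdd_aboveI2[of _ _ S]) simp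
qed

lemma pos_bop_star_times: "pos_bop (star T * T)"
  by (simp add: pos_bop_def star_mult star_star times_bop.rep_eq cinner_star_right cinner_self)

text \<open>A nonnegative diagonal operator is its own absolute value.\<close>

lemma trace_class_diagonal:
  fixes T :: "'h::chilbert_space bop"
  assumes B: "orthonormal_basis B" and sa: "star T = T"
    and T: "\<And>b. b \<in> B \<Longrightarrow> bop_apply T b = t b *\<^sub>R b" and t0: "\<And>b. b \<in> B \<Longrightarrow> 0 \<le> t b"
  shows "trace_class T \<longleftrightarrow> t summable_on B"
proof -
  define Q where "Q = bop_powr (star T * T) (1 / 2)"
  have Q: "bop_apply Q b = t b *\<^sub>R b" if "b \<in> B" for b
  proof -
    have "bop_apply (star T * T) b = (t b * t b) *\<^sub>R b"
      by (simp add: sa times_bop.rep_eq T[OF that] bop_scaleR)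
    from bop_powr_eigenvector[OF pos_bop_star_times _ this, of "1 / 2"]
    show ?thesis using t0[OF that] by (simp add: Q_def powr_half_sqrt)
  qed
  have saQ: "star Q = Q" unfolding Q_def by (intro star_bop_powr pos_bop_star_times) simp
  have "(\<lambda>b. cinner b (bop_apply Q b)) summable_on B \<longleftrightarrow> (\<lambda>b. complex_of_real (t b)) summable_on B"
    using orthonormal_norm[OF orthonormal_basisD[OF B]]
    by (intro summable_on_cong) (simp add: Q cinner_scaleR_right cinner_self)
  then have "t summable_on B \<Longrightarrow> trace_class T"
    using B unfolding trace_class_def Q_def by (metis summable_on_of_real)
  moreover have "trace_class T \<Longrightarrow> t summable_on B"
    using summable_diagonal_basis_independent[OF B saQ Q t0] unfolding trace_class_def Q_def by blast
  ultimately show ?thesis by blast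
qed

lemma summable_op_iff:
  fixes D :: "('h::chilbert_space \<times> 'h) set"
  assumes D: "selfadjoint_op D" and B: "orthonormal_basis B"
    and r: "\<And>b. b \<in> B \<Longrightarrow> bop_apply (inverse_one_plus_sq D) b = r b *\<^sub>R b" and p: "p > 0"
  shows "summable_op p D \<longleftrightarrow> (\<lambda>b. r b powr (p / 2)) summable_on B"
  unfolding summable_op_def
  using p by (intro trace_class_diagonal B star_bop_powr bop_powr_eigenvector
      pos_inverse_one_plus_sq D r) simp_all

text \<open>The square root of the resolvent has the square roots of the eigenvalues; its square is the resolvent.\<close>

lemma compact_resolvent_iff:
  fixes D :: "('h::chilbert_space \<times> 'h) set"
  assumes D: "selfadjoint_op D" and B: "orthonormal_basis B"
    and r: "\<And>b. b \<in> B \<Longrightarrow> bop_apply (inverse_one_plus_sq D) b = r b *\<^sub>R b"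
  shows "compact_bop (bop_powr (inverse_one_plus_sq D) (1 / 2)) \<longleftrightarrow> (\<forall>e>0. finite {b \<in> B. r b > e})"
proof -
  define R where "R = inverse_one_plus_sq D"
  have R: "pos_bop R" unfolding R_def by (rule pos_inverse_one_plus_sq[OF D])
  show ?thesis
    unfolding R_def[symmetric]
  proof
    assume "compact_bop (bop_powr R (1 / 2))"
    then have "compact_bop R" using compact_bop_times_left bop_powr_half_square[OF R] by metis
    then show "\<forall>e>0. finite {b \<in> B. r b > e}"
      using compact_bop_finite_eigenvalues[OF _ orthonormal_basisD[OF B]] r by (simp add: R_def)
  next
    assume fin: "\<forall>e>0. finite {b \<in> B. r b > e}"
    show "compact_bop (bop_powr R (1 / 2))"
    proof (rule compact_bop_diagonal[OF B])
      show "star (bop_powr R (1 / 2)) = bop_powr R (1 / 2)" by (rule star_bop_powr[OF R]) simp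
      show "bop_apply (bop_powr R (1 / 2)) b = (r b powr (1 / 2)) *\<^sub>R b" if "b \<in> B" for b
        using r[OF that] by (intro bop_powr_eigenvector R) (simp_all add: R_def)
      show "0 \<le> r b powr (1 / 2)" for b by simp
      fix e :: real assume e: "e > 0"
      have "{b \<in> B. r b powr (1 / 2) > e} \<subseteq> {b \<in> B. r b > e\<^sup>2}"
      proof (safe)
        fix b assume b: "b \<in> B" "e < r b powr (1 / 2)"
        have "b \<noteq> 0" using orthonormal_norm[OF orthonormal_basisD[OF B] b(1)] by auto
        then have "0 \<le> r b" using pos_bop_eigenvalue[OF R] r[OF b(1)] by (simp add: R_def)
        moreover have "e\<^sup>2 < (r b powr (1 / 2))\<^sup>2" using b(2) e by (intro power_strict_mono) simp_all
        ultimately show "e\<^sup>2 < r b" by (simp add: powr_half_sqrt)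
      qed
      moreover have "finite {b \<in> B. r b > e\<^sup>2}" using fin e by simp
      ultimately show "finite {b \<in> B. r b powr (1 / 2) > e}" by (rule finite_subset)
    qed
  qed
qed

section \<open>Homomorphisms of C*-algebras are contractive\<close>

lemma unital_cstarD:
  assumes "unital_cstar A"
  shows "csubspace A" "\<And>x y. x \<in> A \<Longrightarrow> y \<in> A \<Longrightarrow> x * y \<in> A" "\<And>x. x \<in> A \<Longrightarrow> star x \<in> A" "closed A"
  using assms by (simp_all add: unital_cstar_def star_subalgebra_def)

lemma is_unit_of_unique: "is_unit_of A e \<Longrightarrow> is_unit_of A f \<Longrightarrow> e = f"
  unfolding is_unit_of_def by metis

lemma unit_of_eq: "is_unit_of A e \<Longrightarrow> unit_of A = e"
  unfolding unit_of_def using is_unit_of_unique by blast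

lemma is_unit_of_unit_of: "unital_cstar A \<Longrightarrow> is_unit_of A (unit_of A)"
  using unit_of_eq unfolding unital_cstar_def by metis

lemma star_unit: "unital_cstar A \<Longrightarrow> is_unit_of A e \<Longrightarrow> star e = e"
  using unital_cstarD(3)[of A e] unfolding is_unit_of_def by (metis star_mult star_star)

text \<open>A square root of \<open>e - a\<^sup>* a\<close> is \<open>e - y\<close> for a fixed point \<open>y\<close> of the contraction
  \<open>y \<mapsto> (a\<^sup>* a + y\<^sup>2) / 2\<close> on a ball of radius less than one. \<close>

lemma sqrt_unit_minus_square:
  fixes A :: "'a::cstar_algebra set"
  assumes A: "unital_cstar A" and e: "is_unit_of A e" and a: "a \<in> A" "norm a < 1"
  obtains c where "c \<in> A" "star c = c" "c * c = e - star a * a"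
proof -
  note alg = unital_cstarD[OF A]
  define d where "d = star a * a"
  have d: "d \<in> A" "star d = d" "norm d < 1"
    using a alg by (simp_all add: d_def star_mult star_star cstar_identity power_less_one_iff)
  \<comment> \<open>The midpoint between \<open>norm d\<close> and 1 bounds \<open>(norm d + r\<^sup>2) / 2\<close>, because \<open>r \<le> 1\<close>.\<close>
  define r where "r = (1 + norm d) / 2"
  have r: "0 \<le> r" "r < 1" using d by (simp_all add: r_def add_nonneg_nonneg)
  have r2: "(norm d + r * r) / 2 \<le> r"
  proof -
    have "r * r \<le> 1 * 1" using r by (intro mult_mono) simp_all
    then show ?thesis by (simp add: r_def)
  qed
  define Y where "Y = A \<inter> {y. star y = y} \<inter> cball 0 r"
  define f where "f y = (1 / 2 :: real) *\<^sub>R (d + y * y)" for y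
  have "closed {y :: 'a. star y = y}"
    by (intro closed_Collect_eq linear_continuous_on bounded_linear_star continuous_on_id)
  then have "complete Y"
    unfolding Y_def complete_eq_closed by (intro closed_Int alg(4) closed_cball)
  moreover have "Y \<noteq> {}"
    using complex_vector.subspace_0[OF alg(1)] r by (auto simp: Y_def intro!: exI[of _ 0])
  moreover have "f ` Y \<subseteq> Y"
  proof
    fix z assume "z \<in> f ` Y"
    then obtain y where y: "y \<in> A" "star y = y" "norm y \<le> r" "z = f y" by (auto simp: Y_def)
    have "norm z \<le> (norm d + norm (y * y)) / 2"
      using norm_triangle_ineq[of d "y * y"] by (simp add: y(4) f_def)
    also have "norm (y * y) \<le> r * r"
      using norm_mult_ineq[of y y] mult_mono[OF y(3) y(3)] r by simp
    finally have "norm z \<le> r" using r2 by simp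
    moreover have "star z = z" by (simp add: y f_def star_scaleR star_add star_mult d(2))
    moreover have "z \<in> A"
      unfolding y(4) f_def by (intro csubspace_scaleR complex_vector.subspace_add alg d(1) y(1))
    ultimately show "z \<in> Y" by (simp add: Y_def)
  qed
  moreover have "\<forall>y\<in>Y. \<forall>z\<in>Y. dist (f y) (f z) \<le> r * dist y z"
  proof (intro ballI)
    fix y z assume "y \<in> Y" "z \<in> Y"
    then have yz: "norm y \<le> r" "norm z \<le> r" by (simp_all add: Y_def)
    have "f y - f z = (1 / 2 :: real) *\<^sub>R (y * (y - z) + (y - z) * z)"
      by (simp add: f_def algebra_simps)
    then have "dist (f y) (f z) \<le> (norm (y * (y - z)) + norm ((y - z) * z)) / 2"
      using norm_triangle_ineq[of "y * (y - z)" "(y - z) * z"] by (simp add: dist_norm)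
    also have "\<dots> \<le> (r * norm (y - z) + norm (y - z) * r) / 2"
      using yz r by (intro divide_right_mono add_mono order_trans[OF norm_mult_ineq] mult_mono) simp_all
    finally show "dist (f y) (f z) \<le> r * dist y z" by (simp add: dist_norm)
  qed
  ultimately have "\<exists>!y\<in>Y. f y = y" using r by (intro Banach_fix) blast+
  then obtain y where y: "y \<in> A" "star y = y" "f y = y" by (auto simp: Y_def)
  have "2 *\<^sub>R f y = d + y * y" by (simp add: f_def)
  then have yy: "d + y * y = y + y" by (simp add: y(3) scaleR_2)
  have ee: "e \<in> A" "e * e = e" "e * y = y" "y * e = y"
    using e y(1) by (auto simp: is_unit_of_def)
  show ?thesis
  proof (rule that[of "e - y"])
    show "e - y \<in> A" by (intro csubspace_diff alg ee y)
    show "star (e - y) = e - y" by (simp add: star_diff star_unit[OF A e] y)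
    show "(e - y) * (e - y) = e - star a * a"
      using yy by (simp add: left_diff_distrib right_diff_distrib ee d_def[symmetric] algebra_simps)
  qed
qed

lemma cstar_homD:
  assumes "cstar_hom A \<phi>"
  shows "\<And>x y. x \<in> A \<Longrightarrow> y \<in> A \<Longrightarrow> \<phi> (x + y) = \<phi> x + \<phi> y"
    "\<And>x y. x \<in> A \<Longrightarrow> y \<in> A \<Longrightarrow> \<phi> (x * y) = \<phi> x * \<phi> y"
    "\<And>c x. x \<in> A \<Longrightarrow> \<phi> (c *\<^sub>C x) = c *\<^sub>C \<phi> x"
    "\<And>x. x \<in> A \<Longrightarrow> \<phi> (star x) = star (\<phi> x)"
  using assms by (simp_all add: cstar_hom_def)

lemma cstar_hom_diff:
  assumes "cstar_hom A \<phi>" "csubspace A" "x \<in> A" "y \<in> A"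
  shows "\<phi> (x - y) = \<phi> x - \<phi> y"
proof -
  have "\<phi> (x + (- 1) *\<^sub>C y) = \<phi> x + (- 1) *\<^sub>C \<phi> y"
    using assms(3,4) complex_vector.subspace_scale[OF assms(2)] by (simp only: cstar_homD[OF assms(1)])
  then show ?thesis by (simp add: complex_vector.scale_minus_left)
qed

text \<open>For \<open>norm b < 1\<close> write \<open>e - b\<^sup>* b = c\<^sup>2\<close> with self-adjoint \<open>c\<close>. Applying \<open>\<phi>\<close> gives
  \<open>\<phi>(b)\<^sup>* \<phi>(b) = \<phi>(e) - \<phi>(c)\<^sup>2 \<le> \<phi>(e) \<le> 1\<close>, as \<open>\<phi>(e)\<close> is a projection; the general case follows by scaling.\<close>

lemma cstar_hom_norm_le:
  fixes A :: "'a::cstar_algebra set" and \<phi> :: "'a \<Rightarrow> 'h::chilbert_space bop"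
  assumes A: "unital_cstar A" and \<phi>: "cstar_hom A \<phi>" and a: "a \<in> A"
  shows "norm (\<phi> a) \<le> norm a"
proof -
  note alg = unital_cstarD[OF A] and hom = cstar_homD[OF \<phi>]
  obtain e where e: "is_unit_of A e" using A unital_cstar_def by blast
  then have eA: "e \<in> A" "e * e = e" by (auto simp: is_unit_of_def)
  define P where "P = \<phi> e"
  have P: "star P = P" "P * P = P"
    unfolding P_def using hom eA star_unit[OF A e] by metis+
  have P_le: "Re (cinner x (bop_apply P x)) \<le> (norm x)\<^sup>2" for x
  proof -
    have PP: "cinner x (bop_apply P x) = complex_of_real ((norm (bop_apply P x))\<^sup>2)"
    proof -
      have "bop_apply P (bop_apply P x) = bop_apply P x" using P(2) by (metis times_bop.rep_eq)
      then show ?thesis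
        using cinner_selfadjoint[OF P(1), of x "bop_apply P x"] by (simp only: cinner_self)
    qed
    then have "norm (bop_apply P x) * norm (bop_apply P x) \<le> norm x * norm (bop_apply P x)"
      using Re_cinner_le[of x "bop_apply P x"] by (simp add: power2_eq_square)
    then have "norm (bop_apply P x) \<le> norm x" by (cases "norm (bop_apply P x) = 0") simp_all
    then show ?thesis using PP by (simp add: power_mono)
  qed
  have le1: "norm (\<phi> b) \<le> 1" if b: "b \<in> A" "norm b < 1" for b
  proof (rule norm_bop_le)
    fix x
    obtain c where c: "c \<in> A" "star c = c" "c * c = e - star b * b"
      using sqrt_unit_minus_square[OF A e b] by blast
    have sb: "star b * b = e - c * c" using c(3) by simp
    have "star (\<phi> b) * \<phi> b = P - star (\<phi> c) * \<phi> c"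
      using hom b(1) c eA alg sb cstar_hom_diff[OF \<phi> alg(1), of e "c * c"]
      by (metis P_def)
    then have "cinner x (bop_apply (star (\<phi> b) * \<phi> b) x) = cinner x (bop_apply (P - star (\<phi> c) * \<phi> c) x)"
      by simp
    then have "complex_of_real ((norm (bop_apply (\<phi> b) x))\<^sup>2)
        = cinner x (bop_apply P x) - complex_of_real ((norm (bop_apply (\<phi> c) x))\<^sup>2)"
      by (simp only: times_bop.rep_eq minus_bop.rep_eq cinner_diff_right cinner_star_right cinner_self)
    then have "(norm (bop_apply (\<phi> b) x))\<^sup>2 = Re (cinner x (bop_apply P x)) - (norm (bop_apply (\<phi> c) x))\<^sup>2"
      by (metis Re_complex_of_real minus_complex.sel(1))
    also have "\<dots> \<le> (norm x)\<^sup>2" using P_le[of x] zero_le_power2[of "norm (bop_apply (\<phi> c) x)"] by linarith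
    finally have "norm (bop_apply (\<phi> b) x) \<le> norm x" by (rule power2_le_imp_le) simp
    then show "norm (bop_apply (\<phi> b) x) \<le> 1 * norm x" by simp
  qed simp
  show ?thesis
  proof (rule dense_ge)
    fix t assume t: "norm a < t"
    have t0: "t > 0" using t norm_ge_zero[of a] by linarith
    define s where "s = complex_of_real (1 / t)"
    have "norm (s *\<^sub>C a) < 1" using t t0 by (simp add: s_def norm_scaleC norm_divide)
    moreover have "s *\<^sub>C a \<in> A" using a complex_vector.subspace_scale[OF alg(1)] by blast
    ultimately have "norm (s *\<^sub>C \<phi> a) \<le> 1" using le1[of "s *\<^sub>C a"] hom(3)[OF a] by simp
    then show "norm (\<phi> a) \<le> t" using t0 by (simp add: s_def norm_scaleC norm_divide divide_le_eq)
  qed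
qed

section \<open>Operators on square-summable families\<close>

abbreviation single :: "'h::complex_normed_vector \<Rightarrow> 'g \<Rightarrow> ('g, 'h) ell2"
  where "single \<xi> g \<equiv> tens \<xi> (ell2_delta g)"

lemma ell2_dominated:
  fixes x :: "('g, 'h::complex_normed_vector) ell2" and f :: "'g \<Rightarrow> 'k::complex_normed_vector"
  assumes f: "\<And>g. norm (f g) \<le> K * norm (ell2_apply x g)" and K: "0 \<le> K"
  obtains y where "ell2_apply y = f" "norm y \<le> K * norm x"
proof -
  have le: "(norm (f g))\<^sup>2 \<le> K\<^sup>2 * (norm (ell2_apply x g))\<^sup>2" for g
    using power_mono[OF f norm_ge_zero, of g 2] by (simp add: power_mult_distrib)
  have sK: "(\<lambda>g. K\<^sup>2 * (norm (ell2_apply x g))\<^sup>2) summable_on UNIV"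
    by (intro summable_on_cmult_right ell2_summable)
  have "(\<lambda>g. (norm (f g))\<^sup>2) summable_on UNIV"
    by (rule summable_on_comparison_test[OF sK]) (simp_all add: le)
  then obtain y where y: "ell2_apply y = f" using Abs_ell2_inverse[of f] by auto
  have "(norm y)\<^sup>2 \<le> (K * norm x)\<^sup>2"
    unfolding ell2_norm_sq[of y] power_mult_distrib ell2_norm_sq[of x]
    using infsum_mono[OF ell2_summable[of y] sK] le by (simp add: y infsum_cmult_right')
  then have "norm y \<le> K * norm x" by (rule power2_le_imp_le) (simp add: K)
  then show ?thesis using y that by blast
qed

lemma bounded_clinearI:
  assumes "\<And>x y. f (x + y) = f x + f y" "\<And>c x. f (c *\<^sub>C x) = c *\<^sub>C f x" "\<And>x. norm (f x) \<le> K * norm x"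
  shows "bounded_clinear f"
  unfolding bounded_clinear_def
  by (intro conjI allI bounded_linear_intro[of _ K])
    (simp_all add: assms scaleR_scaleC mult.commute[of _ K])

text \<open>The direct sum of a uniformly bounded family of operators.\<close>

definition fibre_bop :: "('g \<Rightarrow> 'h::chilbert_space bop) \<Rightarrow> ('g, 'h) ell2 bop"
  where "fibre_bop T = Abs_bop (\<lambda>x. Abs_ell2 (\<lambda>g. bop_apply (T g) (ell2_apply x g)))"

lemma fibre_bop:
  assumes T: "\<And>g. norm (T g) \<le> K"
  shows "ell2_apply (bop_apply (fibre_bop T) x) g = bop_apply (T g) (ell2_apply x g)"
    and "norm (fibre_bop T) \<le> K"
proof -
  define f where "f x = Abs_ell2 (\<lambda>g. bop_apply (T g) (ell2_apply x g))" for x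
  have K: "0 \<le> K" using T norm_ge_zero order_trans by blast
  have f: "ell2_apply (f x) g = bop_apply (T g) (ell2_apply x g)" "norm (f x) \<le> K * norm x" for x g
  proof -
    have dom: "norm (bop_apply (T g) (ell2_apply x g)) \<le> K * norm (ell2_apply x g)" for g
      using norm_bop_apply[of "T g" "ell2_apply x g"] mult_right_mono[OF T norm_ge_zero] order_trans by blast
    then obtain y where y: "ell2_apply y = (\<lambda>g. bop_apply (T g) (ell2_apply x g))" "norm y \<le> K * norm x"
      using ell2_dominated[of "\<lambda>g. bop_apply (T g) (ell2_apply x g)", OF dom K] by blast
    have "f x = y" unfolding f_def y(1)[symmetric] by (rule ell2_apply_inverse)
    then show "ell2_apply (f x) g = bop_apply (T g) (ell2_apply x g)" "norm (f x) \<le> K * norm x"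
      using y by simp_all
  qed
  have "bounded_clinear f"
    by (rule bounded_clinearI[of _ K]; (rule ell2_eqI)?)
      (simp_all add: f plus_ell2.rep_eq scaleC_ell2.rep_eq bop_add bop_scaleC)
  then have *: "bop_apply (fibre_bop T) = f"
    unfolding fibre_bop_def f_def[abs_def, symmetric] by (simp add: Abs_bop_inverse)
  show "ell2_apply (bop_apply (fibre_bop T) x) g = bop_apply (T g) (ell2_apply x g)" by (simp add: * f)
  show "norm (fibre_bop T) \<le> K" by (rule norm_bop_le) (simp_all add: * f K)
qed

lemma cinner_single: "cinner (single \<xi> g) x = cinner \<xi> (ell2_apply x g)"
  for \<xi> :: "'h::complex_inner"
proof -
  have "cinner (single \<xi> g) x = (\<Sum>\<^sub>\<infinity>k\<in>{g}. cinner \<xi> (ell2_apply x k))"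
    unfolding cinner_ell2_def
    by (rule infsum_cong_neutral) (simp_all add: tens.rep_eq ell2_delta.rep_eq)
  then show ?thesis by simp
qed

lemma ell2_apply_single:
  "ell2_apply (single \<xi> g) k = (if k = g then \<xi> else 0)"
  by (simp add: tens.rep_eq ell2_delta.rep_eq)

lemma norm_single: "norm (single \<xi> g) = norm \<xi>"
proof -
  have "(norm (single \<xi> g))\<^sup>2 = (\<Sum>\<^sub>\<infinity>k\<in>{g}. (norm \<xi>)\<^sup>2)"
    unfolding ell2_norm_sq by (rule infsum_cong_neutral) (simp_all add: ell2_apply_single)
  then show ?thesis by simp
qed

text \<open>The squared error of a partial sum is the tail of the series for the squared norm.\<close>

lemma ell2_expansion:
  fixes x :: "('g, 'h::complex_normed_vector) ell2"
  shows "((\<lambda>g. single (ell2_apply x g) g) has_sum x) UNIV"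
  unfolding has_sum_def tendsto_iff
proof (intro allI impI)
  fix e :: real assume e: "e > 0"
  have err: "(norm (x - (\<Sum>g\<in>F. single (ell2_apply x g) g)))\<^sup>2
      = (norm x)\<^sup>2 - (\<Sum>g\<in>F. (norm (ell2_apply x g))\<^sup>2)" if F: "finite F" for F
  proof -
    define y where "y = (\<Sum>g\<in>F. single (ell2_apply x g) g)"
    have y: "ell2_apply y h = (if h \<in> F then ell2_apply x h else 0)" for h
      using F unfolding y_def ell2_apply_sum by (simp add: ell2_apply_single)
    have "(norm (x - y))\<^sup>2 = (\<Sum>\<^sub>\<infinity>g\<in>UNIV - F. (norm (ell2_apply x g))\<^sup>2)"
      unfolding ell2_norm_sq by (rule infsum_cong_neutral) (auto simp: minus_ell2.rep_eq y)
    also have "\<dots> = (norm x)\<^sup>2 - (\<Sum>g\<in>F. (norm (ell2_apply x g))\<^sup>2)"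
      unfolding ell2_norm_sq using F by (simp add: infsum_Diff ell2_summable)
    finally show ?thesis by (simp add: y_def)
  qed
  have "((\<lambda>g. (norm (ell2_apply x g))\<^sup>2) has_sum (norm x)\<^sup>2) UNIV"
    unfolding ell2_norm_sq by (rule has_sum_infsum[OF ell2_summable])
  then have "\<forall>\<^sub>F F in finite_subsets_at_top UNIV.
      dist (\<Sum>g\<in>F. (norm (ell2_apply x g))\<^sup>2) ((norm x)\<^sup>2) < e\<^sup>2"
    unfolding has_sum_def tendsto_iff using e by simp
  moreover have "\<forall>\<^sub>F F in finite_subsets_at_top (UNIV :: 'g set). finite F"
    by (rule eventually_finite_subsets_at_top_weakI)
  ultimately show "\<forall>\<^sub>F F in finite_subsets_at_top UNIV.
      dist (\<Sum>g\<in>F. single (ell2_apply x g) g) x < e"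
  proof eventually_elim
    case (elim F)
    then have "(norm (x - (\<Sum>g\<in>F. single (ell2_apply x g) g)))\<^sup>2 < e\<^sup>2"
      unfolding err[OF elim(2)] dist_real_def by linarith
    then show ?case using e by (simp add: dist_norm norm_minus_commute power2_less_imp_less)
  qed
qed

lemma bop_ell2_eqI:
  fixes S T :: "('g, 'h::chilbert_space) ell2 bop"
  assumes "\<And>\<xi> g. bop_apply S (single \<xi> g) = bop_apply T (single \<xi> g)"
  shows "S = T"
proof (rule bop_eqI)
  fix x
  have "((\<lambda>g. bop_apply R (single (ell2_apply x g) g)) has_sum bop_apply R x) UNIV"
    for R :: "('g, 'h) ell2 bop"
    using has_sum_bounded_linear[OF bounded_linear_bop ell2_expansion[of x], of R] by (simp add: o_def)
  from this[of S] this[of T] show "bop_apply S x = bop_apply T x"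
    unfolding assms using has_sum_unique by blast
qed

lemma
  fixes h :: "'g::group_add" and x :: "('g, 'h::chilbert_space) ell2"
  shows bop_apply_translation_tens:
      "bop_apply (translation h) (single \<xi> g) = (single \<xi> (h + g) :: ('g, 'h) ell2)"
    and translation_apply: "ell2_apply (bop_apply (translation h) x) g = ell2_apply x (- h + g)"
proof -
  define f :: "('g, 'h) ell2 \<Rightarrow> ('g, 'h) ell2"
    where "f x = Abs_ell2 (\<lambda>g. ell2_apply x (- h + g))" for x
  have bij: "bij_betw (\<lambda>g. - h + g) UNIV UNIV"
    by (rule bij_betw_byWitness[of _ "\<lambda>g. h + g"]) (auto simp: add.assoc[symmetric])
  have f: "ell2_apply (f x) g = ell2_apply x (- h + g)" for x g
  proof -
    have "(\<lambda>g. (norm (ell2_apply x (- h + g)))\<^sup>2) summable_on UNIV"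
      using summable_on_reindex_bij_betw[OF bij, of "\<lambda>g. (norm (ell2_apply x g))\<^sup>2"] ell2_summable[of x] by blast
    then show ?thesis by (simp add: f_def Abs_ell2_inverse)
  qed
  have f_norm: "norm (f x) = norm x" for x
    unfolding norm_ell2.rep_eq f
    using infsum_reindex_bij_betw[OF bij, of "\<lambda>g. (norm (ell2_apply x g))\<^sup>2"] by simp
  have "bounded_clinear f"
    by (rule bounded_clinearI[of _ 1]; (rule ell2_eqI)?)
      (simp_all add: f f_norm plus_ell2.rep_eq scaleC_ell2.rep_eq)
  then obtain T where T: "bop_apply T = f" using Abs_bop_inverse[of f] by auto
  have T_tens: "bop_apply T (single \<xi> g) = single \<xi> (h + g)" for \<xi> g
  proof (rule ell2_eqI)
    fix k
    have "- h + k = g \<longleftrightarrow> k = h + g" by (metis add.assoc add.left_neutral left_minus right_minus)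
    then show "ell2_apply (bop_apply T (single \<xi> g)) k = ell2_apply (single \<xi> (h + g)) k"
      by (simp add: T f ell2_apply_single)
  qed
  have "translation h = T"
    unfolding translation_def
  proof (rule the_equality)
    show "\<forall>\<xi> g. bop_apply T (single \<xi> g) = single \<xi> (h + g)" using T_tens by blast
    show "S = T" if "\<forall>\<xi> g. bop_apply S (single \<xi> g) = single \<xi> (h + g)" for S
      using that T_tens by (intro bop_ell2_eqI) simp
  qed
  then show "bop_apply (translation h) (single \<xi> g) = (single \<xi> (h + g) :: ('g, 'h) ell2)"
    "ell2_apply (bop_apply (translation h) x) g = ell2_apply x (- h + g)"
    using T_tens by (simp_all add: T f)
qed

lemma translation_add: "translation (g + h) = (translation g * translation h :: ('g::group_add, 'h::chilbert_space) ell2 bop)"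
  by (rule bop_eqI, rule ell2_eqI) (simp add: translation_apply times_bop.rep_eq minus_add add.assoc
      diff_conv_add_uminus del: add_uminus_conv_diff)

lemma translation_zero: "translation 0 = (1 :: ('g::group_add, 'h::chilbert_space) ell2 bop)"
  by (rule bop_eqI, rule ell2_eqI) (simp add: translation_apply one_bop.rep_eq)

lemma ell2_cinner_eqI:
  fixes x :: "('g, 'h::complex_inner) ell2"
  shows "(\<And>\<xi> g. cinner (single \<xi> g) x = cinner (single \<xi> g) y) \<Longrightarrow> x = y"
  by (rule ell2_eqI, rule cinner_eqI) (simp add: cinner_single)

lemma star_translation: "star (translation h) = (translation (- h) :: ('g::group_add, 'h::chilbert_space) ell2 bop)"
  by (rule bop_eqI, rule ell2_cinner_eqI)
    (simp add: cinner_star_right bop_apply_translation_tens cinner_single translation_apply)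

section \<open>The algebra of the crossed product\<close>

locale crossed_system =
  fixes A :: "'a::cstar_algebra set"
    and \<pi> :: "'a \<Rightarrow> 'h::chilbert_space bop"
    and \<alpha> :: "'g::group_add \<Rightarrow> 'a \<Rightarrow> 'a"
  assumes A: "unital_cstar A" and \<pi>: "cstar_hom A \<pi>" and \<alpha>: "action_on A \<alpha>"
begin

lemmas alg = unital_cstarD[OF A]
lemmas \<pi>_hom = cstar_homD[OF \<pi>]

lemma A_zero: "0 \<in> A" by (rule complex_vector.subspace_0[OF alg(1)])

lemma \<alpha>_hom: "cstar_hom A (\<alpha> g)"
  using \<alpha> by (simp add: action_on_def cstar_aut_def)

lemmas \<alpha>_homD = cstar_homD[OF \<alpha>_hom]

lemma \<alpha>_in: "a \<in> A \<Longrightarrow> \<alpha> g a \<in> A"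
  using \<alpha> bij_betwE unfolding action_on_def cstar_aut_def by blast

lemma \<alpha>_0: "a \<in> A \<Longrightarrow> \<alpha> 0 a = a"
  and \<alpha>_add: "a \<in> A \<Longrightarrow> \<alpha> (g + h) a = \<alpha> g (\<alpha> h a)"
  using \<alpha> by (simp_all add: action_on_def)

lemma \<alpha>_inverse: "a \<in> A \<Longrightarrow> \<alpha> g (\<alpha> (- g) a) = a"
  by (simp flip: \<alpha>_add add: \<alpha>_0)

lemma \<alpha>_unit: assumes e: "is_unit_of A e" shows "\<alpha> g e = e"
proof (rule is_unit_of_unique[OF _ e])
  have "\<alpha> g e * a = a \<and> a * \<alpha> g e = a" if a: "a \<in> A" for a
  proof -
    define b where "b = \<alpha> (- g) a"
    have b: "b \<in> A" "\<alpha> g b = a" unfolding b_def using a by (simp_all add: \<alpha>_in \<alpha>_inverse)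
    then have "e * b = b" "b * e = b" "e \<in> A" using e by (auto simp: is_unit_of_def)
    then show ?thesis using \<alpha>_homD(2) b by metis
  qed
  then show "is_unit_of A (\<alpha> g e)" using e \<alpha>_in by (simp add: is_unit_of_def)
qed

lemma \<pi>_\<alpha>_hom: "cstar_hom A (\<lambda>a. \<pi> (\<alpha> g a))"
  unfolding cstar_hom_def by (simp add: \<alpha>_homD \<pi>_hom \<alpha>_in)

lemma norm_\<pi>_\<alpha>: "a \<in> A \<Longrightarrow> norm (\<pi> (\<alpha> g a)) \<le> norm a"
  by (rule cstar_hom_norm_le[OF A \<pi>_\<alpha>_hom])

abbreviation cov :: "'a \<Rightarrow> ('g, 'h) ell2 bop" where "cov \<equiv> covariant_rep \<pi> \<alpha>"
abbreviation tr :: "'g \<Rightarrow> ('g, 'h) ell2 bop" where "tr \<equiv> translation"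

text \<open>The operators \<open>\<pi>(\<alpha>\<^sub>g\<^sup>-\<^sup>1(a))\<close> are bounded by \<open>norm a\<close> uniformly in \<open>g\<close>, so the formula on elementary tensors
  extends to a bounded operator.\<close>

lemma cov_eq:
  assumes a: "a \<in> A"
  shows "cov a = fibre_bop (\<lambda>g. \<pi> (\<alpha> (- g) a))"
proof -
  define T where "T = fibre_bop (\<lambda>g. \<pi> (\<alpha> (- g) a))"
  have T_tens: "bop_apply T (single \<xi> g) = tens (bop_apply (\<pi> (\<alpha> (- g) a)) \<xi>) (ell2_delta g)" for \<xi> g
    by (rule ell2_eqI) (simp add: T_def fibre_bop(1)[OF norm_\<pi>_\<alpha>[OF a]] ell2_apply_single)
  show ?thesis
    unfolding covariant_rep_def T_def[symmetric]
  proof (rule the_equality)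
    show "\<forall>\<xi> g. bop_apply T (single \<xi> g) = tens (bop_apply (\<pi> (\<alpha> (- g) a)) \<xi>) (ell2_delta g)"
      using T_tens by blast
    show "S = T" if "\<forall>\<xi> g. bop_apply S (single \<xi> g) = tens (bop_apply (\<pi> (\<alpha> (- g) a)) \<xi>) (ell2_delta g)" for S
      using that T_tens by (intro bop_ell2_eqI) simp
  qed
qed

lemma cov_apply: "a \<in> A \<Longrightarrow> ell2_apply (bop_apply (cov a) x) g = bop_apply (\<pi> (\<alpha> (- g) a)) (ell2_apply x g)"
  by (simp add: cov_eq fibre_bop(1)[OF norm_\<pi>_\<alpha>])

lemma norm_cov_le: "a \<in> A \<Longrightarrow> norm (cov a) \<le> norm a"
  by (simp add: cov_eq fibre_bop(2)[OF norm_\<pi>_\<alpha>])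

lemma cov_hom: "cstar_hom A cov"
  unfolding cstar_hom_def
proof (intro conjI ballI allI)
  fix a b c assume ab: "a \<in> A" "b \<in> A"
  show "cov (a + b) = cov a + cov b"
    using ab complex_vector.subspace_add[OF alg(1)]
    by (intro bop_eqI ell2_eqI) (simp add: cov_apply plus_bop.rep_eq plus_ell2.rep_eq \<alpha>_homD \<pi>_hom \<alpha>_in)
  show "cov (a * b) = cov a * cov b"
    using ab alg(2)
    by (intro bop_eqI ell2_eqI) (simp add: cov_apply times_bop.rep_eq \<alpha>_homD \<pi>_hom \<alpha>_in)
next
  fix a c assume a: "a \<in> A"
  show "cov (c *\<^sub>C a) = c *\<^sub>C cov a"
    using a complex_vector.subspace_scale[OF alg(1)]
    by (intro bop_eqI ell2_eqI) (simp add: cov_apply scaleC_bop.rep_eq scaleC_ell2.rep_eq \<alpha>_homD \<pi>_hom \<alpha>_in)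
next
  fix a assume a: "a \<in> A"
  have tens: "bop_apply (cov a) (single \<xi> g) = tens (bop_apply (\<pi> (\<alpha> (- g) a)) \<xi>) (ell2_delta g)" for \<xi> g
    by (rule ell2_eqI) (simp add: cov_apply a ell2_apply_single)
  show "cov (star a) = star (cov a)"
    by (rule bop_eqI, rule ell2_cinner_eqI)
      (simp add: cinner_star_right tens cinner_single cov_apply a alg \<alpha>_homD \<pi>_hom \<alpha>_in)
qed

lemmas cov_homD = cstar_homD[OF cov_hom]

lemma cov_0: "cov 0 = 0"
  using cov_homD(1)[OF A_zero A_zero] by simp

lemma tr_cov: "a \<in> A \<Longrightarrow> tr h * cov a = cov (\<alpha> h a) * tr h"
  by (rule bop_eqI, rule ell2_eqI)
    (simp add: times_bop.rep_eq translation_apply cov_apply \<alpha>_in minus_add \<alpha>_add[symmetric])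

lemma term_mult:
  assumes "a \<in> A" "b \<in> A"
  shows "(cov a * tr g) * (cov b * tr h) = cov (a * \<alpha> g b) * tr (g + h)"
proof -
  have "(cov a * tr g) * (cov b * tr h) = cov a * (tr g * cov b) * tr h" by (simp only: mult.assoc)
  also have "\<dots> = cov (a * \<alpha> g b) * (tr g * tr h)"
    using assms by (simp only: tr_cov cov_homD \<alpha>_in mult.assoc)
  finally show ?thesis by (simp only: translation_add)
qed

lemma term_star:
  assumes "a \<in> A"
  shows "star (cov a * tr g) = cov (\<alpha> (- g) (star a)) * tr (- g)"
  using assms alg(3) by (simp only: star_mult star_translation cov_homD(4)[symmetric] tr_cov)

lemma crossed_CcI:
  "finite F \<Longrightarrow> (\<And>g. g \<in> F \<Longrightarrow> f g \<in> X) \<Longrightarrow> (\<Sum>g\<in>F. cov (f g) * tr g) \<in> crossed_Cc X \<pi> \<alpha>"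
  unfolding crossed_Cc_def by blast

lemma crossed_CcE:
  assumes "x \<in> crossed_Cc X \<pi> \<alpha>"
  obtains F f where "finite F" "\<And>g. g \<in> F \<Longrightarrow> f g \<in> X" "x = (\<Sum>g\<in>F. cov (f g) * tr g)"
  using assms unfolding crossed_Cc_def by blast

lemma crossed_Cc_generator: "a \<in> X \<Longrightarrow> cov a * tr g \<in> crossed_Cc X \<pi> \<alpha>"
  using crossed_CcI[of "{g}" "\<lambda>_. a"] by simp

lemma crossed_Cc_csubspace:
  assumes X: "csubspace X" "X \<subseteq> A"
  shows "csubspace (crossed_Cc X \<pi> \<alpha>)"
proof (rule complex_vector.subspaceI)
  note X0 = complex_vector.subspace_0[OF X(1)]
  show "0 \<in> crossed_Cc X \<pi> \<alpha>"
    using crossed_CcI[of "{}"] by simp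
  show "c *\<^sub>C x \<in> crossed_Cc X \<pi> \<alpha>" if x: "x \<in> crossed_Cc X \<pi> \<alpha>" for c x
  proof -
    obtain F f where F: "finite F" "\<And>g. g \<in> F \<Longrightarrow> f g \<in> X" "x = (\<Sum>g\<in>F. cov (f g) * tr g)"
      using x by (rule crossed_CcE) (rule that)
    have "c *\<^sub>C x = (\<Sum>g\<in>F. cov (c *\<^sub>C f g) * tr g)"
      unfolding F(3) complex_vector.scale_sum_right
      using F(2) X(2) by (intro sum.cong refl) (simp add: cov_homD subset_iff mult_scaleC_left)
    then show ?thesis
      using F(1,2) complex_vector.subspace_scale[OF X(1)] by (simp add: crossed_CcI)
  qed
  show "x + y \<in> crossed_Cc X \<pi> \<alpha>" if x: "x \<in> crossed_Cc X \<pi> \<alpha>" and y: "y \<in> crossed_Cc X \<pi> \<alpha>" for x y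
  proof -
    obtain F f where F: "finite F" "\<And>g. g \<in> F \<Longrightarrow> f g \<in> X" "x = (\<Sum>g\<in>F. cov (f g) * tr g)"
      using x by (rule crossed_CcE) (rule that)
    obtain G h where G: "finite G" "\<And>g. g \<in> G \<Longrightarrow> h g \<in> X" "y = (\<Sum>g\<in>G. cov (h g) * tr g)"
      using y by (rule crossed_CcE) (rule that)
    define f' where "f' g = (if g \<in> F then f g else 0)" for g
    define h' where "h' g = (if g \<in> G then h g else 0)" for g
    have fh: "f' g \<in> X" "h' g \<in> X" for g using F G X0 by (simp_all add: f'_def h'_def)
    have "x = (\<Sum>g\<in>F \<union> G. cov (f' g) * tr g)"
      unfolding F(3) using F(1) G(1) by (intro sum.mono_neutral_cong_left) (auto simp: f'_def cov_0)
    moreover have "y = (\<Sum>g\<in>F \<union> G. cov (h' g) * tr g)"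
      unfolding G(3) using F(1) G(1) by (intro sum.mono_neutral_cong_left) (auto simp: h'_def cov_0)
    ultimately have "x + y = (\<Sum>g\<in>F \<union> G. cov (f' g + h' g) * tr g)"
      using fh X(2) by (simp add: cov_homD subset_iff distrib_right sum.distrib)
    then show ?thesis
      using F(1) G(1) fh complex_vector.subspace_add[OF X(1)] by (simp add: crossed_CcI)
  qed
qed

lemma crossed_Cc_star_subalgebra:
  assumes X: "star_subalgebra X" "X \<subseteq> A" and inv: "\<And>g. \<alpha> g ` X \<subseteq> X"
  shows "star_subalgebra (crossed_Cc X \<pi> \<alpha>)"
proof -
  have sub: "csubspace X" and mult: "\<And>x y. x \<in> X \<Longrightarrow> y \<in> X \<Longrightarrow> x * y \<in> X"
    and st: "\<And>x. x \<in> X \<Longrightarrow> star x \<in> X" using X(1) by (auto simp: star_subalgebra_def)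
  have XA: "\<And>x. x \<in> X \<Longrightarrow> x \<in> A" and in\<alpha>: "\<And>g x. x \<in> X \<Longrightarrow> \<alpha> g x \<in> X" using X(2) inv by auto
  note csub = crossed_Cc_csubspace[OF sub X(2)]
  show ?thesis
    unfolding star_subalgebra_def
  proof (intro conjI ballI csub)
    fix x y assume x: "x \<in> crossed_Cc X \<pi> \<alpha>" and y: "y \<in> crossed_Cc X \<pi> \<alpha>"
    obtain F f where F: "finite F" "\<And>g. g \<in> F \<Longrightarrow> f g \<in> X" "x = (\<Sum>g\<in>F. cov (f g) * tr g)"
      using x by (rule crossed_CcE) (rule that)
    obtain G h where G: "finite G" "\<And>g. g \<in> G \<Longrightarrow> h g \<in> X" "y = (\<Sum>g\<in>G. cov (h g) * tr g)"
      using y by (rule crossed_CcE) (rule that)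
    show "x * y \<in> crossed_Cc X \<pi> \<alpha>"
      unfolding F(3) G(3) sum_product
    proof (intro complex_vector.subspace_sum[OF csub])
      fix g k assume "g \<in> F" "k \<in> G"
      then have "f g \<in> X" "h k \<in> X" using F G by auto
      then show "cov (f g) * tr g * (cov (h k) * tr k) \<in> crossed_Cc X \<pi> \<alpha>"
        by (simp add: term_mult XA mult in\<alpha> crossed_Cc_generator)
    qed
    have "star x = (\<Sum>g\<in>F. star (cov (f g) * tr g))"
      unfolding F(3) by (rule linear_sum[OF bounded_linear.linear[OF bounded_linear_star]])
    also have "\<dots> \<in> crossed_Cc X \<pi> \<alpha>"
      using F(2) by (intro complex_vector.subspace_sum[OF csub])
        (simp add: term_star XA st in\<alpha> crossed_Cc_generator)
    finally show "star x \<in> crossed_Cc X \<pi> \<alpha>" .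
  qed
qed

end

lemma closure_star_subalgebra:
  fixes X :: "'a::cstar_algebra set"
  assumes X: "star_subalgebra X"
  shows "star_subalgebra (closure X)"
proof -
  have sub: "csubspace X" and mult: "\<And>x y. x \<in> X \<Longrightarrow> y \<in> X \<Longrightarrow> x * y \<in> X"
    and st: "\<And>x. x \<in> X \<Longrightarrow> star x \<in> X" using X by (auto simp: star_subalgebra_def)
  show ?thesis
    unfolding star_subalgebra_def
  proof (intro conjI ballI csubspace_closure sub)
    fix x y assume "x \<in> closure X" "y \<in> closure X"
    then obtain f g where "\<And>n. f n \<in> X" "f \<longlonglongrightarrow> x" "\<And>n. g n \<in> X" "g \<longlonglongrightarrow> y"
      unfolding closure_sequential by blast
    then show "x * y \<in> closure X"
      unfolding closure_sequential by (intro exI[of _ "\<lambda>n. f n * g n"]) (auto intro: mult tendsto_mult)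
  next
    fix x assume "x \<in> closure X"
    then obtain f where "\<And>n. f n \<in> X" "f \<longlonglongrightarrow> x" unfolding closure_sequential by blast
    then show "star x \<in> closure X"
      unfolding closure_sequential
      by (intro exI[of _ "\<lambda>n. star (f n)"]) (auto intro: st bounded_linear.tendsto[OF bounded_linear_star])
  qed
qed

context crossed_system
begin

lemma A_star_subalgebra: "star_subalgebra A" using A by (simp add: unital_cstar_def)

lemma crossed_product_unit:
  assumes e: "is_unit_of A e"
  shows "is_unit_of (reduced_crossed_product A \<pi> \<alpha>) (cov e)"
proof -
  have eA: "e \<in> A" and ea: "e * a = a" "a * e = a" if "a \<in> A" for a
    using e that by (auto simp: is_unit_of_def)
  have eA: "e \<in> A" using e by (simp add: is_unit_of_def)
  have tr0: "cov e = cov e * tr 0" by (simp add: translation_zero)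
  have gen: "cov e * (cov a * tr g) = cov a * tr g" "(cov a * tr g) * cov e = cov a * tr g"
    if a: "a \<in> A" for a g
  proof -
    show "cov e * (cov a * tr g) = cov a * tr g"
      by (subst tr0) (simp only: term_mult[OF eA a] \<alpha>_0[OF a] ea[OF a] add_0)
    show "(cov a * tr g) * cov e = cov a * tr g"
      by (subst tr0) (simp only: term_mult[OF a eA] \<alpha>_unit[OF e] ea[OF a] add_0_right)
  qed
  have Cc: "cov e * x = x \<and> x * cov e = x" if x: "x \<in> crossed_Cc A \<pi> \<alpha>" for x
  proof -
    obtain F f where F: "finite F" "\<And>g. g \<in> F \<Longrightarrow> f g \<in> A" "x = (\<Sum>g\<in>F. cov (f g) * tr g)"
      using x by (rule crossed_CcE) (rule that)
    show ?thesis
      unfolding F(3) sum_distrib_left sum_distrib_right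
      using F(2) gen by (intro conjI sum.cong refl) simp_all
  qed
  have "closed {x. cov e * x = x \<and> x * cov e = x}"
    by (intro closed_Collect_conj closed_Collect_eq continuous_intros)
  then have "closure (crossed_Cc A \<pi> \<alpha>) \<subseteq> {x. cov e * x = x \<and> x * cov e = x}"
    by (intro closure_minimal) (use Cc in auto)
  moreover have "cov e \<in> closure (crossed_Cc A \<pi> \<alpha>)"
    by (subst tr0) (rule subsetD[OF closure_subset crossed_Cc_generator[OF eA]])
  ultimately show ?thesis unfolding is_unit_of_def reduced_crossed_product_def by auto
qed

lemma crossed_product_unital_cstar: "unital_cstar (reduced_crossed_product A \<pi> \<alpha>)"
proof -
  obtain e where e: "is_unit_of A e" using A unital_cstar_def by blast
  have "star_subalgebra (closure (crossed_Cc A \<pi> \<alpha>))"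
    using \<alpha>_in by (intro closure_star_subalgebra crossed_Cc_star_subalgebra A_star_subalgebra) auto
  then show ?thesis
    using crossed_product_unit[OF e] unfolding unital_cstar_def
    by (auto simp: reduced_crossed_product_def)
qed

lemma crossed_product_unit_of: "unit_of (reduced_crossed_product A \<pi> \<alpha>) = cov (unit_of A)"
  by (intro unit_of_eq crossed_product_unit is_unit_of_unit_of A)

text \<open>The covariant representation is contractive, hence continuous.\<close>

lemma term_in_closure:
  assumes X: "X \<subseteq> A" and a: "a \<in> A" "a \<in> closure X"
    and Y: "\<And>x. x \<in> X \<Longrightarrow> cov x * tr g \<in> Y"
  shows "cov a * tr g \<in> closure Y"
proof -
  obtain f where f: "\<And>n. f n \<in> X" "f \<longlonglongrightarrow> a" using a(2) unfolding closure_sequential by blast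
  have fA: "f n \<in> A" for n using f(1) X by blast
  have "(\<lambda>n. cov (f n) - cov a) \<longlonglongrightarrow> 0"
  proof (rule tendsto_0_le[where K = 1])
    show "(\<lambda>n. f n - a) \<longlonglongrightarrow> 0" using f(2) by (simp add: LIM_zero_iff)
    show "\<forall>\<^sub>F n in sequentially. norm (cov (f n) - cov a) \<le> norm (f n - a) * 1"
      using norm_cov_le[OF csubspace_diff[OF alg(1) fA a(1)]] cstar_hom_diff[OF cov_hom alg(1) fA a(1)]
      by (intro always_eventually) simp
  qed
  then have "(\<lambda>n. cov (f n)) \<longlonglongrightarrow> cov a" by (simp add: LIM_zero_iff)
  then have "(\<lambda>n. cov (f n) * tr g) \<longlonglongrightarrow> cov a * tr g" by (intro tendsto_intros)
  then show ?thesis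
    unfolding closure_sequential using f(1) Y by (intro exI[of _ "\<lambda>n. cov (f n) * tr g"]) simp
qed

lemma crossed_Cc_dense:
  assumes X: "csubspace X" "X \<subseteq> A" "A \<subseteq> closure X"
  shows "reduced_crossed_product A \<pi> \<alpha> \<subseteq> closure (crossed_Cc X \<pi> \<alpha>)"
proof -
  have gen: "cov a * tr g \<in> closure (crossed_Cc X \<pi> \<alpha>)" if "a \<in> A" for a g
    using that X by (intro term_in_closure[of X] crossed_Cc_generator) auto
  have "crossed_Cc A \<pi> \<alpha> \<subseteq> closure (crossed_Cc X \<pi> \<alpha>)"
  proof
    fix x assume "x \<in> crossed_Cc A \<pi> \<alpha>"
    then obtain F f where "\<And>g. g \<in> F \<Longrightarrow> f g \<in> A" "x = (\<Sum>g\<in>F. cov (f g) * tr g)"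
      by (rule crossed_CcE) (rule that)
    then show "x \<in> closure (crossed_Cc X \<pi> \<alpha>)"
      using gen by (simp add: complex_vector.subspace_sum csubspace_closure crossed_Cc_csubspace X)
  qed
  then show ?thesis unfolding reduced_crossed_product_def by (intro closure_minimal) simp_all
qed

lemma crossed_Cc_mono: "X \<subseteq> Y \<Longrightarrow> crossed_Cc X \<pi> \<alpha> \<subseteq> crossed_Cc Y \<pi> \<alpha>"
  unfolding crossed_Cc_def by blast

end

section \<open>Separability\<close>

lemma separable_top_of_set_iff:
  "separable_space (top_of_set S) \<longleftrightarrow> (\<exists>C. countable C \<and> C \<subseteq> S \<and> S \<subseteq> closure C)"
proof -
  have "top_of_set S closure_of C = S \<longleftrightarrow> S \<subseteq> closure C" if "C \<subseteq> S" for C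
  proof -
    have "top_of_set S closure_of C = S \<inter> closure C"
      using that by (simp add: closure_of_subtopology Int_absorb1)
    then show ?thesis by blast
  qed
  then have "(countable C \<and> C \<subseteq> topspace (top_of_set S) \<and> top_of_set S closure_of C = topspace (top_of_set S))
      \<longleftrightarrow> (countable C \<and> C \<subseteq> S \<and> S \<subseteq> closure C)" for C
    by auto
  then show ?thesis unfolding separable_space_def by simp
qed

lemma separable_euclidean_iff:
  "separable_space (euclidean :: 'h::topological_space topology) \<longleftrightarrow> (\<exists>C :: 'h set. countable C \<and> closure C = UNIV)"
  using separable_top_of_set_iff[of "UNIV :: 'h set"] by (simp add: top.extremum_unique)

lemma countable_sum_lists: "countable E \<Longrightarrow> countable (sum_list ` lists E)"
  by simp

text \<open>Finite sums with terms in a countable set form a countable set whose closure is closed under addition, which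
  yields countable dense subsets of spaces spanned by countably many separable pieces.\<close>

lemma closure_sum_lists_sum:
  fixes E :: "'b::real_normed_vector set"
  assumes "\<And>i. i \<in> F \<Longrightarrow> f i \<in> closure E"
  shows "sum f F \<in> closure (sum_list ` lists E)"
proof -
  define S where "S = sum_list ` lists E"
  have ES: "E \<subseteq> S"
  proof
    fix x assume "x \<in> E"
    then have "sum_list [x] \<in> S" unfolding S_def by (intro imageI) simp
    then show "x \<in> S" by simp
  qed
  have add: "x + y \<in> S" if "x \<in> S" "y \<in> S" for x y
  proof -
    obtain xs ys where "xs \<in> lists E" "ys \<in> lists E" "x = sum_list xs" "y = sum_list ys"
      using \<open>x \<in> S\<close> \<open>y \<in> S\<close> unfolding S_def by blast
    then have "x + y = sum_list (xs @ ys)" "xs @ ys \<in> lists E" by auto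
    then show ?thesis unfolding S_def by blast
  qed
  have cl_add: "x + y \<in> closure S" if "x \<in> closure S" "y \<in> closure S" for x y
  proof -
    obtain f g where "\<And>n. f n \<in> S" "f \<longlonglongrightarrow> x" "\<And>n. g n \<in> S" "g \<longlonglongrightarrow> y"
      using \<open>x \<in> closure S\<close> \<open>y \<in> closure S\<close> unfolding closure_sequential by blast
    then show ?thesis
      unfolding closure_sequential by (intro exI[of _ "\<lambda>n. f n + g n"]) (auto intro: add tendsto_add)
  qed
  have "sum_list [] \<in> S" unfolding S_def by (intro imageI) simp
  then have "0 \<in> closure S" using closure_subset by auto
  then have "sum f F \<in> closure S"
    using assms closure_mono[OF ES]
    by (induction F rule: infinite_finite_induct) (auto intro: cl_add)
  then show ?thesis by (simp add: S_def)
qed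

lemma separable_ell2:
  assumes "separable_space (euclidean :: 'h::complex_normed_vector topology)" "countable (UNIV :: 'g set)"
  shows "separable_space (euclidean :: ('g, 'h) ell2 topology)"
proof -
  obtain C :: "'h set" where C: "countable C" "closure C = UNIV"
    using assms(1) separable_euclidean_iff by blast
  define E where "E = (\<lambda>(\<xi>, g :: 'g). single \<xi> g) ` (C \<times> UNIV)"
  have gen: "single \<xi> g \<in> closure E" for \<xi> and g :: 'g
  proof -
    have "\<xi> \<in> closure C" using C(2) by simp
    then obtain f where f: "\<And>n. f n \<in> C" "f \<longlonglongrightarrow> \<xi>" unfolding closure_sequential by blast
    have "single (f n) g - single \<xi> g = single (f n - \<xi>) g" for n
      by (rule ell2_eqI) (simp add: minus_ell2.rep_eq ell2_apply_single)
    then have "(\<lambda>n. single (f n) g) \<longlonglongrightarrow> single \<xi> g"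
      using f(2) by (simp add: tendsto_iff dist_norm norm_single)
    moreover have "single (f n) g \<in> E" for n unfolding E_def using f(1) by force
    ultimately show ?thesis
      unfolding closure_sequential by (intro exI[of _ "\<lambda>n. single (f n) g"]) simp
  qed
  have "x \<in> closure (sum_list ` lists E)" for x :: "('g, 'h) ell2"
  proof -
    have "(\<Sum>g\<in>F. single (ell2_apply x g) g) \<in> closure (sum_list ` lists E)" for F
      by (intro closure_sum_lists_sum gen)
    then show ?thesis
      using ell2_expansion[of x] unfolding has_sum_def
      by (intro Lim_in_closed_set[OF closed_closure _ finite_subsets_at_top_neq_bot]) simp_all
  qed
  moreover have "countable (sum_list ` lists E)"
    unfolding E_def using C(1) assms(2) by (intro countable_sum_lists countable_image countable_SIGMA)
  ultimately show ?thesis unfolding separable_euclidean_iff by blast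
qed

lemma separable_prod:
  assumes "separable_space (euclidean :: 'h::topological_space topology)"
  shows "separable_space (euclidean :: ('h \<times> 'h) topology)"
proof -
  obtain C :: "'h set" where "countable C" "closure C = UNIV" using assms separable_euclidean_iff by blast
  then show ?thesis
    unfolding separable_euclidean_iff by (intro exI[of _ "C \<times> C"]) (simp add: closure_Times)
qed

lemma (in crossed_system) crossed_product_separable:
  assumes sep: "separable_space (top_of_set A)" and G: "countable (UNIV :: 'g set)"
  shows "separable_space (top_of_set (reduced_crossed_product A \<pi> \<alpha>))"
proof -
  obtain C where C: "countable C" "C \<subseteq> A" "A \<subseteq> closure C" using sep separable_top_of_set_iff by blast
  define E where "E = (\<lambda>(a, g). cov a * tr g) ` (C \<times> UNIV)"
  define S where "S = sum_list ` lists E"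
  have gen: "cov a * tr g \<in> closure E" if a: "a \<in> A" for a g
    using a C by (intro term_in_closure[of C]) (auto simp: E_def)
  have "crossed_Cc A \<pi> \<alpha> \<subseteq> closure S"
  proof
    fix x assume "x \<in> crossed_Cc A \<pi> \<alpha>"
    then obtain F f where "\<And>g. g \<in> F \<Longrightarrow> f g \<in> A" "x = (\<Sum>g\<in>F. cov (f g) * tr g)"
      by (rule crossed_CcE) (rule that)
    then show "x \<in> closure S" unfolding S_def using gen by (simp add: closure_sum_lists_sum)
  qed
  then have "reduced_crossed_product A \<pi> \<alpha> \<subseteq> closure S"
    unfolding reduced_crossed_product_def by (intro closure_minimal) simp_all
  moreover have "S \<subseteq> crossed_Cc A \<pi> \<alpha>"
  proof
    fix x assume "x \<in> S"
    then obtain xs where xs: "xs \<in> lists E" "x = sum_list xs" by (auto simp: S_def)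
    have sub: "csubspace (crossed_Cc A \<pi> \<alpha>)" by (rule crossed_Cc_csubspace[OF alg(1)]) simp
    have EC: "y \<in> crossed_Cc A \<pi> \<alpha>" if "y \<in> E" for y
      using that C(2) by (auto simp: E_def intro: crossed_Cc_generator)
    show "x \<in> crossed_Cc A \<pi> \<alpha>"
      unfolding xs(2) using xs(1)
      by (induction xs) (auto intro: EC complex_vector.subspace_0[OF sub] complex_vector.subspace_add[OF sub])
  qed
  moreover have "countable S"
    unfolding S_def E_def using C(1) G by (intro countable_sum_lists countable_image countable_SIGMA)
  ultimately show ?thesis
    unfolding separable_top_of_set_iff reduced_crossed_product_def using closure_subset by blast
qed

section \<open>Fibrewise operators\<close>

text \<open>The direct sum of unbounded operators on its maximal domain.\<close>

definition fibre_op :: "('g \<Rightarrow> ('h::complex_normed_vector \<times> 'k::complex_normed_vector) set)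
    \<Rightarrow> (('g, 'h) ell2 \<times> ('g, 'k) ell2) set"
  where "fibre_op S = {(x, y). \<forall>g. (ell2_apply x g, ell2_apply y g) \<in> S g}"

lemma fibre_op_iff: "(x, y) \<in> fibre_op S \<longleftrightarrow> (\<forall>g. (ell2_apply x g, ell2_apply y g) \<in> S g)"
  by (simp add: fibre_op_def)

lemma bounded_linear_ell2_apply: "bounded_linear (\<lambda>x. ell2_apply x g)"
  by (rule bounded_linear_intro[of _ 1])
    (simp_all add: plus_ell2.rep_eq scaleR_ell2.rep_eq ell2_norm_ge)

lemma tens_add_left: "tens (\<xi> + \<eta>) u = tens \<xi> u + tens \<eta> u"
  by (rule ell2_eqI) (simp add: tens.rep_eq plus_ell2.rep_eq scaleC_add_right)

lemma tens_scaleC_left: "tens (c *\<^sub>C \<xi>) u = c *\<^sub>C tens \<xi> u"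
  by (rule ell2_eqI) (simp add: tens.rep_eq scaleC_ell2.rep_eq scaleC_scaleC mult.commute)

lemma tens_scaleR_left: "tens (r *\<^sub>R \<xi>) u = r *\<^sub>R tens \<xi> u"
  by (simp only: scaleR_scaleC tens_scaleC_left)

lemma bounded_linear_single: "bounded_linear (\<lambda>\<xi>. single \<xi> g)"
  by (rule bounded_linear_intro[of _ 1]) (simp_all add: tens_add_left tens_scaleR_left norm_single)

lemma fibre_op_csubspace:
  assumes "\<And>g. csubspace (S g)"
  shows "csubspace (fibre_op S)"
proof (rule complex_vector.subspaceI)
  show "0 \<in> fibre_op S"
    using complex_vector.subspace_0[OF assms] by (simp add: fibre_op_iff zero_prod_def zero_ell2.rep_eq)
  show "x + y \<in> fibre_op S" if "x \<in> fibre_op S" "y \<in> fibre_op S" for x y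
    using that csubspace_pair_add[OF assms]
    by (cases x; cases y) (simp add: fibre_op_iff plus_ell2.rep_eq)
  show "c *\<^sub>C x \<in> fibre_op S" if "x \<in> fibre_op S" for c x
    using that csubspace_pair_scale[OF assms]
    by (cases x) (simp add: fibre_op_iff scaleC_prod_def scaleC_ell2.rep_eq)
qed

lemma fibre_op_closed:
  fixes S :: "'g \<Rightarrow> ('h::complex_normed_vector \<times> 'k::complex_normed_vector) set"
  assumes "\<And>g. closed (S g)"
  shows "closed (fibre_op S)"
proof -
  have "fibre_op S = (\<Inter>g. (\<lambda>p. (ell2_apply (fst p) g, ell2_apply (snd p) g)) -` S g)"
    by (auto simp: fibre_op_def)
  moreover have "continuous_on UNIV (\<lambda>p :: ('g, 'h) ell2 \<times> ('g, 'k) ell2. (ell2_apply (fst p) g, ell2_apply (snd p) g))" for g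
    by (intro linear_continuous_on bounded_linear_Pair
        bounded_linear_compose[OF bounded_linear_ell2_apply] bounded_linear_fst bounded_linear_snd)
  ultimately show ?thesis using assms by (auto intro!: closed_INT closed_vimage)
qed

lemma fibre_op_single:
  assumes "\<And>k. csubspace (S k)" "(\<xi>, \<eta>) \<in> S g"
  shows "(single \<xi> g, single \<eta> g) \<in> fibre_op S"
  using assms complex_vector.subspace_0[OF assms(1)]
  by (simp add: fibre_op_iff ell2_apply_single zero_prod_def)

lemma fibre_op_single_valued: "(\<And>g. single_valued (S g)) \<Longrightarrow> single_valued (fibre_op S)"
  by (rule single_valuedI) (metis ell2_eqI fibre_op_iff single_valuedD)

lemma ell2_in_closure:
  assumes M: "csubspace M" and gen: "\<And>g. single (ell2_apply x g) g \<in> closure M"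
  shows "x \<in> closure M"
proof -
  have "(\<Sum>g\<in>F. single (ell2_apply x g) g) \<in> closure M" for F
    by (intro complex_vector.subspace_sum csubspace_closure M gen)
  then show ?thesis
    using ell2_expansion[of x] unfolding has_sum_def
    by (intro Lim_in_closed_set[OF closed_closure _ finite_subsets_at_top_neq_bot]) simp_all
qed

text \<open>The finite truncations of an element of the graph converge to it in the graph norm.\<close>

lemma fibre_op_subset_closure:
  fixes M :: "(('g, 'h::complex_normed_vector) ell2 \<times> ('g, 'k::complex_normed_vector) ell2) set"
  assumes trunc: "\<And>F x y. finite F \<Longrightarrow> (x, y) \<in> fibre_op S \<Longrightarrow>
    (\<Sum>g\<in>F. single (ell2_apply x g) g, \<Sum>g\<in>F. single (ell2_apply y g) g) \<in> M"
  shows "fibre_op S \<subseteq> closure M"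
proof
  fix p assume "p \<in> fibre_op S"
  then obtain x y where p: "p = (x, y)" "(x, y) \<in> fibre_op S" by (cases p) auto
  have "((\<lambda>F. (\<Sum>g\<in>F. single (ell2_apply x g) g, \<Sum>g\<in>F. single (ell2_apply y g) g)) \<longlongrightarrow> (x, y))
      (finite_subsets_at_top UNIV)"
    using ell2_expansion[of x] ell2_expansion[of y] unfolding has_sum_def by (rule tendsto_Pair)
  moreover have "\<forall>\<^sub>F F in finite_subsets_at_top UNIV.
      (\<Sum>g\<in>F. single (ell2_apply x g) g, \<Sum>g\<in>F. single (ell2_apply y g) g) \<in> closure M"
    using trunc[OF _ p(2)] closure_subset by (intro eventually_finite_subsets_at_top_weakI) blast
  ultimately show "p \<in> closure M"
    unfolding p(1) by (intro Lim_in_closed_set[OF closed_closure _ finite_subsets_at_top_neq_bot])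
qed

lemma fibre_op_subset_closure_span:
  assumes "\<And>g \<xi> \<eta>. (\<xi>, \<eta>) \<in> S g \<Longrightarrow> (single \<xi> g, single \<eta> g) \<in> X"
  shows "fibre_op S \<subseteq> closure (cspan X)"
proof (rule fibre_op_subset_closure)
  fix F x y assume xy: "(x, y) \<in> fibre_op S"
  show "(\<Sum>g\<in>F. single (ell2_apply x g) g, \<Sum>g\<in>F. single (ell2_apply y g) g) \<in> cspan X"
    unfolding sum_prod[symmetric] using xy
    by (intro complex_vector.span_sum complex_vector.span_base assms) (simp add: fibre_op_iff)
qed

lemma csubspace_Domain: "csubspace G \<Longrightarrow> csubspace (Domain G)"
proof (rule complex_vector.subspaceI)
  assume G: "csubspace G"
  show "0 \<in> Domain G" using complex_vector.subspace_0[OF G] by (auto simp: zero_prod_def)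
  show "x + y \<in> Domain G" if "x \<in> Domain G" "y \<in> Domain G" for x y
    using that csubspace_pair_add[OF G] by blast
  show "c *\<^sub>C x \<in> Domain G" if "x \<in> Domain G" for c x
    using that csubspace_pair_scale[OF G] by blast
qed

lemma fibre_op_densely_defined:
  fixes S :: "'g \<Rightarrow> ('h::complex_normed_vector \<times> 'k::complex_normed_vector) set"
  assumes S: "\<And>g. densely_defined (S g)"
  shows "densely_defined (fibre_op S)"
proof -
  note d = densely_definedD[OF S]
  have sub: "csubspace (fibre_op S)" by (rule fibre_op_csubspace[OF d(1)])
  have "x \<in> closure (Domain (fibre_op S))" for x :: "('g, 'h) ell2"
  proof (rule ell2_in_closure[OF csubspace_Domain[OF sub]])
    fix g
    have "single (ell2_apply x g) g \<in> (\<lambda>\<xi>. single \<xi> g) ` closure (Domain (S g))"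
      using d(3) by simp
    also have "\<dots> \<subseteq> closure ((\<lambda>\<xi>. single \<xi> g) ` Domain (S g))"
      by (rule closure_bounded_linear_image_subset[OF bounded_linear_single])
    also have "\<dots> \<subseteq> closure (Domain (fibre_op S))"
      using fibre_op_single[of S, OF d(1)] by (intro closure_mono) blast
    finally show "single (ell2_apply x g) g \<in> closure (Domain (fibre_op S))" .
  qed
  then have "closure (Domain (fibre_op S)) = UNIV" by blast
  then show ?thesis
    unfolding densely_defined_def using sub fibre_op_single_valued[of S, OF d(2)] by blast
qed

text \<open>Testing the adjoint against vectors supported at one point isolates a single fibre.\<close>

lemma op_adj_fibre_op:
  fixes S :: "'g \<Rightarrow> ('h::complex_inner \<times> 'k::complex_inner) set"
  assumes S: "\<And>g. csubspace (S g)"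
  shows "op_adj (fibre_op S) = fibre_op (\<lambda>g. op_adj (S g))"
proof (intro equalityI subrelI)
  fix y z assume yz: "(y, z) \<in> op_adj (fibre_op S)"
  have "cinner (ell2_apply y g) \<eta> = cinner (ell2_apply z g) \<xi>" if "(\<xi>, \<eta>) \<in> S g" for g \<xi> \<eta>
  proof -
    have "cinner y (single \<eta> g) = cinner z (single \<xi> g)"
      using yz fibre_op_single[of S, OF S that] by (auto simp: op_adj_def)
    then show ?thesis by (metis cinner_single cinner_commute)
  qed
  then show "(y, z) \<in> fibre_op (\<lambda>g. op_adj (S g))" by (auto simp: fibre_op_iff op_adj_def)
next
  fix y z assume "(y, z) \<in> fibre_op (\<lambda>g. op_adj (S g))"
  then have *: "\<And>g \<xi> \<eta>. (\<xi>, \<eta>) \<in> S g \<Longrightarrow> cinner (ell2_apply y g) \<eta> = cinner (ell2_apply z g) \<xi>"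
    by (auto simp: fibre_op_iff op_adj_def)
  have "cinner y w = cinner z x" if "(x, w) \<in> fibre_op S" for x w
    using that unfolding fibre_op_iff cinner_ell2_def by (intro infsum_cong *) blast
  then show "(y, z) \<in> op_adj (fibre_op S)" by (auto simp: op_adj_def)
qed

definition mult_graph :: "complex \<Rightarrow> ('h::complex_normed_vector \<times> 'h) set"
  where "mult_graph c = {(\<xi>, c *\<^sub>C \<xi>) | \<xi>. True}"

definition shift_op :: "('h::complex_normed_vector \<times> 'h) set \<Rightarrow> complex \<Rightarrow> ('h \<times> 'h) set"
  where "shift_op D c = {(\<xi>, \<eta> + c *\<^sub>C \<xi>) | \<xi> \<eta>. (\<xi>, \<eta>) \<in> D}"

lemma mult_graph_iff: "(\<xi>, \<eta>) \<in> mult_graph c \<longleftrightarrow> \<eta> = c *\<^sub>C \<xi>"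
  by (auto simp: mult_graph_def)

lemma shift_op_iff: "(\<xi>, \<eta>) \<in> shift_op D c \<longleftrightarrow> (\<xi>, \<eta> - c *\<^sub>C \<xi>) \<in> D"
  by (force simp: shift_op_def)

lemma mult_graph_csubspace: "csubspace (mult_graph c)"
  by (rule complex_vector.subspaceI)
    (auto simp: mult_graph_def zero_prod_def scaleC_prod_def scaleC_add_right scaleC_scaleC mult.commute)

lemma mult_graph_closed: "closed (mult_graph c :: ('h::complex_normed_vector \<times> 'h) set)"
proof -
  have "mult_graph c = {p :: 'h \<times> 'h. snd p = c *\<^sub>C fst p}" by (auto simp: mult_graph_def)
  then show ?thesis by (simp add: closed_Collect_eq continuous_on_snd continuous_on_fst
        continuous_on_id continuous_on_scaleC)
qed

lemma mult_graph_densely_defined: "densely_defined (mult_graph c)"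
  unfolding densely_defined_def
  by (auto simp: mult_graph_csubspace single_valued_def mult_graph_iff)
    (metis DomainI UNIV_I closure_subset mult_graph_iff subsetD)

lemma op_adj_mult_graph: "op_adj (mult_graph c :: ('h::complex_inner \<times> 'h) set) = mult_graph (cnj c)"
proof -
  have "(\<forall>\<xi>. cinner y (c *\<^sub>C \<xi>) = cinner z \<xi>) \<longleftrightarrow> z = cnj c *\<^sub>C y" for y z :: 'h
  proof
    assume "\<forall>\<xi>. cinner y (c *\<^sub>C \<xi>) = cinner z \<xi>"
    then have "cinner \<xi> z = cinner \<xi> (cnj c *\<^sub>C y)" for \<xi>
      by (metis cinner_commute cinner_scaleC_left cinner_scaleC_right complex_cnj_cnj)
    then show "z = cnj c *\<^sub>C y" by (rule cinner_eqI)
  qed (simp add: cinner_scaleC_left cinner_scaleC_right)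
  then show ?thesis by (auto simp: op_adj_def mult_graph_def)
qed

lemma shift_op_csubspace: "csubspace D \<Longrightarrow> csubspace (shift_op D c)"
proof (rule complex_vector.subspaceI)
  assume D: "csubspace D"
  show "0 \<in> shift_op D c" using complex_vector.subspace_0[OF D] by (simp add: shift_op_iff zero_prod_def)
  show "x + y \<in> shift_op D c" if "x \<in> shift_op D c" "y \<in> shift_op D c" for x y
    using that csubspace_pair_add[OF D, of "fst x" "snd x - c *\<^sub>C fst x" "fst y" "snd y - c *\<^sub>C fst y"]
    by (cases x; cases y) (simp add: shift_op_iff scaleC_add_right algebra_simps)
  show "k *\<^sub>C x \<in> shift_op D c" if "x \<in> shift_op D c" for k x
    using that csubspace_pair_scale[OF D, of "fst x" "snd x - c *\<^sub>C fst x" k]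
    by (cases x) (simp add: shift_op_iff scaleC_prod_def complex_vector.scale_right_diff_distrib
        scaleC_scaleC mult.commute)
qed

lemma shift_op_densely_defined:
  assumes "densely_defined D"
  shows "densely_defined (shift_op D c)"
proof -
  note d = densely_definedD[OF assms]
  have "single_valued (shift_op D c)"
    using d(2) by (auto simp: single_valued_def shift_op_def)
  moreover have "Domain (shift_op D c) = Domain D" by (auto simp: shift_op_def)
  ultimately show ?thesis using d shift_op_csubspace[OF d(1)] by (simp add: densely_defined_def)
qed

lemma op_adj_shift_op:
  fixes D :: "('h::complex_inner \<times> 'h) set"
  shows "op_adj (shift_op D c) = shift_op (op_adj D) (cnj c)"
proof -
  have eq: "cinner y (\<eta> + c *\<^sub>C \<xi>) = cinner z \<xi> \<longleftrightarrow> cinner y \<eta> = cinner (z - cnj c *\<^sub>C y) \<xi>" for y z \<xi> \<eta> :: 'h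
    by (simp add: cinner_add_right cinner_scaleC_right cinner_diff_left cinner_scaleC_left algebra_simps)
  have "(y, z) \<in> op_adj (shift_op D c) \<longleftrightarrow> (y, z) \<in> shift_op (op_adj D) (cnj c)" for y z
  proof -
    have "(y, z) \<in> op_adj (shift_op D c) \<longleftrightarrow> (\<forall>(\<xi>, \<eta>)\<in>D. cinner y (\<eta> + c *\<^sub>C \<xi>) = cinner z \<xi>)"
      unfolding op_adj_def shift_op_def by fastforce
    then show ?thesis unfolding shift_op_iff by (simp add: eq op_adj_def)
  qed
  then show ?thesis by (metis subrelI subset_antisym)
qed

section \<open>The Dirac operator of the crossed product\<close>

text \<open>The finitely supported vectors form a core: truncations of the maximal domain have finite support.\<close>

lemma mult_op_eq_fibre_op:
  fixes l :: "'g \<Rightarrow> int"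
  shows "mult_op l = fibre_op (\<lambda>g. mult_graph (of_int (l g)))"
proof
  define M :: "(('g, complex) ell2 \<times> ('g, complex) ell2) set" where "M = {(u, v). finite {g. ell2_apply u g \<noteq> 0} \<and>
    (\<forall>g. ell2_apply v g = of_int (l g) * ell2_apply u g)}"
  have M_iff: "(u, v) \<in> M \<longleftrightarrow> finite {g. ell2_apply u g \<noteq> 0} \<and>
    (\<forall>g. ell2_apply v g = of_int (l g) * ell2_apply u g)" for u v
    by (simp add: M_def)
  have mult_op: "mult_op l = closure M" by (simp add: mult_op_def M_def)
  show "mult_op l \<subseteq> fibre_op (\<lambda>g. mult_graph (of_int (l g)))"
    unfolding mult_op
    by (intro closure_minimal fibre_op_closed mult_graph_closed)
      (auto simp: M_iff fibre_op_iff mult_graph_iff scaleC_complex_def)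
  show "fibre_op (\<lambda>g. mult_graph (of_int (l g))) \<subseteq> mult_op l"
    unfolding mult_op
  proof (rule fibre_op_subset_closure)
    fix F :: "'g set" and x y assume F: "finite F" and "(x, y) \<in> fibre_op (\<lambda>g. mult_graph (of_int (l g)) :: (complex \<times> complex) set)"
    then have y: "ell2_apply y g = of_int (l g) * ell2_apply x g" for g
      by (simp add: fibre_op_iff mult_graph_iff scaleC_complex_def)
    have trunc: "ell2_apply (\<Sum>g\<in>F. single (ell2_apply z g) g) k = (if k \<in> F then ell2_apply z k else 0)"
      for z :: "('g, complex) ell2" and k
      using F by (simp add: ell2_apply_sum ell2_apply_single)
    show "(\<Sum>g\<in>F. single (ell2_apply x g) g, \<Sum>g\<in>F. single (ell2_apply y g) g) \<in> M"
      using F unfolding M_iff trunc by (auto simp: y intro: finite_subset[of _ F])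
  qed
qed

text \<open>The closure over elementary tensors already contains every vector of the maximal fibrewise domain.\<close>

lemma op_tensor_Id:
  fixes D :: "('h::complex_normed_vector \<times> 'h) set"
  assumes D: "csubspace D" "closed D"
  shows "op_tensor D (Id :: (('g, complex) ell2 \<times> ('g, complex) ell2) set) = fibre_op (\<lambda>_. D)"
proof
  show "op_tensor D Id \<subseteq> (fibre_op (\<lambda>_. D) :: (('g, 'h) ell2 \<times> ('g, 'h) ell2) set)"
    unfolding op_tensor_def
  proof (intro closure_minimal complex_vector.span_minimal fibre_op_csubspace fibre_op_closed D)
    show "{(tens x u, tens y v) |x y u v. (x, y) \<in> D \<and> (u, v) \<in> Id} \<subseteq> fibre_op (\<lambda>_. D)"
      using csubspace_pair_scale[OF D(1)] by (auto simp: fibre_op_iff tens.rep_eq)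
  qed
  show "fibre_op (\<lambda>_. D) \<subseteq> op_tensor D (Id :: (('g, complex) ell2 \<times> ('g, complex) ell2) set)"
    unfolding op_tensor_def
    by (intro fibre_op_subset_closure_span) blast
qed

lemma op_tensor_mult_op:
  "op_tensor {(\<xi>, \<i> *\<^sub>C \<xi>) | \<xi>. True} (mult_op l)
    = (fibre_op (\<lambda>g. mult_graph (\<i> * of_int (l g))) :: (('g, 'h::complex_normed_vector) ell2 \<times> ('g, 'h) ell2) set)"
proof
  show "op_tensor {(\<xi>, \<i> *\<^sub>C \<xi>) | \<xi>. True} (mult_op l)
      \<subseteq> (fibre_op (\<lambda>g. mult_graph (\<i> * of_int (l g))) :: (('g, 'h) ell2 \<times> ('g, 'h) ell2) set)"
    unfolding op_tensor_def mult_op_eq_fibre_op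
  proof (intro closure_minimal complex_vector.span_minimal fibre_op_csubspace fibre_op_closed
      mult_graph_closed mult_graph_csubspace subsetI)
    fix p :: "('g, 'h) ell2 \<times> ('g, 'h) ell2"
    assume "p \<in> {(tens x u, tens y v) |x y u v. (x, y) \<in> {(\<xi>, \<i> *\<^sub>C \<xi>) | \<xi>. True} \<and>
        (u, v) \<in> fibre_op (\<lambda>g. mult_graph (of_int (l g)))}"
    then show "p \<in> fibre_op (\<lambda>g. mult_graph (\<i> * of_int (l g)))"
      by (auto simp: fibre_op_iff mult_graph_iff tens.rep_eq scaleC_scaleC scaleC_complex_def ac_simps)
  qed
  show "(fibre_op (\<lambda>g. mult_graph (\<i> * of_int (l g))) :: (('g, 'h) ell2 \<times> ('g, 'h) ell2) set)
      \<subseteq> op_tensor {(\<xi>, \<i> *\<^sub>C \<xi>) | \<xi>. True} (mult_op l)"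
    unfolding op_tensor_def mult_op_eq_fibre_op
  proof (intro fibre_op_subset_closure_span)
    fix g and \<xi> \<eta> :: 'h assume "(\<xi>, \<eta>) \<in> mult_graph (\<i> * of_int (l g))"
    then have eta: "\<eta> = of_int (l g) *\<^sub>C \<i> *\<^sub>C \<xi>" by (simp add: mult_graph_iff scaleC_scaleC mult.commute)
    have "single \<eta> g = tens (\<i> *\<^sub>C \<xi>) (of_int (l g) *\<^sub>C ell2_delta g)"
      by (rule ell2_eqI) (simp add: eta tens.rep_eq scaleC_ell2.rep_eq scaleC_scaleC scaleC_complex_def ac_simps)
    moreover have "(ell2_delta g, of_int (l g) *\<^sub>C ell2_delta g) \<in> fibre_op (\<lambda>g. mult_graph (of_int (l g)))"
      by (simp add: fibre_op_iff mult_graph_iff scaleC_ell2.rep_eq ell2_delta.rep_eq scaleC_complex_def)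
    ultimately show "(single \<xi> g, single \<eta> g)
      \<in> {(tens x u, tens y v) |x y u v. (x, y) \<in> {(\<xi>, \<i> *\<^sub>C \<xi>) | \<xi>. True} \<and>
        (u, v) \<in> fibre_op (\<lambda>g. mult_graph (of_int (l g)))}"
      by blast
  qed
qed

text \<open>For self-adjoint \<open>D\<close> the cross terms in \<open>norm (D \<xi> + i t \<xi>)\<close> cancel, so a square-summable
  family \<open>D \<xi>\<^sub>g + i t\<^sub>g \<xi>\<^sub>g\<close> has both summands square-summable.\<close>

lemma norm_selfadjoint_imaginary_shift:
  assumes D: "selfadjoint_op D" and "(\<xi>, \<eta>) \<in> D"
  shows "norm \<eta> \<le> norm (\<eta> + (\<i> * of_real t) *\<^sub>C \<xi>)"
proof -
  have "cinner \<xi> \<eta> = cinner \<eta> \<xi>" by (rule selfadjoint_symmetric[OF D assms(2) assms(2)])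
  then have "Im (cinner \<eta> \<xi>) = 0"
    using cinner_commute[of \<xi> \<eta>] by (metis Reals_cnj_iff complex_is_Real_iff)
  then have "(norm (\<eta> + (\<i> * of_real t) *\<^sub>C \<xi>))\<^sup>2 = (norm \<eta>)\<^sup>2 + (norm ((\<i> * of_real t) *\<^sub>C \<xi>))\<^sup>2"
    unfolding norm_plus_sq by (simp add: cinner_scaleC_right)
  then have "(norm \<eta>)\<^sup>2 \<le> (norm (\<eta> + (\<i> * of_real t) *\<^sub>C \<xi>))\<^sup>2" by simp
  then show ?thesis by (rule power2_le_imp_le) simp
qed

lemma op_plus_fibre_op:
  fixes D :: "('h::chilbert_space \<times> 'h) set"
  assumes D: "selfadjoint_op D"
  shows "op_plus (fibre_op (\<lambda>_. D)) (fibre_op (\<lambda>g. mult_graph (\<i> * of_real (t g))))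
    = fibre_op (\<lambda>g. shift_op D (\<i> * of_real (t g)))"
proof (intro equalityI subrelI)
  fix x y assume "(x, y) \<in> op_plus (fibre_op (\<lambda>_. D)) (fibre_op (\<lambda>g. mult_graph (\<i> * of_real (t g))))"
  then show "(x, y) \<in> fibre_op (\<lambda>g. shift_op D (\<i> * of_real (t g)))"
    by (auto simp: op_plus_def fibre_op_iff mult_graph_iff shift_op_iff plus_ell2.rep_eq)
next
  fix x y assume xy: "(x, y) \<in> fibre_op (\<lambda>g. shift_op D (\<i> * of_real (t g)))"
  define f where "f g = ell2_apply y g - (\<i> * of_real (t g)) *\<^sub>C ell2_apply x g" for g
  have f: "(ell2_apply x g, f g) \<in> D" for g
    using xy by (simp add: fibre_op_iff shift_op_iff f_def)
  have "norm (f g) \<le> 1 * norm (ell2_apply y g)" for g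
    using norm_selfadjoint_imaginary_shift[OF D f, of g "t g"] by (simp add: f_def)
  then obtain w where w: "ell2_apply w = f" using ell2_dominated[of f 1 y] by auto
  have "(x, w) \<in> fibre_op (\<lambda>_. D)" using f by (simp add: fibre_op_iff w)
  moreover have "(x, y - w) \<in> fibre_op (\<lambda>g. mult_graph (\<i> * of_real (t g)))"
    by (simp add: fibre_op_iff mult_graph_iff minus_ell2.rep_eq w f_def)
  ultimately have "(x, w + (y - w)) \<in> op_plus (fibre_op (\<lambda>_. D)) (fibre_op (\<lambda>g. mult_graph (\<i> * of_real (t g))))"
    unfolding op_plus_def by blast
  then show "(x, y) \<in> op_plus (fibre_op (\<lambda>_. D)) (fibre_op (\<lambda>g. mult_graph (\<i> * of_real (t g))))" by simp
qed

lemma op_minus_fibre_op: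
  fixes S :: "(('g, 'h::complex_normed_vector) ell2 \<times> ('g, 'h) ell2) set"
  shows "op_minus S (fibre_op (\<lambda>g. mult_graph (c g))) = op_plus S (fibre_op (\<lambda>g. mult_graph (- c g)))"
proof -
  have neg: "(x, z) \<in> fibre_op (\<lambda>g. mult_graph (- c g)) \<longleftrightarrow> (x, - z) \<in> fibre_op (\<lambda>g. mult_graph (c g))" for x z
  proof -
    have "ell2_apply z g = - (c g *\<^sub>C ell2_apply x g) \<longleftrightarrow> - ell2_apply z g = c g *\<^sub>C ell2_apply x g" for g
      by (metis minus_minus)
    then show ?thesis
      by (simp only: fibre_op_iff mult_graph_iff uminus_ell2.rep_eq complex_vector.scale_minus_left)
  qed
  show ?thesis
    unfolding op_minus_def op_plus_def neg by (auto, metis diff_conv_add_uminus minus_minus, metis diff_minus_eq_add minus_minus)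
qed

abbreviation half_dirac :: "('h::chilbert_space \<times> 'h) set \<Rightarrow> real \<Rightarrow> ('g \<Rightarrow> int) \<Rightarrow> (('g, 'h) ell2 \<times> ('g, 'h) ell2) set"
  where "half_dirac D s l \<equiv> fibre_op (\<lambda>g. shift_op D (\<i> * of_real (s * of_int (l g))))"

lemma crossed_dirac_eq:
  fixes D :: "('h::chilbert_space \<times> 'h) set"
  assumes D: "selfadjoint_op D"
  shows "crossed_dirac D l = op_offdiag (half_dirac D (- 1) l) (half_dirac D 1 l)"
proof -
  have sub: "csubspace D" using D by (simp add: selfadjoint_op_def densely_defined_def)
  have p: "(\<lambda>g. mult_graph (\<i> * of_int (l g)) :: ('h \<times> 'h) set) = (\<lambda>g. mult_graph (\<i> * of_real (1 * of_int (l g))))"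
    and m: "(\<lambda>g. mult_graph (- (\<i> * of_int (l g))) :: ('h \<times> 'h) set) = (\<lambda>g. mult_graph (\<i> * of_real (- 1 * of_int (l g))))"
    by simp_all
  show ?thesis
    unfolding crossed_dirac_def Let_def op_tensor_mult_op op_tensor_Id[OF sub selfadjoint_closed[OF D]]
      op_minus_fibre_op
    unfolding p m op_plus_fibre_op[OF D] by simp
qed

lemma half_dirac_densely_defined: "selfadjoint_op D \<Longrightarrow> densely_defined (half_dirac D s l)"
  by (intro fibre_op_densely_defined shift_op_densely_defined) (simp add: selfadjoint_op_def)

lemma op_adj_half_dirac:
  fixes D :: "('h::chilbert_space \<times> 'h) set"
  assumes D: "selfadjoint_op D"
  shows "op_adj (half_dirac D s l) = half_dirac D (- s) l"
proof -
  have sub: "csubspace D" and adj: "op_adj D = D"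
    using D by (auto simp: selfadjoint_op_def densely_defined_def)
  show ?thesis
    by (subst op_adj_fibre_op) (simp_all add: shift_op_csubspace sub op_adj_shift_op adj)
qed

text \<open>Testing against vectors with one vanishing component separates the two adjoint relations.\<close>

lemma selfadjoint_offdiag:
  fixes S :: "('k::complex_inner \<times> 'h::complex_inner) set"
  assumes S: "densely_defined S" and T: "densely_defined T" and adj: "op_adj S = T" "op_adj T = S"
  shows "selfadjoint_op (op_offdiag S T)"
proof -
  note s = densely_definedD[OF S] and t = densely_definedD[OF T]
  have iff: "((x, y), (u, v)) \<in> op_offdiag S T \<longleftrightarrow> (y, u) \<in> S \<and> (x, v) \<in> T" for x y u v
    by (auto simp: op_offdiag_def)
  have z: "(0, 0) \<in> S" "(0, 0) \<in> T"
    using complex_vector.subspace_0[OF s(1)] complex_vector.subspace_0[OF t(1)] by (simp_all add: zero_prod_def)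
  have "csubspace (op_offdiag S T)"
  proof (rule complex_vector.subspaceI)
    show "0 \<in> op_offdiag S T" using z by (simp add: zero_prod_def iff)
    show "x + y \<in> op_offdiag S T" if "x \<in> op_offdiag S T" "y \<in> op_offdiag S T" for x y
      using that by (cases x; cases y) (auto simp: iff split_paired_all csubspace_pair_add[OF s(1)] csubspace_pair_add[OF t(1)])
    show "c *\<^sub>C x \<in> op_offdiag S T" if "x \<in> op_offdiag S T" for c x
      using that by (cases x) (auto simp: iff scaleC_prod_def split_paired_all csubspace_pair_scale[OF s(1)] csubspace_pair_scale[OF t(1)])
  qed
  moreover have "single_valued (op_offdiag S T)"
    using s(2) t(2) by (auto simp: single_valued_def iff)
  moreover have "Domain (op_offdiag S T) = Domain T \<times> Domain S" by (auto simp: Domain_iff split_paired_Ex iff)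
  then have "closure (Domain (op_offdiag S T)) = UNIV" using s(3) t(3) by (simp add: closure_Times)
  moreover have "op_adj (op_offdiag S T) = op_offdiag S T"
  proof -
    have "((a, b), (c, d)) \<in> op_adj (op_offdiag S T) \<longleftrightarrow> (a, d) \<in> op_adj S \<and> (b, c) \<in> op_adj T" for a b c d
    proof
      assume "((a, b), (c, d)) \<in> op_adj (op_offdiag S T)"
      then have adj: "\<And>p q. (p, q) \<in> op_offdiag S T \<Longrightarrow> cinner (a, b) q = cinner (c, d) p"
        by (auto simp: op_adj_def)
      have *: "cinner a u + cinner b v = cinner c x + cinner d y" if "(y, u) \<in> S" "(x, v) \<in> T" for x y u v
        using adj[of "(x, y)" "(u, v)"] that by (simp add: iff cinner_prod_def)
      show "(a, d) \<in> op_adj S \<and> (b, c) \<in> op_adj T"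
        unfolding op_adj_def using *[OF _ z(2)] *[OF z(1)] by auto
    next
      assume "(a, d) \<in> op_adj S \<and> (b, c) \<in> op_adj T"
      then have "\<And>y u. (y, u) \<in> S \<Longrightarrow> cinner a u = cinner d y" "\<And>x v. (x, v) \<in> T \<Longrightarrow> cinner b v = cinner c x"
        by (auto simp: op_adj_def)
      then show "((a, b), (c, d)) \<in> op_adj (op_offdiag S T)"
        by (auto simp: op_adj_def op_offdiag_def cinner_prod_def add.commute)
    qed
    then have quad: "((a, b), (c, d)) \<in> op_adj (op_offdiag S T) \<longleftrightarrow> ((a, b), (c, d)) \<in> op_offdiag S T" for a b c d
      using adj by (simp add: iff conj_commute)
    have "p \<in> op_adj (op_offdiag S T) \<longleftrightarrow> p \<in> op_offdiag S T" for p
    proof -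
      obtain a b c d where "p = ((a, b), (c, d))" by (metis surj_pair)
      then show ?thesis using quad by simp
    qed
    then show ?thesis by blast
  qed
  ultimately show ?thesis by (simp add: selfadjoint_op_def densely_defined_def)
qed

lemma selfadjoint_crossed_dirac:
  assumes D: "selfadjoint_op D"
  shows "selfadjoint_op (crossed_dirac D l)"
  unfolding crossed_dirac_eq[OF D]
  by (intro selfadjoint_offdiag half_dirac_densely_defined D)
    (use op_adj_half_dirac[OF D, of "- 1" l] op_adj_half_dirac[OF D, of 1 l] in simp_all)

lemma selfadjoint_mult_op: "selfadjoint_op (mult_op l)"
  unfolding mult_op_eq_fibre_op selfadjoint_op_def
  by (simp add: fibre_op_densely_defined mult_graph_densely_defined op_adj_fibre_op
      mult_graph_csubspace op_adj_mult_graph)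

section \<open>Commutators\<close>

text \<open>The bounded operator \<open>S\<close> extends \<open>[G, T]\<close>. In this form, which includes the invariance of the domain,
  the sum and Leibniz rules hold for arbitrary linear relations \<open>G\<close>.\<close>

definition has_commutator :: "('h::chilbert_space \<times> 'h) set \<Rightarrow> 'h bop \<Rightarrow> 'h bop \<Rightarrow> bool"
  where "has_commutator G T S \<longleftrightarrow> (\<forall>(x, y)\<in>G. (bop_apply T x, bop_apply T y + bop_apply S x) \<in> G)"

lemma has_commutatorD:
  "has_commutator G T S \<Longrightarrow> (x, y) \<in> G \<Longrightarrow> (bop_apply T x, bop_apply T y + bop_apply S x) \<in> G"
  by (auto simp: has_commutator_def)

lemma commutator_graph_iff:
  "(x, y) \<in> commutator_graph D T \<longleftrightarrow> (\<exists>u v. (bop_apply T x, u) \<in> D \<and> (x, v) \<in> D \<and> y = u - bop_apply T v)"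
  by (auto simp: commutator_graph_def op_minus_def bop_graph_def)

lemma has_commutator_iff:
  assumes "single_valued D"
  shows "has_commutator D T S \<longleftrightarrow> bop_apply T ` Domain D \<subseteq> Domain D \<and> commutator_graph D T \<subseteq> bop_graph S"
proof
  assume h: "has_commutator D T S"
  have "y = bop_apply S x" if xy: "(x, y) \<in> commutator_graph D T" for x y
  proof -
    obtain u v where uv: "(bop_apply T x, u) \<in> D" "(x, v) \<in> D" "y = u - bop_apply T v"
      using xy unfolding commutator_graph_iff by blast
    then have "u = bop_apply T v + bop_apply S x"
      using single_valuedD[OF assms uv(1)] has_commutatorD[OF h uv(2)] by blast
    then show ?thesis by (simp add: uv(3))
  qed
  moreover have "bop_apply T ` Domain D \<subseteq> Domain D" using has_commutatorD[OF h] by blast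
  ultimately show "bop_apply T ` Domain D \<subseteq> Domain D \<and> commutator_graph D T \<subseteq> bop_graph S"
    by (auto simp: bop_graph_def)
next
  assume h: "bop_apply T ` Domain D \<subseteq> Domain D \<and> commutator_graph D T \<subseteq> bop_graph S"
  have "(bop_apply T x, bop_apply T y + bop_apply S x) \<in> D" if xy: "(x, y) \<in> D" for x y
  proof -
    obtain u where u: "(bop_apply T x, u) \<in> D" using h xy by blast
    then have "(x, u - bop_apply T y) \<in> commutator_graph D T" using xy unfolding commutator_graph_iff by blast
    then have "u - bop_apply T y = bop_apply S x" using h by (auto simp: bop_graph_def)
    then show ?thesis using u by (simp add: algebra_simps)
  qed
  then show "has_commutator D T S" by (auto simp: has_commutator_def)
qed

lemma bop_eq_on_dense:
  assumes "closure X = UNIV" "\<And>x. x \<in> X \<Longrightarrow> bop_apply S x = bop_apply T x"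
  shows "S = T"
proof (rule bop_eqI)
  fix x
  have "closed {x. bop_apply S x = bop_apply T x}"
    by (intro closed_Collect_eq linear_continuous_on bounded_linear_bop)
  then have "closure X \<subseteq> {x. bop_apply S x = bop_apply T x}" using assms(2) by (intro closure_minimal) auto
  then show "bop_apply S x = bop_apply T x" using assms(1) by blast
qed

lemma commutator_eq:
  assumes D: "densely_defined D" and h: "has_commutator D T S"
  shows "commutator D T = S"
  unfolding commutator_def
proof (rule the_equality)
  note d = densely_definedD[OF D]
  show "commutator_graph D T \<subseteq> bop_graph S" using h has_commutator_iff[OF d(2)] by blast
  fix S' assume S': "commutator_graph D T \<subseteq> bop_graph S'"
  show "S' = S"
  proof (rule bop_eq_on_dense[OF d(3)])
    fix x assume "x \<in> Domain D"
    then obtain y where "(x, y) \<in> D" by blast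
    then have "(x, (bop_apply T y + bop_apply S x) - bop_apply T y) \<in> commutator_graph D T"
      using has_commutatorD[OF h] unfolding commutator_graph_iff by blast
    then show "bop_apply S' x = bop_apply S x" using S' by (auto simp: bop_graph_def)
  qed
qed

lemma bounded_commutator_iff:
  assumes "densely_defined D"
  shows "bounded_commutator D T \<longleftrightarrow> (\<exists>S. has_commutator D T S)"
  using has_commutator_iff[OF densely_definedD(2)[OF assms]] by (auto simp: bounded_commutator_def)

lemma has_commutator_commutator:
  assumes "densely_defined D" "bounded_commutator D T"
  shows "has_commutator D T (commutator D T)"
  using assms bounded_commutator_iff commutator_eq by metis

lemma has_commutator_zero: "csubspace D \<Longrightarrow> has_commutator D 0 0"
  using complex_vector.subspace_0[of D] by (auto simp: has_commutator_def zero_bop.rep_eq zero_prod_def)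

lemma has_commutator_add:
  assumes D: "csubspace D" and "has_commutator D T S" "has_commutator D T' S'"
  shows "has_commutator D (T + T') (S + S')"
  unfolding has_commutator_def
proof (clarify)
  fix x y assume xy: "(x, y) \<in> D"
  have "(bop_apply T x + bop_apply T' x, (bop_apply T y + bop_apply S x) + (bop_apply T' y + bop_apply S' x)) \<in> D"
    by (intro csubspace_pair_add D has_commutatorD assms xy)
  then show "(bop_apply (T + T') x, bop_apply (T + T') y + bop_apply (S + S') x) \<in> D"
    by (simp add: plus_bop.rep_eq algebra_simps)
qed

lemma has_commutator_mult:
  assumes "has_commutator D T S" "has_commutator D T' S'"
  shows "has_commutator D (T * T') (T * S' + S * T')"
  unfolding has_commutator_def
proof (clarify)
  fix x y assume xy: "(x, y) \<in> D"
  show "(bop_apply (T * T') x, bop_apply (T * T') y + bop_apply (T * S' + S * T') x) \<in> D"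
    using has_commutatorD[OF assms(1) has_commutatorD[OF assms(2) xy]]
    by (simp add: plus_bop.rep_eq times_bop.rep_eq bop_add add.assoc)
qed

lemma has_commutator_sum:
  assumes D: "csubspace D" and "\<And>i. i \<in> F \<Longrightarrow> \<exists>S. has_commutator D (f i) S"
  shows "\<exists>S. has_commutator D (sum f F) S"
  using assms(2)
  by (induction F rule: infinite_finite_induct)
    (auto intro: has_commutator_zero[OF D] has_commutator_add[OF D])

lift_definition bop_swap :: "'h::chilbert_space bop \<Rightarrow> 'h bop \<Rightarrow> ('h \<times> 'h) bop"
  is "\<lambda>f g x. (f (snd x), g (fst x))"
  by (auto simp: bounded_clinear_def scaleC_prod_def
      intro!: bounded_linear_Pair bounded_linear_compose[OF _ bounded_linear_fst]
        bounded_linear_compose[OF _ bounded_linear_snd])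

lemma has_commutator_offdiag:
  assumes "has_commutator S T C" "has_commutator S' T C'"
  shows "has_commutator (op_offdiag S S') (bop_dsum T T) (bop_swap C C')"
  using assms by (auto simp: has_commutator_def op_offdiag_def bop_dsum.rep_eq bop_swap.rep_eq)

lemma has_commutator_offdiagD:
  assumes "has_commutator (op_offdiag S S') (bop_dsum T T) 0" "csubspace S" "csubspace S'"
  shows "has_commutator S T 0" "has_commutator S' T 0"
proof -
  have z: "(0, 0) \<in> S" "(0, 0) \<in> S'"
    using complex_vector.subspace_0[OF assms(2)] complex_vector.subspace_0[OF assms(3)] by (simp_all add: zero_prod_def)
  have iff: "((x, y), (u, v)) \<in> op_offdiag S S' \<longleftrightarrow> (y, u) \<in> S \<and> (x, v) \<in> S'" for x y u v
    by (auto simp: op_offdiag_def)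
  show "has_commutator S T 0" unfolding has_commutator_def
  proof clarify
    fix y u assume "(y, u) \<in> S"
    then have "((0, y), (u, 0)) \<in> op_offdiag S S'" by (simp add: iff z)
    from has_commutatorD[OF assms(1) this]
    show "(bop_apply T y, bop_apply T u + bop_apply 0 y) \<in> S" by (simp add: bop_dsum.rep_eq zero_bop.rep_eq iff)
  qed
  show "has_commutator S' T 0" unfolding has_commutator_def
  proof clarify
    fix x v assume "(x, v) \<in> S'"
    then have "((x, 0), (0, v)) \<in> op_offdiag S S'" by (simp add: iff z)
    from has_commutatorD[OF assms(1) this]
    show "(bop_apply T x, bop_apply T v + bop_apply 0 x) \<in> S'" by (simp add: bop_dsum.rep_eq zero_bop.rep_eq iff)
  qed
qed

text \<open>Translation commutes with the part acting on the fibres; what remains is multiplication by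
  the differences of the weights, bounded by translation boundedness.\<close>

lemma has_commutator_translation:
  fixes D :: "('h::chilbert_space \<times> 'h) set" and c :: "'g::group_add \<Rightarrow> complex"
  assumes bd: "\<And>g. cmod (c g - c (- h + g)) \<le> K"
  shows "\<exists>S. has_commutator (fibre_op (\<lambda>g. shift_op D (c g))) (translation h) S"
proof
  define M :: "('g, 'h) ell2 bop" where "M = fibre_bop (\<lambda>g. (c g - c (- h + g)) *\<^sub>C 1)"
  have "norm ((c g - c (- h + g)) *\<^sub>C (1 :: 'h bop)) \<le> K" for g
    using bd[of g] by (intro norm_bop_le order_trans[OF norm_ge_zero bd])
      (simp add: scaleC_bop.rep_eq one_bop.rep_eq norm_scaleC mult_right_mono)
  then have M: "ell2_apply (bop_apply M x) g = (c g - c (- h + g)) *\<^sub>C ell2_apply x g" for x g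
    unfolding M_def by (subst fibre_bop(1)) (simp_all add: scaleC_bop.rep_eq one_bop.rep_eq)
  show "has_commutator (fibre_op (\<lambda>g. shift_op D (c g))) (translation h) (M * translation h)"
    unfolding has_commutator_def
    by (auto simp: fibre_op_iff shift_op_iff translation_apply times_bop.rep_eq plus_ell2.rep_eq M
        complex_vector.scale_left_diff_distrib)
qed

text \<open>The scalars \<open>c\<^sub>g\<close> are central in each fibre, so only the commutator with \<open>D\<close> survives there.\<close>

lemma (in crossed_system) has_commutator_cov:
  fixes D :: "('h \<times> 'h) set"
  assumes D: "densely_defined D" and a: "a \<in> A"
    and bc: "\<And>g. bounded_commutator D (\<pi> (\<alpha> g a))"
    and bd: "bdd_above (range (\<lambda>g. norm (commutator D (\<pi> (\<alpha> g a)))))"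
  shows "has_commutator (fibre_op (\<lambda>g. shift_op D (c g))) (cov a)
    (fibre_bop (\<lambda>g. commutator D (\<pi> (\<alpha> (- g) a))))"
proof -
  obtain K where "\<And>g. norm (commutator D (\<pi> (\<alpha> g a))) \<le> K" using bd by (auto simp: bdd_above_def)
  then have app: "ell2_apply (bop_apply (fibre_bop (\<lambda>g. commutator D (\<pi> (\<alpha> (- g) a)))) x) g
      = bop_apply (commutator D (\<pi> (\<alpha> (- g) a))) (ell2_apply x g)" for x g
    by (intro fibre_bop(1)) blast
  show ?thesis
    unfolding has_commutator_def
  proof clarify
    fix x y assume xy: "(x, y) \<in> fibre_op (\<lambda>g. shift_op D (c g))"
    show "(bop_apply (cov a) x, bop_apply (cov a) y
        + bop_apply (fibre_bop (\<lambda>g. commutator D (\<pi> (\<alpha> (- g) a)))) x) \<in> fibre_op (\<lambda>g. shift_op D (c g))"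
      unfolding fibre_op_iff
    proof
      fix g
      have "(ell2_apply x g, ell2_apply y g - c g *\<^sub>C ell2_apply x g) \<in> D"
        using xy by (simp add: fibre_op_iff shift_op_iff)
      from has_commutatorD[OF has_commutator_commutator[OF D bc[of "- g"]] this]
      show "(ell2_apply (bop_apply (cov a) x) g, ell2_apply (bop_apply (cov a) y
        + bop_apply (fibre_bop (\<lambda>g. commutator D (\<pi> (\<alpha> (- g) a)))) x) g) \<in> shift_op D (c g)"
        by (simp add: shift_op_iff plus_ell2.rep_eq cov_apply a app bop_diff bop_scaleC algebra_simps)
    qed
  qed
qed

section \<open>Eigenvectors of the squares\<close>

lemma inverse_one_plus_sq_eigenI:
  assumes D: "selfadjoint_op D" and x: "(x, w) \<in> D" "(w, m *\<^sub>R x) \<in> D" and m: "1 + m \<noteq> 0"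
  shows "bop_apply (inverse_one_plus_sq D) x = (1 / (1 + m)) *\<^sub>R x"
proof -
  have sub: "csubspace D" using D by (simp add: selfadjoint_op_def densely_defined_def)
  define s where "s = 1 / (1 + m)"
  have "(s *\<^sub>R x, s *\<^sub>R w) \<in> D" "(s *\<^sub>R w, s *\<^sub>R m *\<^sub>R x) \<in> D"
    using csubspace_pair_scale[OF sub x(1), of s] csubspace_pair_scale[OF sub x(2), of s]
    by (simp_all add: scaleR_scaleC scaleC_scaleC)
  moreover have "s *\<^sub>R m *\<^sub>R x = x - s *\<^sub>R x"
  proof -
    have "s * m = 1 - s" using m by (simp add: s_def field_simps)
    then show ?thesis by (simp add: scaleR_diff_left)
  qed
  ultimately show ?thesis unfolding inverse_one_plus_sq_iff[OF D] s_def[symmetric] by auto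
qed

lemma inverse_one_plus_sq_eigenE:
  assumes D: "selfadjoint_op D" and b: "bop_apply (inverse_one_plus_sq D) b = r *\<^sub>R b" and r: "r \<noteq> 0"
  obtains w where "(b, w) \<in> D" "(w, (1 / r - 1) *\<^sub>R b) \<in> D"
proof -
  have sub: "csubspace D" using D by (simp add: selfadjoint_op_def densely_defined_def)
  obtain w where w: "(r *\<^sub>R b, w) \<in> D" "(w, b - r *\<^sub>R b) \<in> D"
    using b inverse_one_plus_sq_iff[OF D] by blast
  have "((1 / r) *\<^sub>R r *\<^sub>R b, (1 / r) *\<^sub>R w) \<in> D" "((1 / r) *\<^sub>R w, (1 / r) *\<^sub>R (b - r *\<^sub>R b)) \<in> D"
    using csubspace_pair_scale[OF sub w(1), of "1 / r"] csubspace_pair_scale[OF sub w(2), of "1 / r"]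
    unfolding scaleR_scaleC of_real_divide of_real_1 by blast+
  moreover have "(1 / r) *\<^sub>R r *\<^sub>R b = b" "(1 / r) *\<^sub>R (b - r *\<^sub>R b) = (1 / r - 1) *\<^sub>R b"
    using r by (simp_all add: scaleR_diff_right scaleR_diff_left)
  ultimately show ?thesis using that[of "(1 / r) *\<^sub>R w"] by simp
qed

lemma mult_op_resolvent:
  "bop_apply (inverse_one_plus_sq (mult_op l)) (ell2_delta g) = (1 / (1 + (real_of_int (l g))\<^sup>2)) *\<^sub>R ell2_delta g"
proof (rule inverse_one_plus_sq_eigenI[OF selfadjoint_mult_op])
  have "ell2_apply (ell2_delta g) k = (if k = g then 1 else 0)" for k by (simp add: ell2_delta.rep_eq)
  then show "(ell2_delta g, of_int (l g) *\<^sub>C ell2_delta g) \<in> mult_op l"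
    "(of_int (l g) *\<^sub>C ell2_delta g, (real_of_int (l g))\<^sup>2 *\<^sub>R ell2_delta g) \<in> mult_op l"
    by (simp_all add: mult_op_eq_fibre_op fibre_op_iff mult_graph_iff scaleC_ell2.rep_eq
        scaleR_ell2.rep_eq scaleC_complex_def power2_eq_square scaleR_conv_of_real)
  show "1 + (real_of_int (l g))\<^sup>2 \<noteq> 0" by (metis add_pos_nonneg less_numeral_extra(1) less_numeral_extra(3) zero_le_power2)
qed

text \<open>The first operator sends \<open>b \<otimes> \<delta>\<^sub>g\<close> to \<open>(D b + i s t b) \<otimes> \<delta>\<^sub>g\<close>, and the second one, with the opposite sign, turns this
  into \<open>(D\<^sup>2 b + t\<^sup>2 b) \<otimes> \<delta>\<^sub>g\<close> because \<open>s\<^sup>2 = 1\<close>.\<close>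

lemma half_dirac_single:
  fixes D :: "('h::chilbert_space \<times> 'h) set" and l :: "'g \<Rightarrow> int" and g :: 'g and s m :: real and b w :: 'h
  assumes D: "selfadjoint_op D" and b: "(b, w) \<in> D" "(w, m *\<^sub>R b) \<in> D"
  defines "t \<equiv> real_of_int (l g)"
  defines "v \<equiv> single (w + (\<i> * of_real (s * t)) *\<^sub>C b) g"
  assumes s: "s * s = 1"
  shows "(single b g, v) \<in> half_dirac D s l"
    and "(v, (m + t\<^sup>2) *\<^sub>R single b g) \<in> half_dirac D (- s) l"
proof -
  have sub: "csubspace D" using D by (simp add: selfadjoint_op_def densely_defined_def)
  note tens = fibre_op_single[of "\<lambda>g. shift_op D (\<i> * of_real (_ * of_int (l g)))", OF shift_op_csubspace[OF sub]]
  show "(single b g, v) \<in> half_dirac D s l"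
    unfolding v_def by (rule tens) (simp add: shift_op_iff t_def b)
  define c where "c = \<i> * complex_of_real (s * t)"
  have cc: "c * c = - (of_real (t\<^sup>2))"
  proof -
    have "c * c = (\<i> * \<i>) * of_real ((s * s) * (t * t))" unfolding c_def of_real_mult by (simp only: ac_simps)
    then show ?thesis by (simp add: s power2_eq_square)
  qed
  have "(w, m *\<^sub>R b) \<in> D" "(c *\<^sub>C b, c *\<^sub>C w) \<in> D" using b csubspace_pair_scale[OF sub] by blast+
  then have "(w + c *\<^sub>C b, m *\<^sub>R b + c *\<^sub>C w) \<in> D" by (rule csubspace_pair_add[OF sub])
  moreover have "m *\<^sub>R b + c *\<^sub>C w = (m + t\<^sup>2) *\<^sub>R b - (- c) *\<^sub>C (w + c *\<^sub>C b)"
    by (simp add: scaleC_add_right scaleC_scaleC cc scaleR_scaleC scaleC_add_left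
        complex_vector.scale_minus_left)
  ultimately have "(w + c *\<^sub>C b, (m + t\<^sup>2) *\<^sub>R b) \<in> shift_op D (- c)" by (simp add: shift_op_iff)
  moreover have "- c = \<i> * of_real (- s * of_int (l g))" by (simp add: c_def t_def)
  ultimately show "(v, (m + t\<^sup>2) *\<^sub>R single b g) \<in> half_dirac D (- s) l"
    unfolding v_def c_def[symmetric] tens_scaleR_left[symmetric] by (intro tens) simp
qed

text \<open>The Boolean index selects the summand of \<open>H \<oplus> H\<close>.\<close>

definition crossed_basis :: "'h \<times> 'g \<times> bool \<Rightarrow> ('g, 'h::chilbert_space) ell2 \<times> ('g, 'h) ell2"
  where "crossed_basis = (\<lambda>(b, g, s). if s then (single b g, 0) else (0, single b g))"

text \<open>On a basis vector \<open>b \<otimes> \<delta>\<^sub>g\<close> built from an eigenvector \<open>D\<^sup>2 b = m b\<close> the square of the Dirac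
  operator is \<open>m + l(g)\<^sup>2\<close>, because the mixed terms of the two off-diagonal factors cancel.\<close>

lemma crossed_dirac_resolvent:
  assumes D: "selfadjoint_op D" and b: "bop_apply (inverse_one_plus_sq D) b = r *\<^sub>R b" and r: "r > 0"
  shows "bop_apply (inverse_one_plus_sq (crossed_dirac D l)) (crossed_basis (b, g, s))
    = (1 / (1 / r + (real_of_int (l g))\<^sup>2)) *\<^sub>R crossed_basis (b, g, s)"
proof -
  obtain w where w: "(b, w) \<in> D" "(w, (1 / r - 1) *\<^sub>R b) \<in> D"
    using inverse_one_plus_sq_eigenE[OF D b] r by auto
  define m where "m = 1 / r - 1 + (real_of_int (l g))\<^sup>2"
  have sa: "selfadjoint_op (crossed_dirac D l)" by (rule selfadjoint_crossed_dirac[OF D])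
  have zero: "(0, 0) \<in> half_dirac D u l" for u
    using complex_vector.subspace_0[OF densely_definedD(1)[OF half_dirac_densely_defined[OF D]]]
    by (simp add: zero_prod_def)
  have m: "1 + m = 1 / r + (real_of_int (l g))\<^sup>2" "1 + m \<noteq> 0"
    using r by (simp_all add: m_def add_pos_nonneg less_imp_neq[symmetric])
  have "\<exists>v. (crossed_basis (b, g, s), v) \<in> crossed_dirac D l \<and> (v, m *\<^sub>R crossed_basis (b, g, s)) \<in> crossed_dirac D l"
  proof (cases s)
    case True
    note h = half_dirac_single[OF D w, where s = 1 and l = l and g = g]
    show ?thesis
      using h zero[of 1] zero[of "- 1"] unfolding crossed_dirac_eq[OF D] op_offdiag_def crossed_basis_def m_def
      by (intro exI[of _ "(0, _)"]) (auto simp: True)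
  next
    case False
    note h = half_dirac_single[OF D w, where s = "- 1" and l = l and g = g]
    show ?thesis
      using h zero[of 1] zero[of "- 1"] unfolding crossed_dirac_eq[OF D] op_offdiag_def crossed_basis_def m_def
      by (intro exI[of _ "(_, 0)"]) (auto simp: False)
  qed
  then show ?thesis unfolding m(1)[symmetric] using inverse_one_plus_sq_eigenI[OF sa _ _ m(2)] by blast
qed

lemma crossed_basis_cinner:
  assumes B: "orthonormal B" and i: "i \<in> B \<times> UNIV" and j: "j \<in> B \<times> UNIV"
  shows "cinner (crossed_basis i) (crossed_basis j) = (if i = j then 1 else 0)"
proof -
  obtain b g s b' g' s' where ij: "i = (b, g, s)" "j = (b', g', s')" by (metis prod_cases3)
  have "cinner b b' = (if b = b' then 1 else 0)" using i j ij orthonormal_cinner[OF B] by auto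
  then show ?thesis
    unfolding ij crossed_basis_def by (auto simp: cinner_prod_def cinner_single ell2_apply_single)
qed

lemma crossed_basis_inj:
  assumes B: "orthonormal B"
  shows "inj_on crossed_basis (B \<times> UNIV)"
proof (rule inj_onI)
  fix i j assume "i \<in> B \<times> UNIV" "j \<in> B \<times> UNIV" "crossed_basis i = crossed_basis j"
  then show "i = j"
    using crossed_basis_cinner[OF B, of i j] crossed_basis_cinner[OF B, of i i] by (metis zero_neq_one)
qed

lemma crossed_basis_orthonormal_basis:
  fixes B :: "'h::chilbert_space set"
  assumes B: "orthonormal_basis B"
  shows "orthonormal_basis (crossed_basis ` (B \<times> (UNIV :: ('g \<times> bool) set)))"
proof (rule orthonormal_basisI)
  note oB = orthonormal_basisD[OF B]
  show "orthonormal (crossed_basis ` (B \<times> (UNIV :: ('g \<times> bool) set)))"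
    unfolding orthonormal_def
  proof (intro ballI)
    fix e f :: "('g, 'h) ell2 \<times> ('g, 'h) ell2"
    assume "e \<in> crossed_basis ` (B \<times> UNIV)" "f \<in> crossed_basis ` (B \<times> UNIV)"
    then obtain i j where "i \<in> B \<times> UNIV" "j \<in> B \<times> UNIV" "e = crossed_basis i" "f = crossed_basis j"
      by blast
    then show "cinner e f = (if e = f then 1 else 0)"
      using inj_on_eq_iff[OF crossed_basis_inj[OF oB], of i j] crossed_basis_cinner[OF oB, of i j] by simp
  qed
  fix x :: "('g, 'h) ell2 \<times> ('g, 'h) ell2"
  assume x: "\<And>e. e \<in> crossed_basis ` (B \<times> UNIV) \<Longrightarrow> cinner e x = 0"
  have zero: "\<xi> = 0" if "\<And>b. b \<in> B \<Longrightarrow> cinner b \<xi> = 0" for \<xi> :: 'h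
    using parseval[OF B, of \<xi>] that has_sum_0[of B "\<lambda>b. (cmod (cinner b \<xi>))\<^sup>2"] has_sum_unique by fastforce
  have coeff: "cinner (crossed_basis (b, g, s)) x = 0" if "b \<in> B" for b g s using x that by blast
  have "cinner b (ell2_apply (fst x) g) = 0" "cinner b (ell2_apply (snd x) g) = 0" if "b \<in> B" for b g
    using coeff[OF that, of g True] coeff[OF that, of g False]
    by (simp_all add: crossed_basis_def cinner_prod_def cinner_single)
  then have "ell2_apply (fst x) g = 0" "ell2_apply (snd x) g = 0" for g using zero by blast+
  then show "x = 0" by (intro prod_eqI ell2_eqI) (simp_all add: zero_ell2.rep_eq)
qed

lemma inj_ell2_delta: "inj ell2_delta"
  by (rule injI) (metis ell2_delta.rep_eq zero_neq_one)

lemma ell2_delta_orthonormal_basis: "orthonormal_basis (range (ell2_delta :: 'g \<Rightarrow> ('g, complex) ell2))"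
proof (rule orthonormal_basisI)
  have delta: "ell2_delta g = single 1 g" for g :: 'g
    by (rule ell2_eqI) (simp add: tens.rep_eq scaleC_complex_def)
  have c: "cinner (ell2_delta g) x = ell2_apply x g" for x and g :: 'g
    by (subst delta) (simp add: cinner_single cinner_complex_def)
  show "orthonormal (range (ell2_delta :: 'g \<Rightarrow> ('g, complex) ell2))"
    by (auto simp: orthonormal_def c ell2_delta.rep_eq inj_eq[OF inj_ell2_delta])
  fix x :: "('g, complex) ell2" assume "\<And>b. b \<in> range ell2_delta \<Longrightarrow> cinner b x = 0"
  then have "ell2_apply x g = 0" for g using c[of g x] by simp
  then show "x = 0" by (intro ell2_eqI) (simp add: zero_ell2.rep_eq)
qed

section \<open>The crossed product triple\<close>

lemma bop_dsum_apply: "bop_apply (bop_dsum S T) x = (bop_apply S (fst x), bop_apply T (snd x))"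
  by (simp add: bop_dsum.rep_eq)

lemma bop_dsum_diagonal_hom: "cstar_hom X (\<lambda>T :: 'h::chilbert_space bop. bop_dsum T T)"
  unfolding cstar_hom_def
proof (intro conjI ballI allI)
  show "bop_dsum (S + T) (S + T) = bop_dsum S S + bop_dsum T T" for S T :: "'h bop"
    by (rule bop_eqI) (simp add: bop_dsum_apply plus_bop.rep_eq)
  show "bop_dsum (S * T) (S * T) = bop_dsum S S * bop_dsum T T" for S T :: "'h bop"
    by (rule bop_eqI) (simp add: bop_dsum_apply times_bop.rep_eq)
  show "bop_dsum (c *\<^sub>C T) (c *\<^sub>C T) = c *\<^sub>C bop_dsum T T" for c and T :: "'h bop"
    by (rule bop_eqI) (simp add: bop_dsum_apply scaleC_bop.rep_eq scaleC_prod_def)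
  show "bop_dsum (star T) (star T) = star (bop_dsum T T)" for T :: "'h bop"
    by (rule bop_eqI, rule cinner_eqI, simp only: cinner_star_right)
      (simp add: bop_dsum_apply cinner_star_right cinner_prod_def)
qed

lemma bop_dsum_diagonal_inj: "inj (\<lambda>T :: 'h::chilbert_space bop. bop_dsum T T)"
proof (rule injI)
  fix S T :: "'h bop" assume "bop_dsum S S = bop_dsum T T"
  then have "bop_apply (bop_dsum S S) (x, 0) = bop_apply (bop_dsum T T) (x, 0)" for x by simp
  then show "S = T" by (intro bop_eqI) (simp add: bop_dsum_apply)
qed

lemma summable_on_product_bound:
  fixes a :: "'b \<Rightarrow> real" and c :: "'g \<Rightarrow> real"
  assumes a: "a summable_on B" "\<And>b. b \<in> B \<Longrightarrow> 0 \<le> a b" and c: "c summable_on UNIV" "\<And>g. 0 \<le> c g"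
    and f: "\<And>b g s. b \<in> B \<Longrightarrow> 0 \<le> f (b, g, s)" "\<And>b g s. b \<in> B \<Longrightarrow> f (b, g, s) \<le> a b * c g"
  shows "f summable_on B \<times> (UNIV :: ('g \<times> bool) set)"
proof (rule nonneg_bdd_above_summable_on)
  show "0 \<le> f i" if "i \<in> B \<times> UNIV" for i using that f(1) by auto
  show "bdd_above (sum f ` {F. F \<subseteq> B \<times> (UNIV :: ('g \<times> bool) set) \<and> finite F})"
  proof (rule bdd_aboveI2)
    fix F assume "F \<in> {F. F \<subseteq> B \<times> (UNIV :: ('g \<times> bool) set) \<and> finite F}"
    then have F: "F \<subseteq> B \<times> UNIV" "finite F" by auto
    define P where "P = fst ` F"
    define Q where "Q = (fst \<circ> snd) ` F"
    have PQ: "finite P" "finite Q" "P \<subseteq> B" "F \<subseteq> P \<times> Q \<times> (UNIV :: bool set)"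
      using F by (auto simp: P_def Q_def image_iff) force+
    have "sum f F \<le> (\<Sum>(b, g, s)\<in>F. a b * c g)" using F f(2) by (intro sum_mono) auto
    also have "\<dots> \<le> (\<Sum>(b, g, s)\<in>P \<times> Q \<times> (UNIV :: bool set). a b * c g)"
      using PQ a(2) c(2) by (intro sum_mono2) auto
    also have "\<dots> = (\<Sum>b\<in>P. \<Sum>g\<in>Q. \<Sum>s\<in>(UNIV :: bool set). a b * c g)"
      by (simp only: sum.cartesian_product)
    also have "\<dots> = 2 * (sum a P * sum c Q)"
      unfolding sum_product by (simp add: sum_distrib_left UNIV_bool)
    also have "\<dots> \<le> 2 * (infsum a B * infsum c UNIV)"
      using PQ a c by (intro mult_left_mono mult_mono finite_sum_le_infsum sum_nonneg infsum_nonneg) auto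
    finally show "sum f F \<le> 2 * (infsum a B * infsum c UNIV)" .
  qed
qed

locale crossed_triple = crossed_system A \<pi> \<alpha>
  for A :: "'a::cstar_algebra set" and \<pi> :: "'a \<Rightarrow> 'h::chilbert_space bop"
    and \<alpha> :: "'g::group_add \<Rightarrow> 'a \<Rightarrow> 'a" +
  fixes \<A> :: "'a set" and D :: "('h \<times> 'h) set" and l :: "'g \<Rightarrow> int"
  assumes triple: "odd_spectral_triple A \<A> \<pi> D"
    and faithful: "inj_on \<pi> A"
    and l: "proper_translation_bounded l"
    and inv: "\<And>g. \<alpha> g ` \<A> \<subseteq> \<A>"
    and bdd: "\<And>a. a \<in> \<A> \<Longrightarrow> bdd_above (range (\<lambda>g. norm (commutator D (\<pi> (\<alpha> g a)))))"
begin

abbreviation dirac where "dirac \<equiv> crossed_dirac D l"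

lemma D: "selfadjoint_op D" "densely_defined D" "csubspace D"
  using triple by (simp_all add: odd_spectral_triple_def selfadjoint_op_def densely_defined_def)

lemma \<A>: "star_subalgebra \<A>" "csubspace \<A>" "\<A> \<subseteq> A" "A \<subseteq> closure \<A>"
  using triple by (simp_all add: odd_spectral_triple_def star_subalgebra_def)

lemma \<A>_in_A: "a \<in> \<A> \<Longrightarrow> a \<in> A" using \<A>(3) by blast

lemma \<A>_commutator: "a \<in> \<A> \<Longrightarrow> bounded_commutator D (\<pi> a)"
  using triple by (simp add: odd_spectral_triple_def)

lemma l_zero: "l g = 0 \<longleftrightarrow> g = 0"
  using l by (simp add: proper_translation_bounded_def)

lemma countable_group: "countable (UNIV :: 'g set)"
proof -
  have "UNIV = (\<Union>n. {g. l g = n})" by auto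
  also have "countable \<dots>" using l by (intro countable_UN) (auto simp: proper_translation_bounded_def countable_finite)
  finally show ?thesis .
qed

lemma finite_sublevel: "finite {g. (real_of_int (l g))\<^sup>2 < C}"
proof -
  define N where "N = \<lceil>C\<rceil>"
  have "{g. (real_of_int (l g))\<^sup>2 < C} \<subseteq> (\<Union>n\<in>{- N..N}. {g. l g = n})"
  proof
    fix g assume g: "g \<in> {g. (real_of_int (l g))\<^sup>2 < C}"
    have "\<bar>l g\<bar> \<le> (l g)\<^sup>2"
      by (metis abs_ge_zero abs_le_square_iff int_one_le_iff_zero_less linorder_not_le mult_le_cancel_right1 power2_abs power2_eq_square zero_eq_power2 order_le_less)
    moreover have "real_of_int ((l g)\<^sup>2) < C" using g by simp
    then have "(l g)\<^sup>2 \<le> N" unfolding N_def by linarith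
    ultimately show "g \<in> (\<Union>n\<in>{- N..N}. {g. l g = n})" by auto
  qed
  moreover have "finite (\<Union>n\<in>{- N..N}. {g. l g = n})"
    using l by (intro finite_UN_I) (auto simp: proper_translation_bounded_def)
  ultimately show ?thesis by (rule finite_subset)
qed

text \<open>Eigenvalues of the resolvent are positive since it is positive and injective, and at most 1 since
  \<open>1 / r - 1 = (norm (D b))\<^sup>2\<close> for a unit eigenvector \<open>b\<close>.\<close>

lemma eigenbasis:
  obtains B r where "orthonormal_basis B"
    "\<And>b. b \<in> B \<Longrightarrow> bop_apply (inverse_one_plus_sq D) b = r b *\<^sub>R b"
    "\<And>b. b \<in> B \<Longrightarrow> 0 < r b" "\<And>b. b \<in> B \<Longrightarrow> r b \<le> 1"
proof -
  define R where "R = inverse_one_plus_sq D"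
  have R: "pos_bop R" unfolding R_def by (rule pos_inverse_one_plus_sq[OF D(1)])
  have "compact_bop (bop_powr R (1 / 2))" using triple by (simp add: odd_spectral_triple_def R_def)
  then have "compact_bop R" using compact_bop_times_left bop_powr_half_square[OF R] by metis
  then obtain B r where B: "orthonormal_basis B" "\<And>b. b \<in> B \<Longrightarrow> bop_apply R b = r b *\<^sub>R b"
    using compact_positive_eigenbasis[OF R] by blast
  have n: "norm b = 1" if "b \<in> B" for b using that orthonormal_norm[OF orthonormal_basisD[OF B(1)]] by blast
  have r0: "0 < r b" if b: "b \<in> B" for b
  proof -
    have "b \<noteq> 0" using n[OF b] by auto
    then have "0 \<le> r b" "r b \<noteq> 0"
      using pos_bop_eigenvalue(1)[OF R B(2)[OF b]] inverse_one_plus_sq_injective[OF D(1), of b] B(2)[OF b]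
      by (auto simp: R_def)
    then show ?thesis by simp
  qed
  have "r b \<le> 1" if b: "b \<in> B" for b
  proof -
    obtain w where w: "(b, w) \<in> D" "(w, (1 / r b - 1) *\<^sub>R b) \<in> D"
      using inverse_one_plus_sq_eigenE[OF D(1) B(2)[OF b, unfolded R_def]] r0[OF b] by auto
    have "cinner b ((1 / r b - 1) *\<^sub>R b) = cinner w w" by (rule selfadjoint_symmetric[OF D(1) w])
    then have "complex_of_real (1 / r b - 1) = complex_of_real ((norm w)\<^sup>2)"
      by (simp only: cinner_scaleR_right cinner_self n[OF b]) simp
    then have "1 / r b - 1 = (norm w)\<^sup>2" using of_real_eq_iff by blast
    then have "1 \<le> 1 / r b" using zero_le_power2[of "norm w"] by linarith
    then show ?thesis using r0[OF b] by (simp add: le_divide_eq)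
  qed
  then show ?thesis using that[of B r] B(1) B(2)[unfolded R_def] r0 by blast
qed

context
  fixes B :: "'h set" and r :: "'h \<Rightarrow> real"
  assumes B: "orthonormal_basis B"
    and r: "\<And>b. b \<in> B \<Longrightarrow> bop_apply (inverse_one_plus_sq D) b = r b *\<^sub>R b"
    and r_pos: "\<And>b. b \<in> B \<Longrightarrow> 0 < r b" and r_le: "\<And>b. b \<in> B \<Longrightarrow> r b \<le> 1"
begin

definition eigenvalue :: "'h \<times> 'g \<times> bool \<Rightarrow> real"
  where "eigenvalue = (\<lambda>(b, g, s). 1 / (1 / r b + (real_of_int (l g))\<^sup>2))"

text \<open>The same eigenvalue as a function of the basis vector instead of its index.\<close>

definition eigenvalue_at :: "('g, 'h) ell2 \<times> ('g, 'h) ell2 \<Rightarrow> real"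
  where "eigenvalue_at v = eigenvalue (inv_into (B \<times> UNIV) crossed_basis v)"

lemma eigenvalue_at: "i \<in> B \<times> UNIV \<Longrightarrow> eigenvalue_at (crossed_basis i) = eigenvalue i"
  by (simp add: eigenvalue_at_def inv_into_f_f[OF crossed_basis_inj[OF orthonormal_basisD[OF B]]])

lemma crossed_eigenvector:
  assumes "v \<in> crossed_basis ` (B \<times> UNIV)"
  shows "bop_apply (inverse_one_plus_sq dirac) v = eigenvalue_at v *\<^sub>R v"
proof -
  obtain b g s where v: "b \<in> B" "v = crossed_basis (b, g, s)" using assms by auto
  then have "eigenvalue_at v = 1 / (1 / r b + (real_of_int (l g))\<^sup>2)"
    using eigenvalue_at[of "(b, g, s)"] by (simp add: eigenvalue_def)
  then show ?thesis using crossed_dirac_resolvent[OF D(1) r[OF v(1)] r_pos[OF v(1)], where l = l and g = g and s = s] v(2) by simp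
qed

lemma eigenvalue_pos: "b \<in> B \<Longrightarrow> 0 < eigenvalue (b, g, s)"
  using r_pos[of b] by (simp add: eigenvalue_def add_pos_nonneg)

lemma eigenvalue_le_left: "b \<in> B \<Longrightarrow> eigenvalue (b, g, s) \<le> r b"
proof -
  assume b: "b \<in> B"
  have "1 / (1 / r b + (real_of_int (l g))\<^sup>2) \<le> 1 / (1 / r b)"
    using r_pos[OF b] by (intro divide_left_mono) (simp_all add: add_pos_nonneg)
  then show ?thesis by (simp add: eigenvalue_def)
qed

lemma eigenvalue_le_right: "b \<in> B \<Longrightarrow> eigenvalue (b, g, s) \<le> 1 / (1 + (real_of_int (l g))\<^sup>2)"
proof -
  assume b: "b \<in> B"
  have "0 < 1 / r b" "1 \<le> 1 / r b" using r_pos[OF b] r_le[OF b] by simp_all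
  then show ?thesis
    unfolding eigenvalue_def prod.case
    by (intro divide_left_mono mult_pos_pos add_pos_nonneg) simp_all
qed

text \<open>An eigenvalue above \<open>e\<close> forces \<open>r\<^sub>b > e\<close> and \<open>l(g)\<^sup>2 < 1 / e\<close>. Only finitely many \<open>b\<close> satisfy the former, as \<open>D\<close>
  has compact resolvent, and finitely many \<open>g\<close> the latter, as \<open>l\<close> is proper.\<close>

lemma finite_large_eigenvalues:
  assumes e: "e > 0"
  shows "finite {v \<in> crossed_basis ` (B \<times> (UNIV :: ('g \<times> bool) set)). eigenvalue_at v > e}"
proof -
  have "compact_bop (bop_powr (inverse_one_plus_sq D) (1 / 2))"
    using triple by (simp add: odd_spectral_triple_def)
  then have "finite {b \<in> B. r b > e}" using compact_resolvent_iff[OF D(1) B r] e by blast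
  then have fin: "finite ({b \<in> B. r b > e} \<times> {g. (real_of_int (l g))\<^sup>2 < 1 / e} \<times> (UNIV :: bool set))"
    by (intro finite_cartesian_product finite_sublevel) simp_all
  have "{v \<in> crossed_basis ` (B \<times> (UNIV :: ('g \<times> bool) set)). eigenvalue_at v > e}
      \<subseteq> crossed_basis ` ({b \<in> B. r b > e} \<times> {g. (real_of_int (l g))\<^sup>2 < 1 / e} \<times> (UNIV :: bool set))"
  proof
    fix v assume "v \<in> {v \<in> crossed_basis ` (B \<times> (UNIV :: ('g \<times> bool) set)). eigenvalue_at v > e}"
    then obtain b g s where v: "b \<in> B" "v = crossed_basis (b, g, s)" "eigenvalue (b, g, s) > e"
      using eigenvalue_at by auto
    have "e < 1 / (1 + (real_of_int (l g))\<^sup>2)" using v(3) eigenvalue_le_right[OF v(1), of g s] by linarith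
    then have "e * (1 + (real_of_int (l g))\<^sup>2) < 1" by (simp add: pos_less_divide_eq add_pos_nonneg)
    then have "(real_of_int (l g))\<^sup>2 < 1 / e" using e by (simp add: pos_less_divide_eq algebra_simps)
    moreover have "r b > e" using v(3) eigenvalue_le_left[OF v(1), of g s] by linarith
    ultimately show "v \<in> crossed_basis ` ({b \<in> B. r b > e} \<times> {g. (real_of_int (l g))\<^sup>2 < 1 / e} \<times> (UNIV :: bool set))"
      using v by blast
  qed
  then show ?thesis using fin finite_subset by blast
qed

lemma compact_crossed_resolvent_of_eigenbasis: "compact_bop (bop_powr (inverse_one_plus_sq dirac) (1 / 2))"
  using compact_resolvent_iff[OF selfadjoint_crossed_dirac[OF D(1)] crossed_basis_orthonormal_basis[OF B] crossed_eigenvector]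
    finite_large_eigenvalues by blast

text \<open>The power is split as \<open>(p + q) / 2 = p / 2 + q / 2\<close>, and each factor is estimated by one of the two bounds.\<close>

lemma crossed_summable_of_eigenbasis:
  assumes pq: "p > 0" "q > 0" and p: "summable_op p D" and q: "summable_op q (mult_op l)"
  shows "summable_op (p + q) dirac"
proof -
  define t where "t g = 1 / (1 + (real_of_int (l g))\<^sup>2)" for g
  define t' where "t' = t \<circ> inv (ell2_delta :: 'g \<Rightarrow> ('g, complex) ell2)"
  have t': "t' (ell2_delta g) = t g" for g by (simp add: t'_def inj_ell2_delta)
  have "bop_apply (inverse_one_plus_sq (mult_op l)) v = t' v *\<^sub>R v" if "v \<in> range ell2_delta" for v
    using that mult_op_resolvent[of l] t' by (auto simp: t_def)
  then have "(\<lambda>v. t' v powr (q / 2)) summable_on range ell2_delta"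
    using summable_op_iff[OF selfadjoint_mult_op ell2_delta_orthonormal_basis _ pq(2)] q by blast
  then have tq: "(\<lambda>g. t g powr (q / 2)) summable_on UNIV"
    using summable_on_reindex[OF inj_ell2_delta, of "\<lambda>v. t' v powr (q / 2)"] by (simp add: o_def t')
  have rp: "(\<lambda>b. r b powr (p / 2)) summable_on B"
    using summable_op_iff[OF D(1) B r pq(1)] p by blast
  have "(\<lambda>i. eigenvalue i powr ((p + q) / 2)) summable_on B \<times> (UNIV :: ('g \<times> bool) set)"
  proof (rule summable_on_product_bound[OF rp _ tq])
    fix b g s assume b: "b \<in> B"
    have "eigenvalue (b, g, s) powr ((p + q) / 2) = eigenvalue (b, g, s) powr (p / 2) * eigenvalue (b, g, s) powr (q / 2)"
      by (simp add: add_divide_distrib powr_add)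
    also have "\<dots> \<le> r b powr (p / 2) * t g powr (q / 2)"
      using pq eigenvalue_pos[OF b, of g s] eigenvalue_le_left[OF b, of g s] eigenvalue_le_right[OF b, of g s]
      by (intro mult_mono powr_mono2) (simp_all add: t_def)
    finally show "eigenvalue (b, g, s) powr ((p + q) / 2) \<le> r b powr (p / 2) * t g powr (q / 2)" .
  qed simp_all
  then have "(\<lambda>i. eigenvalue_at (crossed_basis i) powr ((p + q) / 2)) summable_on B \<times> (UNIV :: ('g \<times> bool) set)"
    by (rule summable_on_cong[THEN iffD1, rotated]) (simp add: eigenvalue_at)
  then have "(\<lambda>v. eigenvalue_at v powr ((p + q) / 2)) summable_on crossed_basis ` (B \<times> (UNIV :: ('g \<times> bool) set))"
    by (simp add: summable_on_reindex[OF crossed_basis_inj[OF orthonormal_basisD[OF B]]] o_def)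
  then show ?thesis
    using summable_op_iff[OF selfadjoint_crossed_dirac[OF D(1)] crossed_basis_orthonormal_basis[OF B] crossed_eigenvector, of "p + q"] pq
    by simp
qed

end

lemma compact_crossed_resolvent: "compact_bop (bop_powr (inverse_one_plus_sq dirac) (1 / 2))"
  using eigenbasis compact_crossed_resolvent_of_eigenbasis by metis

lemma crossed_summable:
  "p > 0 \<Longrightarrow> q > 0 \<Longrightarrow> summable_op p D \<Longrightarrow> summable_op q (mult_op l) \<Longrightarrow> summable_op (p + q) dirac"
  using eigenbasis crossed_summable_of_eigenbasis by metis

lemma has_commutator_crossed_Cc:
  assumes x: "x \<in> crossed_Cc \<A> \<pi> \<alpha>"
  shows "\<exists>S. has_commutator (half_dirac D s l) x S"
proof -
  obtain F f where F: "\<And>g. g \<in> F \<Longrightarrow> f g \<in> \<A>" "x = (\<Sum>g\<in>F. cov (f g) * tr g)"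
    using x by (rule crossed_CcE) (rule that)
  show ?thesis
    unfolding F(2)
  proof (rule has_commutator_sum)
    show "csubspace (half_dirac D s l)"
      using half_dirac_densely_defined[OF D(1)] densely_definedD(1) by blast
    fix h assume "h \<in> F"
    then have a: "f h \<in> \<A>" by (rule F)
    have bc: "bounded_commutator D (\<pi> (\<alpha> g (f h)))" for g using a inv by (intro \<A>_commutator) blast
    then obtain S where S: "has_commutator (half_dirac D s l) (cov (f h)) S"
      using has_commutator_cov[OF D(2) \<A>_in_A[OF a] bc bdd[OF a],
          where c = "\<lambda>g. \<i> * of_real (s * of_int (l g))"] by blast
    obtain C where C: "\<And>g. \<bar>l g - l (- h + g)\<bar> \<le> C"
      using l unfolding proper_translation_bounded_def by blast
    have "cmod (\<i> * of_real (s * of_int (l g)) - \<i> * of_real (s * of_int (l (- h + g)))) \<le> \<bar>s\<bar> * real_of_int C" for g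
    proof -
      have "\<i> * complex_of_real (s * of_int (l g)) - \<i> * of_real (s * of_int (l (- h + g)))
          = \<i> * of_real (s * real_of_int (l g - l (- h + g)))" by (simp add: algebra_simps)
      then have "cmod (\<i> * of_real (s * of_int (l g)) - \<i> * of_real (s * of_int (l (- h + g))))
          = \<bar>s\<bar> * real_of_int \<bar>l g - l (- h + g)\<bar>"
        by (simp only: norm_mult norm_of_real abs_mult) simp
      then show ?thesis using C[of g] by (simp add: mult_left_mono)
    qed
    then obtain S' where "has_commutator (half_dirac D s l) (tr h) S'"
      using has_commutator_translation[of "\<lambda>g. \<i> * of_real (s * of_int (l g))" h] by blast
    then show "\<exists>S. has_commutator (half_dirac D s l) (cov (f h) * tr h) S"
      using has_commutator_mult[OF S] by blast
  qed
qed

lemma bounded_commutator_crossed_Cc: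
  assumes "x \<in> crossed_Cc \<A> \<pi> \<alpha>"
  shows "bounded_commutator dirac (bop_dsum x x)"
proof -
  have dd: "densely_defined dirac" using selfadjoint_crossed_dirac[OF D(1), of l] by (simp add: selfadjoint_op_def)
  obtain C C' where "has_commutator (half_dirac D (- 1) l) x C" "has_commutator (half_dirac D 1 l) x C'"
    using has_commutator_crossed_Cc[OF assms, of "- 1"] has_commutator_crossed_Cc[OF assms, of 1] by auto
  then have "has_commutator dirac (bop_dsum x x) (bop_swap C C')"
    unfolding crossed_dirac_eq[OF D(1)] by (rule has_commutator_offdiag)
  then show ?thesis using bounded_commutator_iff[OF dd] by blast
qed

lemma crossed_even_spectral_triple:
  "even_spectral_triple (reduced_crossed_product A \<pi> \<alpha>) (crossed_Cc \<A> \<pi> \<alpha>) (\<lambda>x. bop_dsum x x) dirac"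
  unfolding even_spectral_triple_def
proof (intro conjI)
  have sep: "separable_space (top_of_set A)" "separable_space (euclidean :: 'h topology)"
    using triple by (simp_all add: odd_spectral_triple_def)
  have "crossed_Cc \<A> \<pi> \<alpha> \<subseteq> reduced_crossed_product A \<pi> \<alpha>"
    unfolding reduced_crossed_product_def using crossed_Cc_mono[OF \<A>(3)] closure_subset by blast
  then show "odd_spectral_triple (reduced_crossed_product A \<pi> \<alpha>) (crossed_Cc \<A> \<pi> \<alpha>) (\<lambda>x. bop_dsum x x) dirac"
    unfolding odd_spectral_triple_def
    by (intro conjI ballI crossed_product_unital_cstar crossed_product_separable sep countable_group
        separable_prod separable_ell2 bop_dsum_diagonal_hom crossed_Cc_star_subalgebra \<A> inv
        crossed_Cc_dense selfadjoint_crossed_dirac D compact_crossed_resolvent bounded_commutator_crossed_Cc)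
  have "cstar_hom (reduced_crossed_product A \<pi> \<alpha>) (\<lambda>x. x)" by (simp add: cstar_hom_def)
  then show "\<exists>\<pi>0 \<pi>1. cstar_hom (reduced_crossed_product A \<pi> \<alpha>) \<pi>0 \<and> cstar_hom (reduced_crossed_product A \<pi> \<alpha>) \<pi>1 \<and>
      (\<forall>a\<in>reduced_crossed_product A \<pi> \<alpha>. bop_dsum a a = bop_dsum (\<pi>0 a) (\<pi>1 a))" by blast
  show "\<exists>D0. densely_defined D0 \<and> dirac = op_offdiag D0 (op_adj D0)"
    using half_dirac_densely_defined[OF D(1), of "- 1" l] op_adj_half_dirac[OF D(1), of "- 1" l]
    unfolding crossed_dirac_eq[OF D(1)] by (intro exI[of _ "half_dirac D (- 1) l"]) simp
qed

text \<open>An element of the algebra maps \<open>\<xi> \<otimes> \<delta>\<^sub>0\<close> to a family whose value at \<open>k\<close> involves its coefficient at \<open>k\<close> alone.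
  Coefficients outside the support are set to 0, so that all of them lie in the subalgebra.\<close>

lemma crossed_Cc_coefficients:
  assumes x: "x \<in> crossed_Cc \<A> \<pi> \<alpha>"
  obtains F f where "\<And>g. f g \<in> \<A>" "x = (\<Sum>g\<in>F. cov (f g) * tr g)" "\<And>g. g \<notin> F \<Longrightarrow> f g = 0" "finite F"
    "\<And>\<xi> k. ell2_apply (bop_apply x (single \<xi> 0)) k = bop_apply (\<pi> (\<alpha> (- k) (f k))) \<xi>"
proof -
  obtain F f' where F: "finite F" "\<And>g. g \<in> F \<Longrightarrow> f' g \<in> \<A>" "x = (\<Sum>g\<in>F. cov (f' g) * tr g)"
    using x by (rule crossed_CcE) (rule that)
  define f where "f g = (if g \<in> F then f' g else 0)" for g
  have f: "f g \<in> \<A>" for g using F(2) complex_vector.subspace_0[OF \<A>(2)] by (simp add: f_def)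
  have x_eq: "x = (\<Sum>g\<in>F. cov (f g) * tr g)" unfolding F(3) by (intro sum.cong refl) (simp add: f_def)
  have zero: "\<pi> (\<alpha> h 0) = 0" for h
    using cstar_homD(1)[OF \<pi>_\<alpha>_hom A_zero A_zero, of h] by simp
  have "ell2_apply (bop_apply x (single \<xi> 0)) k = bop_apply (\<pi> (\<alpha> (- k) (f k))) \<xi>" for \<xi> k
  proof -
    have "ell2_apply (bop_apply x (single \<xi> 0)) k
        = (\<Sum>g\<in>F. bop_apply (\<pi> (\<alpha> (- k) (f g))) (ell2_apply (single \<xi> 0) (- g + k)))"
      unfolding x_eq sum_bop_apply ell2_apply_sum
      by (simp add: times_bop.rep_eq cov_apply \<A>_in_A f translation_apply)
    also have "\<dots> = (\<Sum>g\<in>F. if k = g then bop_apply (\<pi> (\<alpha> (- k) (f k))) \<xi> else 0)"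
    proof (intro sum.cong refl)
      fix g
      have "- g + k = 0 \<longleftrightarrow> k = g" by (metis add.assoc add.left_neutral add.right_neutral left_minus right_minus)
      then show "bop_apply (\<pi> (\<alpha> (- k) (f g))) (ell2_apply (single \<xi> 0) (- g + k))
          = (if k = g then bop_apply (\<pi> (\<alpha> (- k) (f k))) \<xi> else 0)"
        by (simp add: ell2_apply_single)
    qed
    also have "\<dots> = bop_apply (\<pi> (\<alpha> (- k) (f k))) \<xi>"
      using F(1) by (simp add: f_def zero zero_bop.rep_eq)
    finally show ?thesis .
  qed
  then show ?thesis using that[of f F] f x_eq F(1) by (simp add: f_def)
qed

lemma \<pi>_\<alpha>_eq_0: "a \<in> A \<Longrightarrow> \<pi> (\<alpha> h a) = 0 \<Longrightarrow> a = 0"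
proof -
  assume a: "a \<in> A" "\<pi> (\<alpha> h a) = 0"
  have "\<pi> 0 = 0" using \<pi>_hom(1)[OF A_zero A_zero] by simp
  then have "\<alpha> h a = 0" using a faithful \<alpha>_in A_zero by (metis inj_onD)
  moreover have "\<alpha> (- h) 0 = 0" using \<alpha>_homD(1)[OF A_zero A_zero, of "- h"] by simp
  moreover have "\<alpha> (- h) (\<alpha> h a) = a" using \<alpha>_inverse[OF a(1), of "- h"] by simp
  ultimately show "a = 0" by simp
qed

text \<open>An element commuting with both \<open>D \<otimes> 1 \<plusminus> i \<otimes> M\<^sub>l\<close> maps \<open>\<xi> \<otimes> \<delta>\<^sub>0\<close>, where the weight
  vanishes, to a vector on which both operators agree, hence into the fibre over the identity.\<close>

lemma commutator_zero_imp_scalar: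
  assumes nd: "nondegenerate A \<A> \<pi> D" and x: "x \<in> crossed_Cc \<A> \<pi> \<alpha>"
    and zero: "has_commutator dirac (bop_dsum x x) 0"
  shows "\<exists>c. x = c *\<^sub>C cov (unit_of A)"
proof -
  obtain F f where f: "\<And>g. f g \<in> \<A>" "x = (\<Sum>g\<in>F. cov (f g) * tr g)" "\<And>g. g \<notin> F \<Longrightarrow> f g = 0" "finite F"
    and coeff: "\<And>\<xi> k. ell2_apply (bop_apply x (single \<xi> 0)) k = bop_apply (\<pi> (\<alpha> (- k) (f k))) \<xi>"
    by (rule crossed_Cc_coefficients[OF x]) (rule that)
  have sub: "csubspace (half_dirac D s l)" for s
    using half_dirac_densely_defined[OF D(1)] densely_definedD(1) by blast
  have comm: "has_commutator (half_dirac D (- 1) l) x 0" "has_commutator (half_dirac D 1 l) x 0"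
    using has_commutator_offdiagD[OF zero[unfolded crossed_dirac_eq[OF D(1)]] sub sub] by blast+
  have fibre: "(bop_apply (\<pi> (\<alpha> (- k) (f k))) \<xi>, bop_apply (\<pi> (\<alpha> (- k) (f k))) \<eta>) \<in> shift_op D (\<i> * of_real (s * of_int (l k)))"
    if "(\<xi>, \<eta>) \<in> D" and s: "s = - 1 \<or> s = 1" for \<xi> \<eta> s k
  proof -
    have "(single \<xi> 0, single \<eta> 0) \<in> half_dirac D s l"
      by (rule fibre_op_single) (use that l_zero[of 0] in \<open>simp_all add: shift_op_csubspace D shift_op_iff\<close>)
    then have "(bop_apply x (single \<xi> 0), bop_apply x (single \<eta> 0) + bop_apply 0 (single \<xi> 0)) \<in> half_dirac D s l"
      using comm s has_commutatorD by blast
    then show ?thesis by (simp add: zero_bop.rep_eq fibre_op_iff coeff)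
  qed
  have f0: "f k = 0" if k: "k \<noteq> 0" for k
  proof -
    have "bop_apply (\<pi> (\<alpha> (- k) (f k))) \<xi> = bop_apply 0 \<xi>" if "\<xi> \<in> Domain D" for \<xi>
    proof -
      obtain \<eta> where \<eta>: "(\<xi>, \<eta>) \<in> D" using \<open>\<xi> \<in> Domain D\<close> by blast
      define \<zeta> where "\<zeta> = bop_apply (\<pi> (\<alpha> (- k) (f k))) \<xi>"
      define c where "c = \<i> * complex_of_real (of_int (l k))"
      define \<theta> where "\<theta> = bop_apply (\<pi> (\<alpha> (- k) (f k))) \<eta>"
      have "(\<zeta>, \<theta> - c *\<^sub>C \<zeta>) \<in> D" "(\<zeta>, \<theta> - (- c) *\<^sub>C \<zeta>) \<in> D"
        using fibre[OF \<eta>, of 1 k] fibre[OF \<eta>, of "- 1" k] by (simp_all add: shift_op_iff \<zeta>_def c_def \<theta>_def)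
      \<comment> \<open>Both values of the single-valued \<open>D\<close> at \<open>\<zeta>\<close> agree, so \<open>2 i l(k) \<zeta> = 0\<close>.\<close>
      then have "\<theta> - c *\<^sub>C \<zeta> = \<theta> - (- c) *\<^sub>C \<zeta>"
        using densely_definedD(2)[OF D(2)] by (rule single_valuedD[rotated])
      moreover have "(c + c) *\<^sub>C \<zeta> = (\<theta> - (- c) *\<^sub>C \<zeta>) - (\<theta> - c *\<^sub>C \<zeta>)"
        by (subst scaleC_add_left) (simp add: complex_vector.scale_minus_left)
      ultimately have "(c + c) *\<^sub>C \<zeta> = 0" by (simp only: diff_self)
      moreover have "c + c \<noteq> 0" using k l_zero[of k] by (simp add: c_def)
      ultimately show ?thesis by (simp add: \<zeta>_def zero_bop.rep_eq complex_vector.scale_eq_0_iff)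
    qed
    then have "\<pi> (\<alpha> (- k) (f k)) = 0" using bop_eq_on_dense[OF densely_definedD(3)[OF D(2)]] by blast
    then show ?thesis using \<pi>_\<alpha>_eq_0 \<A>_in_A f(1) by blast
  qed
  have "has_commutator D (\<pi> (f 0)) 0"
    unfolding has_commutator_def using fibre[of _ _ 1 0] l_zero[of 0]
    by (auto simp: \<alpha>_0 \<A>_in_A f(1) shift_op_iff zero_bop.rep_eq)
  then have "commutator D (\<pi> (f 0)) = 0" by (rule commutator_eq[OF D(2)])
  then obtain c where c: "f 0 = c *\<^sub>C unit_of A" using nd f(1) unfolding nondegenerate_def by blast
  have "x = (\<Sum>g\<in>F. if g = 0 then cov (f 0) else 0)"
    unfolding f(2) by (intro sum.cong refl) (simp add: f0 cov_0 translation_zero)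
  also have "\<dots> = cov (f 0)" using f(3,4) by (simp add: cov_0)
  finally have "x = cov (c *\<^sub>C unit_of A)" by (simp add: c)
  moreover have "unit_of A \<in> A" using is_unit_of_unit_of[OF A] by (simp add: is_unit_of_def)
  ultimately show ?thesis using cov_homD(3) by blast
qed

text \<open>The dense subalgebra may lack the unit. However, if a scalar multiple of the unit of the crossed product belongs
  to the algebra of finite sums, then its coefficient at the identity is the corresponding multiple of the unit
  of \<open>A\<close> and belongs to the subalgebra, where non-degeneracy of \<open>D\<close> applies; this coefficient is fixed by the action.\<close>

lemma scalar_imp_commutator_zero:
  assumes nd: "nondegenerate A \<A> \<pi> D" and x: "x \<in> crossed_Cc \<A> \<pi> \<alpha>" and c: "x = c *\<^sub>C cov (unit_of A)"
  shows "has_commutator dirac (bop_dsum x x) 0"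
proof -
  define a where "a = c *\<^sub>C unit_of A"
  have unit: "is_unit_of A (unit_of A)" by (rule is_unit_of_unit_of[OF A])
  then have e: "unit_of A \<in> A" by (simp add: is_unit_of_def)
  then have a: "a \<in> A" unfolding a_def using complex_vector.subspace_scale[OF alg(1)] by blast
  have x_eq: "x = cov a" unfolding c a_def by (rule cov_homD(3)[OF e, symmetric])
  have \<alpha>a: "\<alpha> g a = a" for g unfolding a_def by (simp add: \<alpha>_homD(3)[OF e] \<alpha>_unit[OF unit])
  obtain b where f: "b \<in> \<A>"
    "\<And>\<xi>. ell2_apply (bop_apply x (single \<xi> 0)) 0 = bop_apply (\<pi> (\<alpha> (- 0) b)) \<xi>"
    by (rule crossed_Cc_coefficients[OF x]) (rule that)
  have "bop_apply (\<pi> a) \<xi> = bop_apply (\<pi> (b)) \<xi>" for \<xi>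
    using f(2)[of \<xi>] by (simp add: x_eq cov_apply a \<alpha>_0 \<A>_in_A f(1) ell2_apply_single)
  then have "\<pi> a = \<pi> (b)" by (rule bop_eqI)
  then have "a = b" using faithful a \<A>_in_A[OF f(1)] by (metis inj_onD)
  then have a\<A>: "a \<in> \<A>" using f(1) by simp
  then have "commutator D (\<pi> a) = 0" using nd a_def unfolding nondegenerate_def by blast
  then have Ca: "commutator D (\<pi> (\<alpha> g a)) = 0" for g by (simp add: \<alpha>a)
  have zero: "fibre_bop (\<lambda>g. 0) = (0 :: ('g, 'h) ell2 bop)"
    using fibre_bop(2)[of "\<lambda>_. 0 :: 'h bop" 0] by simp
  have bc: "bounded_commutator D (\<pi> (\<alpha> g a))" for g using \<A>_commutator[OF a\<A>] by (simp add: \<alpha>a)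
  have "has_commutator (half_dirac D s l) x 0" for s
    using has_commutator_cov[OF D(2) a bc bdd[OF a\<A>]] by (simp add: x_eq Ca zero)
  then have "has_commutator dirac (bop_dsum x x) (bop_swap 0 0)"
    unfolding crossed_dirac_eq[OF D(1)] by (intro has_commutator_offdiag)
  moreover have "bop_swap 0 0 = (0 :: (('g, 'h) ell2 \<times> ('g, 'h) ell2) bop)"
    by (rule bop_eqI) (simp add: bop_swap.rep_eq zero_bop.rep_eq zero_prod_def)
  ultimately show ?thesis by simp
qed

lemma crossed_nondegenerate:
  assumes nd: "nondegenerate A \<A> \<pi> D"
  shows "nondegenerate (reduced_crossed_product A \<pi> \<alpha>) (crossed_Cc \<A> \<pi> \<alpha>) (\<lambda>x. bop_dsum x x) dirac"
  unfolding nondegenerate_def crossed_product_unit_of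
proof (intro conjI ballI)
  show "inj_on (\<lambda>x. bop_dsum x x) (reduced_crossed_product A \<pi> \<alpha>)"
    using bop_dsum_diagonal_inj inj_on_subset by blast
  fix x assume x: "x \<in> crossed_Cc \<A> \<pi> \<alpha>"
  have dd: "densely_defined dirac" using selfadjoint_crossed_dirac[OF D(1), of l] by (simp add: selfadjoint_op_def)
  have "commutator dirac (bop_dsum x x) = 0 \<longleftrightarrow> has_commutator dirac (bop_dsum x x) 0"
    using has_commutator_commutator[OF dd bounded_commutator_crossed_Cc[OF x]] commutator_eq[OF dd] by metis
  then show "commutator dirac (bop_dsum x x) = 0 \<longleftrightarrow> (\<exists>c. x = c *\<^sub>C cov (unit_of A))"
    using commutator_zero_imp_scalar[OF nd x] scalar_imp_commutator_zero[OF nd x] by blast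
qed

end

theorem theorem2p7:
  fixes A \<A> :: "'a::cstar_algebra set"
    and \<pi> :: "'a \<Rightarrow> 'h::chilbert_space bop"
    and D\<^sub>A :: "('h \<times> 'h) set"
    and l :: "'g::group_add \<Rightarrow> int"
    and \<alpha> :: "'g \<Rightarrow> 'a \<Rightarrow> 'a"
  assumes "odd_spectral_triple A \<A> \<pi> D\<^sub>A"
    and "inj_on \<pi> A"
    and "proper_translation_bounded l"
    and "action_on A \<alpha>"
    and "\<And>g. \<alpha> g ` \<A> \<subseteq> \<A>"
    and "\<And>a. a \<in> \<A> \<Longrightarrow> bdd_above (range (\<lambda>g. norm (commutator D\<^sub>A (\<pi> (\<alpha> g a)))))"
  shows "even_spectral_triple (reduced_crossed_product A \<pi> \<alpha>) (crossed_Cc \<A> \<pi> \<alpha>)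
      (\<lambda>x. bop_dsum x x) (crossed_dirac D\<^sub>A l) \<and>
    (\<forall>p q. p > 0 \<longrightarrow> q > 0 \<longrightarrow> summable_op p D\<^sub>A \<longrightarrow> summable_op q (mult_op l) \<longrightarrow>
      summable_op (p + q) (crossed_dirac D\<^sub>A l)) \<and>
    (nondegenerate A \<A> \<pi> D\<^sub>A \<longrightarrow>
      nondegenerate (reduced_crossed_product A \<pi> \<alpha>) (crossed_Cc \<A> \<pi> \<alpha>)
        (\<lambda>x. bop_dsum x x) (crossed_dirac D\<^sub>A l))"
proof -
  interpret crossed_triple A \<pi> \<alpha> \<A> D\<^sub>A l
    using assms by unfold_locales (simp_all add: odd_spectral_triple_def)
  show ?thesis
    using crossed_even_spectral_triple crossed_summable crossed_nondegenerate by blast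
qed

end
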